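(* Let $\widetilde f$ be a prediction procedure, $M\ge 1$ a fixed integer, and let $\widehat f^{\mathrm{zs}}$ be the zero-step predictor based on $\widetilde f$ (see context), trained on $\mathcal{D}_n$. Let $R^{\mathrm{det}}(\cdot;\widetilde f):\mathbb{N}\to\mathbb{R}_{\ge0}$ be a function and set $R^{\mathrm{det}}_{\nearrow}(n;\widetilde f)=\min_{\xi\in\Xi_n}R^{\mathrm{det}}(n_\xi;\widetilde f)$. Consider the conditions (DET) for all $\epsilon>0$, $\displaystyle\lim_{n\to\infty}\sup_{\xi\in\Xi_n}\mathbb{P}\left(\frac{|R(\widetilde f(\cdot;\mathcal{D}_{\mathrm{tr}}^{\xi,j}))-R^{\mathrm{det}}(n_\xi;\widetilde f)|}{R^{\mathrm{det}}(n_\xi;\widetilde f)}>\epsilon\right)=0$; (DET* ) for all $\epsilon>0$, $\displaystyle\lim_{n\to\infty}\mathbb{P}\left(\sup_{\xi\in\Xi_n}\frac{|R(\widetilde f(\cdot;\mathcal{D}_{\mathrm{tr}}^{\xi,j}))-R^{\mathrm{det}}(n_\xi;\widetilde f)|}{R^{\mathrm{det}}(n_\xi;\widetilde f)}>\epsilon\right)=0$; (O1) $\widehat\sigma_{\Xi}=O_p(1)$ and $R^{\mathrm{det}}_{\nearrow}(n;\widetilde f)\sqrt{n_{\mathrm{te}}/\log n}\to\infty$; (O2) $\widehat\kappa_{\Xi}=O_p(1)$. Then, as $n\to\infty$: (i) For $M=1$, if (DET* ) holds and either (O1) or (O2) holds, then $$\frac{|R(\widehat f^{\mathrm{zs}})-R^{\mathrm{det}}_{\nearrow}(n;\widetilde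 f)|}{R^{\mathrm{det}}_{\nearrow}(n;\widetilde f)}=o_p(1).$$ (ii) For $M\ge 1$, if $\ell(\cdot,\cdot)$ is convex in its second argument, (DET) holds, and either (O1) or (O2) holds, then $$\frac{(R(\widehat f^{\mathrm{zs}})-R^{\mathrm{det}}_{\nearrow}(n;\widetilde f))_+}{R^{\mathrm{det}}_{\nearrow}(n;\widetilde f)}=o_p(1).$$
   Context: $\mathcal{D}_n$ consists of $n$ i.i.d. observations $(X_i,Y_i)\in\mathbb{R}^{p}\times\mathbb{R}$ from a distribution $P$ ($p$ and $P$ may depend on $n$); $(X_0,Y_0)\sim P$ is independent of everything else; $\ell:\mathbb{R}\times\mathbb{R}\to\mathbb{R}_{\ge0}$ is a loss. A prediction procedure $\widetilde f$ maps a dataset $\mathcal{D}$ to a predictor $\widetilde f(\cdot;\mathcal{D}):\mathbb{R}^p\to\mathbb{R}$. The conditional risk of a predictor $f$ computed from the data is $R(f)=\int\ell(y,f(x))\,dP(x,y)$. Zero-step procedure: fix $\nu\in(0,1)$; let $n_{\mathrm{te}}<n$, $n_{\mathrm{tr}}=n-n_{\mathrm{te}}$, where $n_{\mathrm{te}}/n\to0$ and $\log n/n_{\mathrm{te}}\to0$. Put $\Xi_n=\{1,2,\dots,\lceil n_{\mathrm{tr}}/\lfloor n^{\nu}\rfloor-2\rceil\}$ and $n_\xi=n_{\mathrm{tr}}-\xi\lfloor n^\nu\rfloor$. Split $\mathcal{D}_n$ at random into $\mathcal{D}_{\mathrm{tr}}$ (size $n_{\mathrm{tr}}$) and $\mathcal{D}_{\mathrm{te}}$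 (size $n_{\mathrm{te}}$, index set $\mathcal{I}_{\mathrm{te}}$). For $\xi\in\Xi_n$ and $1\le j\le M$ let $\mathcal{D}_{\mathrm{tr}}^{\xi,j}$ be random subsets of $\mathcal{D}_{\mathrm{tr}}$ of size $n_\xi$, drawn independently over $j$ (with replacement) uniformly from all subsets of that size, and set $\widehat f^{\xi}(x)=\frac1M\sum_{j=1}^M\widetilde f(x;\mathcal{D}_{\mathrm{tr}}^{\xi,j})$. Let $\widehat R(\widehat f^{\xi})$ be either the average of $\ell(Y_i,\widehat f^{\xi}(X_i))$, $i\in\mathcal{I}_{\mathrm{te}}$ (choice $\mathtt{AVG}$), or their median-of-means (choice $\mathtt{MOM}$) with $\eta=n^{-A}/|\Xi_n|$ for a fixed $A>0$, i.e. the median of the averages over $\lceil8\log(1/\eta)\rceil$ batches of these values. Let $\widehat\xi\in\arg\min_{\xi\in\Xi_n}\widehat R(\widehat f^\xi)$ and $\widehat f^{\mathrm{zs}}=\widehat f^{\widehat\xi}$. Since the $\mathcal{D}_{\mathrm{tr}}^{\xi,j}$ are identically distributed over $j$, condition (DET) does not depend on $j$; (DET* ) is used with $j=1$. Definitions: $\widehat\sigma_\xi$ is the conditional norm (given the data) of $\ell(Y_0,\widehat f^\xi(X_0))$: the $\psi_1$ norm $\inf\{C>0:\mathbb{E}[\exp(|\ell(Y_0,\widehat f^\xi(X_0))|/C)\mid\mathcal{D}_n]\le2\}$ if $\mathtt{AVG}$ is used, and either this $\psi_1$ norm or the $L_2$ norm $(\mathbb{E}[\ell(Y_0,\widehat f^\xi(X_0))^2\mid\mathcal{D}_n])^{1/2}$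 if $\mathtt{MOM}$ is used. $\widehat\sigma_\Xi=\max_{\xi\in\Xi_n}\widehat\sigma_\xi$ and $\widehat\kappa_\Xi=\max_{\xi\in\Xi_n}\widehat\sigma_\xi/R(\widehat f^\xi)$. $(a)_+=\max\{a,0\}$. The values $R^{\mathrm{det}}(n_\xi;\widetilde f)$ are positive where divided by. *)

theory Defs
  imports "HOL-Probability.Probability"
begin

text \<open>
  The dimension may vary with \<open>n\<close>, so a vector of \<open>\<real>\<^sup>d\<close> is a function
  extensional on \<open>{..<d}\<close>, measured by the product of Borel sigma-algebras.
\<close>

type_synonym point = "nat \<Rightarrow> real"
type_synonym observation = "point \<times> real"
type_synonym predictor = "point \<Rightarrow> real"

definition point_space :: "nat \<Rightarrow> point measure" where
  "point_space d = (\<Pi>\<^sub>M k\<in>{..<d}. borel)"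

definition obs_space :: "nat \<Rightarrow> observation measure" where
  "obs_space d = point_space d \<Otimes>\<^sub>M borel"

text \<open>
  A dataset is the list of its observations (repetitions are possible). A prediction procedure
  receives the dimension and the dataset; invariance under reordering is not required.
\<close>

type_synonym procedure = "nat \<Rightarrow> observation list \<Rightarrow> predictor"

definition measurable_procedure :: "procedure \<Rightarrow> bool" where
  "measurable_procedure f \<longleftrightarrow> (\<forall>d. \<forall>m\<ge>1.
     (\<lambda>(z, x). f d (map z [0..<m]) x)
       \<in> borel_measurable ((\<Pi>\<^sub>M i\<in>{..<m}. obs_space d) \<Otimes>\<^sub>M point_space d))"

definition dataset :: "(nat \<Rightarrow> observation) \<Rightarrow> nat set \<Rightarrow> observation list" where
  "dataset z S = map z (sorted_list_of_set S)"


text \<open>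
  Risk and norms of the loss on a fresh observation, for a fixed predictor. Evaluated at a predictor
  computed from the data, they are the conditional quantities given the data, because the fresh
  observation is independent of everything else. They may be infinite.
\<close>

definition risk :: "(real \<Rightarrow> real \<Rightarrow> real) \<Rightarrow> observation measure \<Rightarrow> predictor \<Rightarrow> ennreal" where
  "risk l P f = (\<integral>\<^sup>+ (x, y). ennreal (l y (f x)) \<partial>P)"

definition psi1_norm :: "'a measure \<Rightarrow> ('a \<Rightarrow> real) \<Rightarrow> ennreal" where
  "psi1_norm P W = (INF C\<in>{C::real. 0 < C \<and> (\<integral>\<^sup>+ z. ennreal (exp (\<bar>W z\<bar> / C)) \<partial>P) \<le> 2}. ennreal C)"

definition L2_norm_of :: "'a measure \<Rightarrow> ('a \<Rightarrow> real) \<Rightarrow> ennreal" where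
  "L2_norm_of P W = (let I = (\<integral>\<^sup>+ z. ennreal ((W z)\<^sup>2) \<partial>P)
                     in if I = \<infinity> then \<infinity> else ennreal (sqrt (enn2real I)))"

datatype norm_kind = Psi1 | L2

fun loss_norm ::
    "norm_kind \<Rightarrow> (real \<Rightarrow> real \<Rightarrow> real) \<Rightarrow> observation measure \<Rightarrow> predictor \<Rightarrow> ennreal" where
  "loss_norm Psi1 l P f = psi1_norm P (\<lambda>(x, y). l y (f x))"
| "loss_norm L2 l P f = L2_norm_of P (\<lambda>(x, y). l y (f x))"


definition median :: "real list \<Rightarrow> real" where
  "median xs = (let ys = sort xs in (ys ! ((length ys - 1) div 2) + ys ! (length ys div 2)) / 2)"

text \<open>
  \<open>g\<close> assigns the positions \<open>k < m\<close> to \<open>B\<close> batches whose sizes are as equal as possible.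
\<close>

definition equal_batches :: "nat \<Rightarrow> nat \<Rightarrow> (nat \<Rightarrow> nat) \<Rightarrow> bool" where
  "equal_batches m B g \<longleftrightarrow> (\<forall>k<m. g k < B) \<and>
     (\<forall>b<B. card {k. k < m \<and> g k = b} \<in> {m div B, m div B + 1})"

definition median_of_means :: "nat \<Rightarrow> (nat \<Rightarrow> nat) \<Rightarrow> real list \<Rightarrow> real" where
  "median_of_means B g ws = median (map (\<lambda>b.
     (\<Sum>k | k < length ws \<and> g k = b. ws ! k) / real (card {k. k < length ws \<and> g k = b})) [0..<B])"

datatype estimator = AVG | MOM


text \<open>
  All fields indexed by \<open>n\<close> form a triangular array: the \<open>n\<close>-th experiment lives on its own
  probability space. Observations are indexed by \<open>{1..n}\<close>; the test set and the subsamples are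
  given by their index sets.
\<close>

record 'w zero_step =
  prob_of :: "nat \<Rightarrow> 'w measure"
  pdim :: "nat \<Rightarrow> nat"
  law :: "nat \<Rightarrow> observation measure"
  obs :: "nat \<Rightarrow> nat \<Rightarrow> 'w \<Rightarrow> observation"
  lossfun :: "real \<Rightarrow> real \<Rightarrow> real"
  proc :: procedure
  bags :: nat
  nu :: real
  n_test :: "nat \<Rightarrow> nat"
  test_set :: "nat \<Rightarrow> 'w \<Rightarrow> nat set"
  subsample :: "nat \<Rightarrow> nat \<Rightarrow> nat \<Rightarrow> 'w \<Rightarrow> nat set"  (* n, xi, j *)
  est :: estimator
  mom_A :: real
  batch :: "nat \<Rightarrow> nat \<Rightarrow> nat"  (* n, position in the test set *)
  norm_choice :: norm_kind
  xihat :: "nat \<Rightarrow> 'w \<Rightarrow> nat"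

definition n_train :: "'w zero_step \<Rightarrow> nat \<Rightarrow> nat" where
  "n_train E n = n - n_test E n"

definition block :: "'w zero_step \<Rightarrow> nat \<Rightarrow> nat" where
  "block E n = nat \<lfloor>real n powr nu E\<rfloor>"

definition grid :: "'w zero_step \<Rightarrow> nat \<Rightarrow> nat set" where
  "grid E n = {1..nat \<lceil>real (n_train E n) / real (block E n) - 2\<rceil>}"

text \<open>For \<open>n \<ge> 1\<close> and \<open>\<xi>\<close> in the grid the subtraction below is not truncated:
  \<open>\<xi> * block E n + block E n < n_train E n\<close>.\<close>

definition sub_size :: "'w zero_step \<Rightarrow> nat \<Rightarrow> nat \<Rightarrow> nat" where
  "sub_size E n \<xi> = n_train E n - \<xi> * block E n"

definition base_predictor :: "'w zero_step \<Rightarrow> nat \<Rightarrow> nat \<Rightarrow> nat \<Rightarrow> 'w \<Rightarrow> predictor" where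
  "base_predictor E n \<xi> j \<omega> =
     proc E (pdim E n) (dataset (\<lambda>i. obs E n i \<omega>) (subsample E n \<xi> j \<omega>))"

definition bagged_predictor :: "'w zero_step \<Rightarrow> nat \<Rightarrow> nat \<Rightarrow> 'w \<Rightarrow> predictor" where
  "bagged_predictor E n \<xi> \<omega> =
     (\<lambda>x. (\<Sum>j = 1..bags E. base_predictor E n \<xi> j \<omega> x) / real (bags E))"

definition zs_predictor :: "'w zero_step \<Rightarrow> nat \<Rightarrow> 'w \<Rightarrow> predictor" where
  "zs_predictor E n \<omega> = bagged_predictor E n (xihat E n \<omega>) \<omega>"

definition Risk :: "'w zero_step \<Rightarrow> nat \<Rightarrow> predictor \<Rightarrow> ennreal" where
  "Risk E n f = risk (lossfun E) (law E n) f"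

definition mom_batches :: "'w zero_step \<Rightarrow> nat \<Rightarrow> nat" where
  "mom_batches E n =
     (let \<eta> = real n powr (- mom_A E) / real (card (grid E n)) in nat \<lceil>8 * ln (1 / \<eta>)\<rceil>)"

definition est_risk :: "'w zero_step \<Rightarrow> nat \<Rightarrow> 'w \<Rightarrow> predictor \<Rightarrow> real" where
  "est_risk E n \<omega> f =
     (let W = (\<lambda>i. lossfun E (snd (obs E n i \<omega>)) (f (fst (obs E n i \<omega>)))) in
      case est E of
        AVG \<Rightarrow> (\<Sum>i\<in>test_set E n \<omega>. W i) / real (card (test_set E n \<omega>))
      | MOM \<Rightarrow> median_of_means (mom_batches E n) (batch E n)
                 (map W (sorted_list_of_set (test_set E n \<omega>))))"


definition test_splits :: "'w zero_step \<Rightarrow> nat \<Rightarrow> nat set set" where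
  "test_splits E n = {T. T \<subseteq> {1..n} \<and> card T = n_test E n}"

definition train_subsets :: "'w zero_step \<Rightarrow> nat \<Rightarrow> nat \<Rightarrow> nat set \<Rightarrow> nat set set" where
  "train_subsets E n \<xi> T = {S. S \<subseteq> {1..n} - T \<and> card S = sub_size E n \<xi>}"

text \<open>
  The joint law of the split and of the \<open>M\<close> subsamples for one \<open>\<xi>\<close>: a uniform split, then, given
  the split, independent uniform subsets of the training indices.
\<close>

definition split_subsample_law ::
    "'w zero_step \<Rightarrow> nat \<Rightarrow> nat \<Rightarrow> (nat set \<times> (nat \<Rightarrow> nat set)) pmf" where
  "split_subsample_law E n \<xi> =
     bind_pmf (pmf_of_set (test_splits E n)) (\<lambda>T.
       map_pmf (Pair T) (Pi_pmf {1..bags E} {} (\<lambda>_. pmf_of_set (train_subsets E n \<xi> T))))"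

definition data :: "'w zero_step \<Rightarrow> nat \<Rightarrow> 'w \<Rightarrow> nat \<Rightarrow> observation" where
  "data E n \<omega> = (\<lambda>i\<in>{1..n}. obs E n i \<omega>)"

definition randomization ::
    "'w zero_step \<Rightarrow> nat \<Rightarrow> 'w \<Rightarrow> nat set \<times> (nat \<Rightarrow> nat \<Rightarrow> nat set)" where
  "randomization E n \<omega> =
     (test_set E n \<omega>, \<lambda>\<xi>\<in>grid E n. \<lambda>j\<in>{1..bags E}. subsample E n \<xi> j \<omega>)"

text \<open>
  The \<open>n\<close>-th experiment. The joint law of the subsamples across different \<open>\<xi>\<close> is left arbitrary;
  split and subsamples are jointly independent of the data. The index sets are required to have
  the right shape at every \<open>\<omega>\<close>, not only almost surely, since the probability spaces need not be
  complete and \<open>measure\<close> is \<open>0\<close> on non-measurable sets.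
\<close>

definition zs_experiment :: "'w zero_step \<Rightarrow> nat \<Rightarrow> bool" where
  "zs_experiment E n \<longleftrightarrow>
     0 < n_test E n \<and> n_test E n < n \<and>
     prob_space (prob_of E n) \<and>
     prob_space (law E n) \<and> sets (law E n) = sets (obs_space (pdim E n)) \<and>
     prob_space.indep_vars (prob_of E n) (\<lambda>_. law E n) (obs E n) {1..n} \<and>
     (\<forall>i\<in>{1..n}. distr (prob_of E n) (law E n) (obs E n i) = law E n) \<and>
     (\<forall>\<omega>\<in>space (prob_of E n). test_set E n \<omega> \<in> test_splits E n \<and>
        (\<forall>\<xi>\<in>grid E n. \<forall>j\<in>{1..bags E}.
           subsample E n \<xi> j \<omega> \<in> train_subsets E n \<xi> (test_set E n \<omega>))) \<and>
     (\<forall>\<xi>\<in>grid E n.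
        distr (prob_of E n) (count_space UNIV)
          (\<lambda>\<omega>. (test_set E n \<omega>, \<lambda>j. if j \<in> {1..bags E} then subsample E n \<xi> j \<omega> else {}))
        = measure_pmf (split_subsample_law E n \<xi>)) \<and>
     prob_space.indep_set (prob_of E n)
       {data E n -` A \<inter> space (prob_of E n) | A. A \<in> sets (\<Pi>\<^sub>M i\<in>{1..n}. law E n)}
       {randomization E n -` B \<inter> space (prob_of E n) | B. B \<in> UNIV} \<and>
     (est E = MOM \<longrightarrow> equal_batches (n_test E n) (mom_batches E n) (batch E n)) \<and>
     xihat E n \<in> measurable (prob_of E n) (count_space UNIV) \<and>
     (\<forall>\<omega>\<in>space (prob_of E n).
        is_arg_min (\<lambda>\<xi>. est_risk E n \<omega> (bagged_predictor E n \<xi> \<omega>)) (\<lambda>\<xi>. \<xi> \<in> grid E n)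
          (xihat E n \<omega>))"

text \<open>
  For small \<open>n\<close> the grid may be empty, so the experiments are only required to exist eventually.
\<close>

definition zero_step_setting :: "'w zero_step \<Rightarrow> bool" where
  "zero_step_setting E \<longleftrightarrow>
     1 \<le> bags E \<and> 0 < nu E \<and> nu E < 1 \<and> 0 < mom_A E \<and>
     (\<forall>y a. 0 \<le> lossfun E y a) \<and>
     (\<lambda>(y, a). lossfun E y a) \<in> borel_measurable (borel \<Otimes>\<^sub>M borel) \<and>
     measurable_procedure (proc E) \<and>
     (est E = AVG \<longrightarrow> norm_choice E = Psi1) \<and>
     (\<lambda>n. real (n_test E n) / real n) \<longlonglongrightarrow> 0 \<and>
     (\<lambda>n. ln (real n) / real (n_test E n)) \<longlonglongrightarrow> 0 \<and>
     (\<forall>\<^sub>F n in sequentially. zs_experiment E n)"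


definition sigma_hat :: "'w zero_step \<Rightarrow> nat \<Rightarrow> nat \<Rightarrow> 'w \<Rightarrow> ennreal" where
  "sigma_hat E n \<xi> \<omega> =
     loss_norm (norm_choice E) (lossfun E) (law E n) (bagged_predictor E n \<xi> \<omega>)"

definition sigma_max :: "'w zero_step \<Rightarrow> nat \<Rightarrow> 'w \<Rightarrow> ennreal" where
  "sigma_max E n \<omega> = (MAX \<xi>\<in>grid E n. sigma_hat E n \<xi> \<omega>)"

text \<open>
  \<open>\<infinity> / \<infinity>\<close> would be \<open>0\<close> in \<open>ennreal\<close>; an infinite norm has to give an infinite ratio. If the
  risk vanishes so does the norm, and then \<open>0 / 0 = 0\<close>.
\<close>

definition kappa_hat :: "'w zero_step \<Rightarrow> nat \<Rightarrow> nat \<Rightarrow> 'w \<Rightarrow> ennreal" where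
  "kappa_hat E n \<xi> \<omega> =
     (if sigma_hat E n \<xi> \<omega> = \<infinity> then \<infinity>
      else sigma_hat E n \<xi> \<omega> / Risk E n (bagged_predictor E n \<xi> \<omega>))"

definition kappa_max :: "'w zero_step \<Rightarrow> nat \<Rightarrow> 'w \<Rightarrow> ennreal" where
  "kappa_max E n \<omega> = (MAX \<xi>\<in>grid E n. kappa_hat E n \<xi> \<omega>)"

definition Op1 :: "(nat \<Rightarrow> 'w measure) \<Rightarrow> (nat \<Rightarrow> 'w \<Rightarrow> ennreal) \<Rightarrow> bool" where
  "Op1 Q X \<longleftrightarrow> (\<forall>\<epsilon>>0. \<exists>K::real. \<forall>\<^sub>F n in sequentially.
     measure (Q n) {\<omega>\<in>space (Q n). ennreal K < X n \<omega>} \<le> \<epsilon>)"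

definition op1 :: "(nat \<Rightarrow> 'w measure) \<Rightarrow> (nat \<Rightarrow> 'w \<Rightarrow> ereal) \<Rightarrow> bool" where
  "op1 Q X \<longleftrightarrow> (\<forall>\<epsilon>::real. 0 < \<epsilon> \<longrightarrow>
     (\<lambda>n. measure (Q n) {\<omega>\<in>space (Q n). ereal \<epsilon> < \<bar>X n \<omega>\<bar>}) \<longlonglongrightarrow> 0)"

text \<open>Relative deviations are computed in \<open>ereal\<close>, where an infinite risk gives \<open>\<infinity>\<close>.\<close>

definition rel_dev :: "ennreal \<Rightarrow> real \<Rightarrow> ereal" where
  "rel_dev R r = \<bar>enn2ereal R - ereal r\<bar> / ereal r"

definition rel_excess :: "ennreal \<Rightarrow> real \<Rightarrow> ereal" where
  "rel_excess R r = max (enn2ereal R - ereal r) 0 / ereal r"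

definition Rdet_min :: "'w zero_step \<Rightarrow> (nat \<Rightarrow> real) \<Rightarrow> nat \<Rightarrow> real" where
  "Rdet_min E Rdet n = (MIN \<xi>\<in>grid E n. Rdet (sub_size E n \<xi>))"

definition DET :: "'w zero_step \<Rightarrow> (nat \<Rightarrow> real) \<Rightarrow> bool" where
  "DET E Rdet \<longleftrightarrow> (\<forall>\<epsilon>::real. 0 < \<epsilon> \<longrightarrow>
     (\<lambda>n. SUP \<xi>\<in>grid E n. measure (prob_of E n)
        {\<omega>\<in>space (prob_of E n).
           ereal \<epsilon> < rel_dev (Risk E n (base_predictor E n \<xi> 1 \<omega>)) (Rdet (sub_size E n \<xi>))})
     \<longlonglongrightarrow> 0)"

definition DET_star :: "'w zero_step \<Rightarrow> (nat \<Rightarrow> real) \<Rightarrow> bool" where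
  "DET_star E Rdet \<longleftrightarrow> (\<forall>\<epsilon>::real. 0 < \<epsilon> \<longrightarrow>
     (\<lambda>n. measure (prob_of E n)
        {\<omega>\<in>space (prob_of E n).
           ereal \<epsilon> < (SUP \<xi>\<in>grid E n.
             rel_dev (Risk E n (base_predictor E n \<xi> 1 \<omega>)) (Rdet (sub_size E n \<xi>)))})
     \<longlonglongrightarrow> 0)"

definition O1 :: "'w zero_step \<Rightarrow> (nat \<Rightarrow> real) \<Rightarrow> bool" where
  "O1 E Rdet \<longleftrightarrow> Op1 (prob_of E) (sigma_max E) \<and>
     filterlim (\<lambda>n. Rdet_min E Rdet n * sqrt (real (n_test E n) / ln (real n))) at_top sequentially"

definition O2 :: "'w zero_step \<Rightarrow> bool" where
  "O2 E \<longleftrightarrow> Op1 (prob_of E) (kappa_max E)"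

end

theory Submission
  imports Defs
begin

text \<open>
  The zero-step procedure picks the minimizer of the estimated risks over the grid. If all estimated
  risks are close to the true risks, the selected predictor is almost as good as the one at any fixed
  grid point, in particular at the deterministic point \<open>\<xi>\<close> at which
  \<open>Rdet (sub_size E n \<xi>)\<close> attains its minimum \<open>r = Rdet_min E Rdet n\<close>. At this single point (DET)
  applies: every base predictor has risk at most \<open>(1 + \<delta>) r\<close> with high probability, and averaging
  a fixed number of them keeps the bound if the loss is convex. Hence control at each single grid point
  gives the upper bound. For the lower bound in the case of one bag, (DET*) controls all grid points
  at once, so the selected predictor, whichever it is, has risk at least \<open>(1 - \<delta>) r\<close>.

  Closeness of estimated and true risks is a concentration statement. Given the training data, the
  split and the subsamples, the losses on the test set are independent with mean the conditional risk,
  and their norm is \<open>sigma_hat\<close>. For \<open>AVG\<close>, finiteness of the \<open>\<psi>\<^sub>1\<close> norm gives a Chernoff bound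
  (\<open>average_concentration\<close>); for \<open>MOM\<close>, Chebyshev's inequality makes each batch mean accurate with
  probability at least \<open>7/8\<close>, and the median fails only if half of the independent batches fail
  (\<open>batch_means_concentration\<close>, \<open>median_of_majority\<close>). In both cases the error at one \<open>\<xi>\<close> is at most
  \<open>rate E n * sigma_hat E n \<xi>\<close>, where \<open>rate E n\<close> has the order of \<open>sqrt (ln n / n_test)\<close>, and the failure
  probability is so small that it can be summed over the at most \<open>n\<close> grid points
  (\<open>uniform_concentration\<close>). Condition (O1) bounds this error by \<open>\<delta> r\<close>, condition (O2) by \<open>\<delta>\<close> times
  the risk \<open>R\<close>; both are covered by the bound \<open>\<delta> (R + r)\<close> (\<open>eventually_est_close\<close>), from which
  the comparison of the two predictors is elementary (\<open>select_near_minimizer\<close>).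

  Conditioning is elementary because the split and the subsamples take finitely many values: an event
  that depends on them and on the data is a finite mixture of events of the data alone
  (\<open>mixture_prob\<close>), and for each value Fubini's theorem separates the test coordinates from the training
  coordinates (\<open>deviation_prob_trained_predictor\<close>). The norms, risks and relative deviations are shown to
  be measurable along the way: \<open>measure\<close> is \<open>0\<close> on non-measurable sets, so only for
  measurable events do the hypotheses carry information.
\<close>

section \<open>Exponential bounds for averages\<close>

text \<open>
  The \<open>\<psi>\<^sub>1\<close> norm is an infimum that need not be attained, and a norm may be \<open>0\<close>. Both
  difficulties disappear if a tail bound is proved for all \<open>C > \<sigma>\<close> and then passed to \<open>\<sigma>\<close> by
  continuity of the measure from below.
\<close>
lemma (in prob_space) prob_gr_limit_le:
  fixes X :: "'a \<Rightarrow> real"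
  assumes [measurable]: "X \<in> borel_measurable M"
    and le: "\<And>C. \<sigma> < C \<Longrightarrow> prob {\<omega>\<in>space M. c * C < X \<omega>} \<le> \<delta>"
    and c: "0 \<le> c"
  shows "prob {\<omega>\<in>space M. c * \<sigma> < X \<omega>} \<le> \<delta>"
proof -
  define A where "A k = {\<omega>\<in>space M. c * (\<sigma> + inverse (real (Suc k))) < X \<omega>}" for k
  have lim: "(\<lambda>k. c * (\<sigma> + inverse (real (Suc k)))) \<longlonglongrightarrow> c * \<sigma>"
    using tendsto_mult[OF tendsto_const tendsto_add[OF tendsto_const LIMSEQ_inverse_real_of_nat]]
    by simp
  have U: "{\<omega>\<in>space M. c * \<sigma> < X \<omega>} = (\<Union>k. A k)"
  proof (intro equalityI subsetI)
    fix \<omega> assume \<omega>: "\<omega> \<in> {\<omega>\<in>space M. c * \<sigma> < X \<omega>}"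
    then have "\<forall>\<^sub>F k in sequentially. c * (\<sigma> + inverse (real (Suc k))) < X \<omega>"
      using order_tendstoD(2)[OF lim] by simp
    then show "\<omega> \<in> (\<Union>k. A k)"
      using \<omega> by (auto simp: A_def eventually_sequentially)
  next
    fix \<omega> assume "\<omega> \<in> (\<Union>k. A k)"
    then obtain k where k: "\<omega> \<in> space M" "c * (\<sigma> + inverse (real (Suc k))) < X \<omega>"
      by (auto simp: A_def)
    have "c * \<sigma> \<le> c * (\<sigma> + inverse (real (Suc k)))"
      using c by (intro mult_left_mono) auto
    then show "\<omega> \<in> {\<omega>\<in>space M. c * \<sigma> < X \<omega>}" using k by auto
  qed
  have "incseq A"
  proof (rule incseq_SucI, rule subsetI)
    fix k \<omega> assume "\<omega> \<in> A k"
    moreover have "c * (\<sigma> + inverse (real (Suc (Suc k)))) \<le> c * (\<sigma> + inverse (real (Suc k)))"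
      using c by (intro mult_left_mono add_left_mono le_imp_inverse_le) auto
    ultimately show "\<omega> \<in> A (Suc k)" by (auto simp: A_def)
  qed
  then have "(\<lambda>k. prob (A k)) \<longlonglongrightarrow> prob (\<Union>k. A k)"
    by (intro finite_Lim_measure_incseq) (auto simp: A_def[abs_def])
  moreover have "prob (A k) \<le> \<delta>" for k
    unfolding A_def by (intro le) simp
  ultimately show ?thesis
    unfolding U by (intro LIMSEQ_le_const2) auto
qed

lemma exp_le_taylor2: "exp u \<le> 1 + u + u\<^sup>2 / 2 * exp \<bar>u\<bar>" for u :: real
proof -
  obtain t where t: "\<bar>t\<bar> \<le> \<bar>u\<bar>" "exp u = (\<Sum>m<2. u ^ m / fact m) + exp t / fact 2 * u ^ 2"
    using Maclaurin_exp_le[of u 2] by auto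
  have "exp t \<le> exp \<bar>u\<bar>" using t(1) by simp
  then have "exp t * u\<^sup>2 \<le> exp \<bar>u\<bar> * u\<^sup>2" by (intro mult_right_mono) auto
  then show ?thesis using t(2) by (simp add: numeral_2_eq_2 field_simps)
qed

lemma square_le_exp: "0 \<le> x \<Longrightarrow> x\<^sup>2 \<le> 2 * (exp x - 1)" for x :: real
  using exp_lower_Taylor_quadratic[of x] by simp

text \<open>
  A second order Taylor expansion of \<open>exp (\<kappa> Y)\<close> has remainder \<open>(\<kappa> Y)\<^sup>2 / 2 * exp \<bar>\<kappa> Y\<bar>\<close>. For
  \<open>\<bar>\<kappa>\<bar> \<le> 1 / (2 C)\<close> the second factor is at most \<open>exp h\<close> with \<open>h = Y / (2 C)\<close>, and \<open>h\<^sup>2\<close> is absorbed by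
  another \<open>exp h\<close>, so the remainder is bounded by a multiple of the integrable \<open>exp (Y / C)\<close>.
\<close>
lemma (in prob_space) mgf_centered_le:
  fixes Y :: "'a \<Rightarrow> real"
  assumes [measurable]: "Y \<in> borel_measurable M" and pos: "\<And>\<omega>. 0 \<le> Y \<omega>"
    and C: "0 < C" and psi: "(\<integral>\<^sup>+\<omega>. ennreal (exp (Y \<omega> / C)) \<partial>M) \<le> 2"
    and \<kappa>: "\<bar>\<kappa>\<bar> \<le> 1 / (2 * C)"
  shows "(\<integral>\<^sup>+\<omega>. ennreal (exp (\<kappa> * (Y \<omega> - expectation Y))) \<partial>M) \<le> ennreal (exp (8 * \<kappa>\<^sup>2 * C\<^sup>2))"
proof -
  have intE: "integrable M (\<lambda>\<omega>. exp (Y \<omega> / C))"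
  proof (rule integrableI_nonneg)
    show "(\<integral>\<^sup>+\<omega>. ennreal (exp (Y \<omega> / C)) \<partial>M) < \<infinity>"
      using psi by (rule le_less_trans) simp
  qed auto
  have E2: "expectation (\<lambda>\<omega>. exp (Y \<omega> / C)) \<le> 2"
    by (subst integral_eq_nn_integral) (use psi in \<open>auto intro!: enn2real_leI\<close>)
  have intY: "integrable M Y"
  proof (rule Bochner_Integration.integrable_bound[of _ "\<lambda>\<omega>. C * exp (Y \<omega> / C)"])
    show "AE \<omega> in M. norm (Y \<omega>) \<le> norm (C * exp (Y \<omega> / C))"
    proof (rule AE_I2)
      fix \<omega>
      have "Y \<omega> / C \<le> exp (Y \<omega> / C)" using exp_ge_add_one_self[of "Y \<omega> / C"] by linarith
      then show "norm (Y \<omega>) \<le> norm (C * exp (Y \<omega> / C))"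
        using C pos[of \<omega>] by (simp add: field_simps)
    qed
  qed (use intE in auto)
  have pt: "exp (\<kappa> * Y \<omega>) \<le> 1 + \<kappa> * Y \<omega> + 4 * C\<^sup>2 * \<kappa>\<^sup>2 * exp (Y \<omega> / C)" for \<omega>
  proof -
    define h where "h = Y \<omega> / (2 * C)"
    have h0: "0 \<le> h" and Yh: "Y \<omega> = 2 * C * h" using pos[of \<omega>] C by (auto simp: h_def)
    have "\<bar>\<kappa> * Y \<omega>\<bar> \<le> h"
      using mult_right_mono[OF \<kappa> pos[of \<omega>]] pos[of \<omega>] by (simp add: h_def abs_mult)
    then have e1: "exp \<bar>\<kappa> * Y \<omega>\<bar> \<le> exp h" by simp
    have "h\<^sup>2 \<le> 2 * exp h" using square_le_exp[OF h0] by simp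
    then have "h\<^sup>2 * exp \<bar>\<kappa> * Y \<omega>\<bar> \<le> (2 * exp h) * exp h"
      using e1 by (intro mult_mono) auto
    also have "\<dots> = 2 * exp (Y \<omega> / C)"
      using C by (simp add: Yh flip: exp_add)
    finally have e2: "h\<^sup>2 * exp \<bar>\<kappa> * Y \<omega>\<bar> \<le> 2 * exp (Y \<omega> / C)" .
    have "(\<kappa> * Y \<omega>)\<^sup>2 / 2 * exp \<bar>\<kappa> * Y \<omega>\<bar> = 2 * C\<^sup>2 * \<kappa>\<^sup>2 * (h\<^sup>2 * exp \<bar>\<kappa> * Y \<omega>\<bar>)"
      by (subst Yh) (simp add: power_mult_distrib field_simps Yh)
    also have "\<dots> \<le> 2 * C\<^sup>2 * \<kappa>\<^sup>2 * (2 * exp (Y \<omega> / C))"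
      using e2 by (intro mult_left_mono) auto
    finally show ?thesis using exp_le_taylor2[of "\<kappa> * Y \<omega>"] by simp
  qed
  have intK: "integrable M (\<lambda>\<omega>. exp (\<kappa> * Y \<omega>))"
    by (rule Bochner_Integration.integrable_bound
          [of _ "\<lambda>\<omega>. 1 + \<kappa> * Y \<omega> + 4 * C\<^sup>2 * \<kappa>\<^sup>2 * exp (Y \<omega> / C)"])
      (use intE intY pt in \<open>auto intro!: AE_I2 order_trans[OF pt]\<close>)
  have "expectation (\<lambda>\<omega>. exp (\<kappa> * Y \<omega>))
      \<le> expectation (\<lambda>\<omega>. 1 + \<kappa> * Y \<omega> + 4 * C\<^sup>2 * \<kappa>\<^sup>2 * exp (Y \<omega> / C))"
    by (intro integral_mono intK pt) (use intE intY in auto)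
  also have "\<dots> = 1 + \<kappa> * expectation Y + 4 * C\<^sup>2 * \<kappa>\<^sup>2 * expectation (\<lambda>\<omega>. exp (Y \<omega> / C))"
    using intE intY by (simp add: prob_space)
  also have "\<dots> \<le> 1 + \<kappa> * expectation Y + 4 * C\<^sup>2 * \<kappa>\<^sup>2 * 2"
    using E2 by (intro add_left_mono mult_left_mono) auto
  also have "\<dots> \<le> exp (\<kappa> * expectation Y + 8 * \<kappa>\<^sup>2 * C\<^sup>2)"
    using exp_ge_add_one_self[of "\<kappa> * expectation Y + 8 * \<kappa>\<^sup>2 * C\<^sup>2"] by (simp add: algebra_simps)
  finally have main: "expectation (\<lambda>\<omega>. exp (\<kappa> * Y \<omega>)) \<le> exp (\<kappa> * expectation Y + 8 * \<kappa>\<^sup>2 * C\<^sup>2)" .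
  have "(\<integral>\<^sup>+\<omega>. ennreal (exp (\<kappa> * (Y \<omega> - expectation Y))) \<partial>M)
      = (\<integral>\<^sup>+\<omega>. ennreal (exp (- \<kappa> * expectation Y)) * ennreal (exp (\<kappa> * Y \<omega>)) \<partial>M)"
    by (intro nn_integral_cong) (simp add: right_diff_distrib exp_diff exp_minus field_simps flip: ennreal_mult)
  also have "\<dots> = ennreal (exp (- \<kappa> * expectation Y)) * ennreal (expectation (\<lambda>\<omega>. exp (\<kappa> * Y \<omega>)))"
    by (simp add: nn_integral_cmult nn_integral_eq_integral[OF intK])
  also have "\<dots> \<le> ennreal (exp (- \<kappa> * expectation Y)) * ennreal (exp (\<kappa> * expectation Y + 8 * \<kappa>\<^sup>2 * C\<^sup>2))"
    using main by (intro mult_left_mono ennreal_leI) auto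
  also have "\<dots> = ennreal (exp (8 * \<kappa>\<^sup>2 * C\<^sup>2))"
    by (simp add: flip: ennreal_mult exp_add)
  finally show ?thesis .
qed

text \<open>
  Markov's inequality for the exponential of the sum, whose expectation factorizes. The sign of \<open>\<kappa>\<close>
  is arbitrary, so both tails are covered.
\<close>
lemma (in prob_space) chernoff_sum:
  fixes Y :: "'i \<Rightarrow> 'a \<Rightarrow> real"
  assumes ind: "indep_vars (\<lambda>_. borel) Y T" and T: "finite T"
    and mgf: "\<And>i. i \<in> T \<Longrightarrow> (\<integral>\<^sup>+\<omega>. ennreal (exp (\<kappa> * (Y i \<omega> - \<mu>))) \<partial>M) \<le> ennreal (exp b)"
  shows "prob {\<omega>\<in>space M. a \<le> \<kappa> * (\<Sum>i\<in>T. Y i \<omega> - \<mu>)} \<le> exp (real (card T) * b - a)"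
proof -
  have [measurable]: "Y i \<in> borel_measurable M" if "i \<in> T" for i
    using ind that by (auto simp: indep_vars_def)
  define S where "S \<omega> = \<kappa> * (\<Sum>i\<in>T. Y i \<omega> - \<mu>)" for \<omega>
  have [measurable]: "S \<in> borel_measurable M" unfolding S_def by measurable
  have prod: "ennreal (exp (S \<omega>)) = (\<Prod>i\<in>T. ennreal (exp (\<kappa> * (Y i \<omega> - \<mu>))))" for \<omega>
    unfolding S_def using T by (subst prod_ennreal) (auto simp: sum_distrib_left exp_sum)
  have ind': "indep_vars (\<lambda>_. borel) (\<lambda>i \<omega>. ennreal (exp (\<kappa> * (Y i \<omega> - \<mu>)))) T"
    by (rule indep_vars_compose2[OF ind]) auto
  have "(\<integral>\<^sup>+\<omega>. ennreal (exp (S \<omega>)) \<partial>M) = (\<Prod>i\<in>T. \<integral>\<^sup>+\<omega>. ennreal (exp (\<kappa> * (Y i \<omega> - \<mu>))) \<partial>M)"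
    unfolding prod by (rule indep_vars_nn_integral[OF T ind']) auto
  also have "\<dots> \<le> (\<Prod>i\<in>T. ennreal (exp b))"
    by (intro prod_mono_ennreal mgf) 
  also have "\<dots> = ennreal (exp (real (card T) * b))"
    by (simp add: ennreal_power flip: exp_of_nat_mult)
  finally have I: "(\<integral>\<^sup>+\<omega>. ennreal (exp (S \<omega>)) \<partial>M) \<le> ennreal (exp (real (card T) * b))" .
  have "emeasure M {\<omega>\<in>space M. a \<le> S \<omega>} \<le> emeasure M {\<omega>\<in>space M. 1 \<le> ennreal (exp (- a)) * ennreal (exp (S \<omega>))}"
    by (intro emeasure_mono) (auto simp flip: ennreal_mult exp_add)
  also have "\<dots> \<le> ennreal (exp (- a)) * (\<integral>\<^sup>+\<omega>. ennreal (exp (S \<omega>)) * indicator (space M) \<omega> \<partial>M)"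
    using nn_integral_Markov_inequality[of "\<lambda>\<omega>. ennreal (exp (S \<omega>))" "space M" M "ennreal (exp (- a))"]
    by simp
  also have "(\<integral>\<^sup>+\<omega>. ennreal (exp (S \<omega>)) * indicator (space M) \<omega> \<partial>M) = (\<integral>\<^sup>+\<omega>. ennreal (exp (S \<omega>)) \<partial>M)"
    by (intro nn_integral_cong) auto
  also have "ennreal (exp (- a)) * (\<integral>\<^sup>+\<omega>. ennreal (exp (S \<omega>)) \<partial>M) \<le> ennreal (exp (- a)) * ennreal (exp (real (card T) * b))"
    by (intro mult_left_mono I) auto
  also have "\<dots> = ennreal (exp (real (card T) * b - a))"
    by (simp flip: ennreal_mult exp_add)
  finally show ?thesis unfolding S_def emeasure_eq_measure by simp
qed

lemma (in prob_space) average_concentration: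
  fixes Y :: "'i \<Rightarrow> 'a \<Rightarrow> real"
  assumes ind: "indep_vars (\<lambda>_. borel) Y T" and T: "finite T" "T \<noteq> {}"
    and pos: "\<And>i \<omega>. 0 \<le> Y i \<omega>" and mean: "\<And>i. i \<in> T \<Longrightarrow> expectation (Y i) = \<mu>"
    and C: "0 < C" and psi: "\<And>i. i \<in> T \<Longrightarrow> (\<integral>\<^sup>+\<omega>. ennreal (exp (Y i \<omega> / C)) \<partial>M) \<le> 2"
    and t: "0 < t" "t \<le> 8"
  shows "prob {\<omega>\<in>space M. t * C < \<bar>(\<Sum>i\<in>T. Y i \<omega>) / real (card T) - \<mu>\<bar>}
       \<le> 2 * exp (- real (card T) * t\<^sup>2 / 32)"
proof -
  let ?m = "real (card T)"
  have m: "0 < ?m" using T by (simp add: card_gt_0_iff)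
  have [measurable]: "Y i \<in> borel_measurable M" if "i \<in> T" for i
    using ind that by (auto simp: indep_vars_def)
  \<comment> \<open>minimizes the exponent \<open>8 * \<kappa>\<^sup>2 * C\<^sup>2 - \<kappa> * t * C\<close>; \<open>t \<le> 8\<close> keeps it in the range of the moment bound\<close>
  define \<kappa> where "\<kappa> = t / (16 * C)"
  have k0: "0 < \<kappa>" and kb: "\<bar>\<kappa>\<bar> \<le> 1 / (2 * C)" using C t by (auto simp: \<kappa>_def field_simps)
  have mgf: "(\<integral>\<^sup>+\<omega>. ennreal (exp (s * (Y i \<omega> - \<mu>))) \<partial>M) \<le> ennreal (exp (t\<^sup>2 / 32))"
    if "i \<in> T" "s = \<kappa> \<or> s = - \<kappa>" for i s
  proof -
    have "s\<^sup>2 = t\<^sup>2 / (256 * C\<^sup>2)" using that(2) by (auto simp: \<kappa>_def power_divide power_mult_distrib)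
    then have "8 * s\<^sup>2 * C\<^sup>2 = t\<^sup>2 / 32" using C by simp
    moreover have "\<bar>s\<bar> \<le> 1 / (2 * C)" using that(2) kb by auto
    ultimately show ?thesis
      using mgf_centered_le[of "Y i" C s] that(1) psi[OF that(1)] pos C
      unfolding mean[OF that(1)] by (metis \<open>\<And>i. i \<in> T \<Longrightarrow> Y i \<in> borel_measurable M\<close>)
  qed
  define A where "A s = {\<omega>\<in>space M. ?m * t\<^sup>2 / 16 \<le> s * (\<Sum>i\<in>T. Y i \<omega> - \<mu>)}" for s
  have [measurable]: "A s \<in> events" for s unfolding A_def by measurable
  have A: "prob (A s) \<le> exp (- ?m * t\<^sup>2 / 32)" if "s = \<kappa> \<or> s = - \<kappa>" for s
  proof -
    have "prob (A s) \<le> exp (?m * (t\<^sup>2 / 32) - ?m * t\<^sup>2 / 16)"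
      unfolding A_def by (intro chernoff_sum ind T mgf that)
    then show ?thesis by (simp add: field_simps)
  qed
  have "{\<omega>\<in>space M. t * C < \<bar>(\<Sum>i\<in>T. Y i \<omega>) / ?m - \<mu>\<bar>} \<subseteq> A \<kappa> \<union> A (- \<kappa>)"
  proof
    fix \<omega> assume \<omega>: "\<omega> \<in> {\<omega>\<in>space M. t * C < \<bar>(\<Sum>i\<in>T. Y i \<omega>) / ?m - \<mu>\<bar>}"
    define D where "D = (\<Sum>i\<in>T. Y i \<omega> - \<mu>)"
    have D: "(\<Sum>i\<in>T. Y i \<omega>) / ?m - \<mu> = D / ?m"
      using m by (simp add: D_def sum_subtractf field_simps)
    have "t * C * ?m < \<bar>D\<bar>" using \<omega> m unfolding mem_Collect_eq D by (simp add: field_simps)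
    then have "\<kappa> * (t * C * ?m) \<le> \<kappa> * \<bar>D\<bar>" using k0 by (intro mult_left_mono) auto
    moreover have "\<kappa> * (t * C * ?m) = ?m * t\<^sup>2 / 16"
      using C by (simp add: \<kappa>_def power2_eq_square field_simps)
    ultimately have "?m * t\<^sup>2 / 16 \<le> \<kappa> * \<bar>D\<bar>" by simp
    then show "\<omega> \<in> A \<kappa> \<union> A (- \<kappa>)"
      using \<omega> by (cases "0 \<le> D") (auto simp: A_def D_def)
  qed
  then have "prob {\<omega>\<in>space M. t * C < \<bar>(\<Sum>i\<in>T. Y i \<omega>) / ?m - \<mu>\<bar>} \<le> prob (A \<kappa> \<union> A (- \<kappa>))"
    by (intro finite_measure_mono) auto
  also have "\<dots> \<le> prob (A \<kappa>) + prob (A (- \<kappa>))" by (rule measure_Un_le) auto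
  also have "\<dots> \<le> 2 * exp (- ?m * t\<^sup>2 / 32)" using A[of \<kappa>] A[of "- \<kappa>"] by simp
  finally show ?thesis .
qed

section \<open>Medians of batch means\<close>

lemma (in prob_space) second_moment_sum_indep:
  fixes Z :: "'i \<Rightarrow> 'a \<Rightarrow> real"
  assumes ind: "indep_vars (\<lambda>_. borel) Z G" and G: "finite G"
    and int: "\<And>i. i \<in> G \<Longrightarrow> integrable M (Z i)"
    and sq: "\<And>i. i \<in> G \<Longrightarrow> integrable M (\<lambda>\<omega>. (Z i \<omega>)\<^sup>2)"
    and mean: "\<And>i. i \<in> G \<Longrightarrow> expectation (Z i) = 0"
  shows "integrable M (\<lambda>\<omega>. (\<Sum>i\<in>G. Z i \<omega>)\<^sup>2)"
    and "expectation (\<lambda>\<omega>. (\<Sum>i\<in>G. Z i \<omega>)\<^sup>2) = (\<Sum>i\<in>G. expectation (\<lambda>\<omega>. (Z i \<omega>)\<^sup>2))"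
proof -
  have cross: "integrable M (\<lambda>\<omega>. Z i \<omega> * Z j \<omega>) \<and> expectation (\<lambda>\<omega>. Z i \<omega> * Z j \<omega>) = 0"
    if ij: "i \<in> G" "j \<in> G" "i \<noteq> j" for i j
  proof -
    have ind2: "indep_vars (\<lambda>_. borel) Z {i, j}"
      using ij by (intro indep_vars_subset[OF ind]) auto
    have "integrable M (\<lambda>\<omega>. \<Prod>k\<in>{i, j}. Z k \<omega>)"
      by (rule indep_vars_integrable[OF _ ind2]) (use int ij in auto)
    moreover have "expectation (\<lambda>\<omega>. \<Prod>k\<in>{i, j}. Z k \<omega>) = (\<Prod>k\<in>{i, j}. expectation (Z k))"
      by (rule indep_vars_lebesgue_integral[OF _ ind2]) (use int ij in auto)
    ultimately show ?thesis using ij mean by simp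
  qed
  have prod_int: "integrable M (\<lambda>\<omega>. Z i \<omega> * Z j \<omega>)" if "i \<in> G" "j \<in> G" for i j
    using cross[OF that] sq[OF that(1)] by (cases "i = j") (auto simp: power2_eq_square)
  have expand: "(\<Sum>i\<in>G. Z i \<omega>)\<^sup>2 = (\<Sum>i\<in>G. \<Sum>j\<in>G. Z i \<omega> * Z j \<omega>)" for \<omega>
    by (simp add: power2_eq_square sum_product)
  show "integrable M (\<lambda>\<omega>. (\<Sum>i\<in>G. Z i \<omega>)\<^sup>2)"
    unfolding expand by (intro Bochner_Integration.integrable_sum prod_int)
  have "expectation (\<lambda>\<omega>. (\<Sum>i\<in>G. Z i \<omega>)\<^sup>2) = (\<Sum>i\<in>G. \<Sum>j\<in>G. expectation (\<lambda>\<omega>. Z i \<omega> * Z j \<omega>))"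
    unfolding expand by (simp add: prod_int)
  also have "\<dots> = (\<Sum>i\<in>G. \<Sum>j\<in>G. if j = i then expectation (\<lambda>\<omega>. (Z i \<omega>)\<^sup>2) else 0)"
    by (intro sum.cong refl) (auto simp: power2_eq_square cross)
  also have "\<dots> = (\<Sum>i\<in>G. expectation (\<lambda>\<omega>. (Z i \<omega>)\<^sup>2))"
    using G by simp
  finally show "expectation (\<lambda>\<omega>. (\<Sum>i\<in>G. Z i \<omega>)\<^sup>2) = (\<Sum>i\<in>G. expectation (\<lambda>\<omega>. (Z i \<omega>)\<^sup>2))" .
qed

lemma (in prob_space) batch_mean_chebyshev:
  fixes Y :: "'i \<Rightarrow> 'a \<Rightarrow> real"
  assumes ind: "indep_vars (\<lambda>_. borel) Y G" and G: "finite G" "k \<le> card G" "0 < k"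
    and mean: "\<And>i. i \<in> G \<Longrightarrow> expectation (Y i) = \<mu>"
    and C: "0 < C" and sq: "\<And>i. i \<in> G \<Longrightarrow> (\<integral>\<^sup>+\<omega>. ennreal ((Y i \<omega>)\<^sup>2) \<partial>M) \<le> ennreal (2 * C\<^sup>2)"
    and c: "0 < c"
  shows "prob {\<omega>\<in>space M. c * C < \<bar>(\<Sum>i\<in>G. Y i \<omega>) / real (card G) - \<mu>\<bar>} \<le> 2 / (c\<^sup>2 * real k)"
proof -
  let ?g = "real (card G)"
  have g: "0 < ?g" using G by linarith
  have [measurable]: "Y i \<in> borel_measurable M" if "i \<in> G" for i
    using ind that by (auto simp: indep_vars_def)
  have sqi: "integrable M (\<lambda>\<omega>. (Y i \<omega>)\<^sup>2)" if "i \<in> G" for i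
    by (rule integrableI_nonneg) (use that sq[OF that] in \<open>auto intro: le_less_trans\<close>)
  have int: "integrable M (Y i)" if "i \<in> G" for i
    using square_integrable_imp_integrable[OF _ sqi[OF that]] that by simp
  have Esq: "expectation (\<lambda>\<omega>. (Y i \<omega>)\<^sup>2) \<le> 2 * C\<^sup>2" if "i \<in> G" for i
    by (subst integral_eq_nn_integral) (use that sq[OF that] in \<open>auto intro!: enn2real_leI\<close>)
  define Z where "Z i \<omega> = Y i \<omega> - \<mu>" for i \<omega>
  have indZ: "indep_vars (\<lambda>_. borel) Z G"
    unfolding Z_def by (rule indep_vars_compose2[OF ind]) auto
  have Zi: "integrable M (Z i)" "expectation (Z i) = 0" if "i \<in> G" for i
    using int[OF that] mean[OF that] by (auto simp: Z_def[abs_def] prob_space)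
  have Zs: "integrable M (\<lambda>\<omega>. (Z i \<omega>)\<^sup>2)" if "i \<in> G" for i
    using sqi[OF that] int[OF that] by (simp add: Z_def power2_diff)
  have EZ: "expectation (\<lambda>\<omega>. (Z i \<omega>)\<^sup>2) \<le> 2 * C\<^sup>2" if "i \<in> G" for i
  proof -
    have "expectation (\<lambda>\<omega>. (Z i \<omega>)\<^sup>2) = expectation (\<lambda>\<omega>. (Y i \<omega>)\<^sup>2) - \<mu>\<^sup>2"
      using variance_eq[OF int[OF that] sqi[OF that]] mean[OF that] by (simp add: Z_def)
    then show ?thesis using Esq[OF that] zero_le_power2[of \<mu>] by linarith
  qed
  have S: "integrable M (\<lambda>\<omega>. (\<Sum>i\<in>G. Z i \<omega>)\<^sup>2)"
    "expectation (\<lambda>\<omega>. (\<Sum>i\<in>G. Z i \<omega>)\<^sup>2) = (\<Sum>i\<in>G. expectation (\<lambda>\<omega>. (Z i \<omega>)\<^sup>2))"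
    by (intro second_moment_sum_indep indZ G(1) Zi Zs; assumption)+
  define S where "S \<omega> = (\<Sum>i\<in>G. Z i \<omega>)" for \<omega>
  have [measurable]: "S \<in> borel_measurable M" unfolding S_def Z_def by measurable
  have ES: "expectation (\<lambda>\<omega>. (S \<omega>)\<^sup>2) \<le> ?g * (2 * C\<^sup>2)"
    unfolding S_def S(2) using sum_mono[of G "\<lambda>i. expectation (\<lambda>\<omega>. (Z i \<omega>)\<^sup>2)" "\<lambda>_. 2 * C\<^sup>2"] EZ by simp
  have "prob {\<omega>\<in>space M. c * C < \<bar>(\<Sum>i\<in>G. Y i \<omega>) / ?g - \<mu>\<bar>}
      \<le> prob {\<omega>\<in>space M. (c * C * ?g)\<^sup>2 \<le> (S \<omega>)\<^sup>2}"
  proof (intro finite_measure_mono subsetI)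
    fix \<omega> assume \<omega>: "\<omega> \<in> {\<omega>\<in>space M. c * C < \<bar>(\<Sum>i\<in>G. Y i \<omega>) / ?g - \<mu>\<bar>}"
    have "(\<Sum>i\<in>G. Y i \<omega>) / ?g - \<mu> = S \<omega> / ?g"
      using g by (simp add: S_def Z_def sum_subtractf field_simps)
    then have "c * C * ?g \<le> \<bar>S \<omega>\<bar>" using \<omega> g by (simp add: field_simps)
    then have "(c * C * ?g)\<^sup>2 \<le> (\<bar>S \<omega>\<bar>)\<^sup>2" using c C g by (intro power_mono) auto
    then show "\<omega> \<in> {\<omega>\<in>space M. (c * C * ?g)\<^sup>2 \<le> (S \<omega>)\<^sup>2}" using \<omega> by simp
  qed measurable
  also have "\<dots> \<le> expectation (\<lambda>\<omega>. (S \<omega>)\<^sup>2) / (c * C * ?g)\<^sup>2"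
    by (rule integral_Markov_inequality_measure[where A="{}"])
      (use S(1) c C g in \<open>auto simp: S_def\<close>)
  also have "\<dots> \<le> ?g * (2 * C\<^sup>2) / (c * C * ?g)\<^sup>2"
    by (intro divide_right_mono ES) auto
  also have "\<dots> = 2 / (c\<^sup>2 * ?g)"
    using c C g by (simp add: field_simps power2_eq_square)
  also have "\<dots> \<le> 2 / (c\<^sup>2 * real k)"
    using c G by (intro divide_left_mono mult_left_mono) auto
  finally show ?thesis .
qed

text \<open>
  A Chernoff bound for the number of events that occur: since \<open>exp 1 \<le> 3\<close>, the exponential of the
  indicator of one event has mean at most \<open>1 + 2/8 \<le> exp (1/4)\<close>, so the exponent is \<open>B/4 - B/2\<close>.
\<close>
lemma (in prob_space) half_of_indep_rare_events:
  fixes H :: "nat \<Rightarrow> 'a \<Rightarrow> real"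
  assumes ind: "indep_vars (\<lambda>_. borel) H {..<B}"
    and rare: "\<And>b. b < B \<Longrightarrow> prob {\<omega>\<in>space M. s < H b \<omega>} \<le> 1 / 8"
  shows "prob {\<omega>\<in>space M. B \<le> 2 * card {b. b < B \<and> s < H b \<omega>}} \<le> exp (- real B / 4)"
proof -
  have [measurable]: "H b \<in> borel_measurable M" if "b < B" for b
    using ind that by (auto simp: indep_vars_def)
  define I where "I b \<omega> = indicat_real {s<..} (H b \<omega>)" for b \<omega>
  have indI: "indep_vars (\<lambda>_. borel) I {..<B}"
    unfolding I_def by (rule indep_vars_compose2[OF ind]) auto
  have [measurable]: "I b \<in> borel_measurable M" if "b < B" for b
    using indI that by (auto simp: indep_vars_def)
  have mgf: "(\<integral>\<^sup>+\<omega>. ennreal (exp (1 * (I b \<omega> - 0))) \<partial>M) \<le> ennreal (exp (1 / 4))" if b: "b \<in> {..<B}" for b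
  proof -
    let ?A = "{\<omega>\<in>space M. s < H b \<omega>}"
    have A: "?A \<in> events" using b by simp
    have "(\<integral>\<^sup>+\<omega>. ennreal (exp (1 * (I b \<omega> - 0))) \<partial>M) \<le> (\<integral>\<^sup>+\<omega>. 1 + 2 * indicator ?A \<omega> \<partial>M)"
    proof (rule nn_integral_mono)
      fix \<omega> assume "\<omega> \<in> space M"
      moreover have "ennreal (exp 1) \<le> ennreal 3" by (rule ennreal_leI) (rule exp_le)
      ultimately show "ennreal (exp (1 * (I b \<omega> - 0))) \<le> 1 + 2 * indicator ?A \<omega>"
        by (cases "s < H b \<omega>") (simp_all add: I_def)
    qed
    also have "\<dots> = ennreal (1 + 2 * prob ?A)"
      using A by (simp add: nn_integral_add nn_integral_cmult emeasure_space_1 emeasure_eq_measure ennreal_plus ennreal_mult prob_space)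
    also have "\<dots> \<le> ennreal (exp (1 / 4))"
      using rare[of b] b exp_ge_add_one_self[of "1/4::real"] by (intro ennreal_leI) (simp del: exp_ge_add_one_self)
    finally show ?thesis .
  qed
  have cnt: "(\<Sum>b<B. I b \<omega> - 0) = real (card {b. b < B \<and> s < H b \<omega>})" for \<omega>
    unfolding I_def by (simp add: indicator_def sum.If_cases Int_def)
  have "{\<omega>\<in>space M. B \<le> 2 * card {b. b < B \<and> s < H b \<omega>}}
      = {\<omega>\<in>space M. real B / 2 \<le> 1 * (\<Sum>b\<in>{..<B}. I b \<omega> - 0)}"
    unfolding cnt by (auto simp: field_simps)
  also have "prob \<dots> \<le> exp (real (card {..<B}) * (1 / 4) - real B / 2)"
    by (rule chernoff_sum[OF indI finite_lessThan mgf])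
  also have "real (card {..<B}) * (1 / 4) - real B / 2 = - real B / 4" by simp
  finally show ?thesis .
qed

text \<open>
  Both middle entries of the sorted list must be accurate: if one of them were too small, so would be
  all entries before it, and if it were too large, so would be all entries after it; either way half
  of the list would be inaccurate.
\<close>
lemma median_of_majority:
  assumes "2 * card {b. b < B \<and> s < \<bar>h b - \<mu>\<bar>} < B"
  shows "\<bar>median (map h [0..<B]) - \<mu>\<bar> \<le> s"
proof -
  define ys where "ys = sort (map h [0..<B])"
  have B: "0 < B" using assms by simp
  have len: "length ys = B" and srt: "sorted ys" by (auto simp: ys_def)
  have mset: "mset ys = mset (map h [0..<B])" by (simp add: ys_def)
  have count: "card {i. i < B \<and> s < \<bar>ys ! i - \<mu>\<bar>} = card {b. b < B \<and> s < \<bar>h b - \<mu>\<bar>}"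
  proof -
    have "length (filter (\<lambda>x. s < \<bar>x - \<mu>\<bar>) ys) = length (filter (\<lambda>x. s < \<bar>x - \<mu>\<bar>) (map h [0..<B]))"
      using mset by (metis mset_filter size_mset)
    then have "card {i. i < B \<and> s < \<bar>ys ! i - \<mu>\<bar>}
        = card {i. i < B \<and> s < \<bar>map h [0..<B] ! i - \<mu>\<bar>}"
      by (simp add: length_filter_conv_card len)
    also have "{i. i < B \<and> s < \<bar>map h [0..<B] ! i - \<mu>\<bar>} = {b. b < B \<and> s < \<bar>h b - \<mu>\<bar>}"
      by auto
    finally show ?thesis .
  qed
  have central: "\<bar>ys ! i - \<mu>\<bar> \<le> s" if i: "i < B" "B \<le> 2 * i + 2" "2 * i \<le> B" for i
  proof (rule ccontr)
    assume "\<not> \<bar>ys ! i - \<mu>\<bar> \<le> s"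
    then consider "ys ! i < \<mu> - s" | "\<mu> + s < ys ! i" by linarith
    then obtain J where J: "J \<subseteq> {i. i < B \<and> s < \<bar>ys ! i - \<mu>\<bar>}" "B \<le> 2 * card J"
    proof cases
      case 1
      have "ys ! k \<le> ys ! i" if "k \<le> i" for k
        using srt that i(1) len by (auto simp: sorted_iff_nth_mono)
      then have "{..i} \<subseteq> {i. i < B \<and> s < \<bar>ys ! i - \<mu>\<bar>}" using 1 i(1) by fastforce
      then show ?thesis using that[of "{..i}"] i(2) by simp
    next
      case 2
      have "ys ! i \<le> ys ! k" if "i \<le> k" "k < B" for k
        using srt that i(1) len by (auto simp: sorted_iff_nth_mono)
      then have "{i..<B} \<subseteq> {i. i < B \<and> s < \<bar>ys ! i - \<mu>\<bar>}" using 2 by fastforce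
      then show ?thesis using that[of "{i..<B}"] i(3) by simp
    qed
    have "card J \<le> card {i. i < B \<and> s < \<bar>ys ! i - \<mu>\<bar>}" by (intro card_mono J) auto
    then show False using J(2) assms count by linarith
  qed
  have "\<bar>ys ! ((B - 1) div 2) - \<mu>\<bar> \<le> s" "\<bar>ys ! (B div 2) - \<mu>\<bar> \<le> s"
    by (intro central; use B in presburger)+
  moreover have "median (map h [0..<B]) = (ys ! ((B - 1) div 2) + ys ! (B div 2)) / 2"
    by (simp add: median_def Let_def ys_def)
  ultimately show ?thesis by (simp add: abs_le_iff field_simps)
qed

text \<open>
  The condition \<open>16 \<le> c\<^sup>2 * k\<close> makes Chebyshev's bound for a batch of at least \<open>k\<close> elements at most
  \<open>1/8\<close>. The constant \<open>2\<close> in the second moment bound leaves room for the comparison of the \<open>\<psi>\<^sub>1\<close> norm with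
  the \<open>L\<^sub>2\<close> norm, so that one statement serves both norms.
\<close>
lemma (in prob_space) batch_means_concentration:
  fixes Y :: "'i \<Rightarrow> 'a \<Rightarrow> real"
  assumes ind: "indep_vars (\<lambda>_. borel) Y T" and T: "finite T"
    and G: "\<And>b. b < B \<Longrightarrow> G b \<subseteq> T" "disjoint_family_on G {..<B}"
      "\<And>b. b < B \<Longrightarrow> k \<le> card (G b)" "0 < k"
    and mean: "\<And>i. i \<in> T \<Longrightarrow> expectation (Y i) = \<mu>"
    and \<sigma>: "0 \<le> \<sigma>"
    and sq: "\<And>i C. i \<in> T \<Longrightarrow> \<sigma> < C \<Longrightarrow> (\<integral>\<^sup>+\<omega>. ennreal ((Y i \<omega>)\<^sup>2) \<partial>M) \<le> ennreal (2 * C\<^sup>2)"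
    and c: "0 < c" "16 \<le> c\<^sup>2 * real k"
  shows "prob {\<omega>\<in>space M. B \<le> 2 * card {b. b < B \<and>
            c * \<sigma> < \<bar>(\<Sum>i\<in>G b. Y i \<omega>) / real (card (G b)) - \<mu>\<bar>}} \<le> exp (- real B / 4)"
proof -
  have Ym[measurable]: "Y i \<in> borel_measurable M" if "i \<in> T" for i
    using ind that by (auto simp: indep_vars_def)
  define H where "H b \<omega> = \<bar>(\<Sum>i\<in>G b. Y i \<omega>) / real (card (G b)) - \<mu>\<bar>" for b \<omega>
  have "indep_vars (\<lambda>b. PiM (G b) (\<lambda>_. borel)) (\<lambda>b \<omega>. restrict (\<lambda>i. Y i \<omega>) (G b)) {..<B}"
    by (rule indep_vars_restrict[OF ind _ G(2)]) (use G(1) in auto)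
  then have "indep_vars (\<lambda>_. borel) (\<lambda>b \<omega>. (\<lambda>y. \<bar>(\<Sum>i\<in>G b. y i) / real (card (G b)) - \<mu>\<bar>)
      (restrict (\<lambda>i. Y i \<omega>) (G b))) {..<B}"
    by (rule indep_vars_compose2) measurable
  then have indH: "indep_vars (\<lambda>_. borel) H {..<B}"
    by (simp add: H_def[abs_def])
  have Hm: "H b \<in> borel_measurable M" if "b < B" for b
    using indH that by (auto simp: indep_vars_def)
  have rare: "prob {\<omega>\<in>space M. c * \<sigma> < H b \<omega>} \<le> 1 / 8" if b: "b < B" for b
  proof (rule prob_gr_limit_le[OF Hm[OF b]])
    fix C assume C: "\<sigma> < C"
    have "prob {\<omega>\<in>space M. c * C < H b \<omega>} \<le> 2 / (c\<^sup>2 * real k)"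
      unfolding H_def
      by (rule batch_mean_chebyshev[OF indep_vars_subset[OF ind G(1)[OF b]]])
        (use T G b mean \<sigma> C sq c finite_subset[OF G(1)[OF b] T] subsetD[OF G(1)[OF b]] in auto)
    also have "\<dots> \<le> 2 / 16" using c by (intro divide_left_mono) auto
    finally show "prob {\<omega>\<in>space M. c * C < H b \<omega>} \<le> 1 / 8" by simp
  qed (use c in simp)
  show ?thesis
    using half_of_indep_rare_events[OF indH rare] unfolding H_def .
qed

section \<open>The norms of the loss\<close>

text \<open>
  Rational constants suffice because the exponential moment decreases in \<open>q\<close>; this yields measurability
  of the norm in a parameter.
\<close>
lemma psi1_norm_less_iff:
  "psi1_norm P W < a \<longleftrightarrow>
    (\<exists>q\<in>\<rat>. 0 < q \<and> ennreal q < a \<and> (\<integral>\<^sup>+ z. ennreal (exp (\<bar>W z\<bar> / q)) \<partial>P) \<le> 2)"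
proof
  assume "psi1_norm P W < a"
  then obtain C where C: "0 < C" "(\<integral>\<^sup>+ z. ennreal (exp (\<bar>W z\<bar> / C)) \<partial>P) \<le> 2" "ennreal C < a"
    by (auto simp: psi1_norm_def INF_less_iff)
  obtain r where r: "C < r" "ennreal r < a"
  proof (cases a)
    case (real a')
    then show ?thesis using that[of "(C + a') / 2"] C by (auto simp: ennreal_less_iff)
  next
    case top
    then show ?thesis using that[of "C + 1"] by auto
  qed
  obtain q where q: "q \<in> \<rat>" "C < q" "q < r" using Rats_dense_in_real[OF r(1)] by auto
  have "(\<integral>\<^sup>+ z. ennreal (exp (\<bar>W z\<bar> / q)) \<partial>P) \<le> (\<integral>\<^sup>+ z. ennreal (exp (\<bar>W z\<bar> / C)) \<partial>P)"
    using C q by (intro nn_integral_mono ennreal_leI) (auto intro!: divide_left_mono)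
  moreover have "ennreal q < a" using q r(2) by (meson ennreal_leI le_less_trans less_imp_le)
  ultimately show "\<exists>q\<in>\<rat>. 0 < q \<and> ennreal q < a \<and> (\<integral>\<^sup>+ z. ennreal (exp (\<bar>W z\<bar> / q)) \<partial>P) \<le> 2"
    using q C r by (intro bexI[of _ q]) auto
next
  assume "\<exists>q\<in>\<rat>. 0 < q \<and> ennreal q < a \<and> (\<integral>\<^sup>+ z. ennreal (exp (\<bar>W z\<bar> / q)) \<partial>P) \<le> 2"
  then show "psi1_norm P W < a"
    by (auto simp: psi1_norm_def INF_less_iff)
qed

lemma psi1_norm_lessD:
  assumes "psi1_norm P W < ennreal C"
  shows "0 < C" "(\<integral>\<^sup>+ z. ennreal (exp (\<bar>W z\<bar> / C)) \<partial>P) \<le> 2"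
proof -
  obtain q where q: "0 < q" "ennreal q < ennreal C" "(\<integral>\<^sup>+ z. ennreal (exp (\<bar>W z\<bar> / q)) \<partial>P) \<le> 2"
    using assms unfolding psi1_norm_less_iff by auto
  then have qC: "q < C" by (simp add: ennreal_less_iff)
  then show "0 < C" using q by simp
  have "(\<integral>\<^sup>+ z. ennreal (exp (\<bar>W z\<bar> / C)) \<partial>P) \<le> (\<integral>\<^sup>+ z. ennreal (exp (\<bar>W z\<bar> / q)) \<partial>P)"
    using qC q by (intro nn_integral_mono ennreal_leI) (auto intro!: divide_left_mono)
  then show "(\<integral>\<^sup>+ z. ennreal (exp (\<bar>W z\<bar> / C)) \<partial>P) \<le> 2" using q by simp
qed

lemma borel_measurable_psi1_norm:
  assumes P: "prob_space P" and [measurable]: "(\<lambda>(y, z). w y z) \<in> borel_measurable (N \<Otimes>\<^sub>M P)"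
  shows "(\<lambda>y. psi1_norm P (w y)) \<in> borel_measurable N"
proof (rule borel_measurableI_less)
  interpret prob_space P by fact
  fix a :: ennreal
  have "{y \<in> space N. psi1_norm P (w y) < a}
     = (\<Union>q\<in>{q\<in>\<rat>. 0 < q \<and> ennreal q < a}.
          {y \<in> space N. (\<integral>\<^sup>+ z. ennreal (exp (\<bar>w y z\<bar> / q)) \<partial>P) \<le> 2})"
    by (auto simp: psi1_norm_less_iff)
  also have "\<dots> \<in> sets N"
    by (intro sets.countable_UN' countable_subset[OF _ countable_rat]) (auto, measurable)
  finally show "{y \<in> space N. psi1_norm P (w y) < a} \<in> sets N" .
qed

lemma borel_measurable_L2_norm:
  assumes P: "prob_space P" and [measurable]: "(\<lambda>(y, z). w y z) \<in> borel_measurable (N \<Otimes>\<^sub>M P)"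
  shows "(\<lambda>y. L2_norm_of P (w y)) \<in> borel_measurable N"
proof -
  interpret prob_space P by fact
  show ?thesis unfolding L2_norm_of_def Let_def by measurable
qed

lemma L2_norm_lessD:
  assumes "L2_norm_of P W < ennreal C"
  shows "0 < C" "(\<integral>\<^sup>+ z. ennreal ((W z)\<^sup>2) \<partial>P) \<le> ennreal (C\<^sup>2)"
proof -
  define I where "I = (\<integral>\<^sup>+ z. ennreal ((W z)\<^sup>2) \<partial>P)"
  have fin: "I \<noteq> \<infinity>" and s: "ennreal (sqrt (enn2real I)) < ennreal C"
    using assms by (auto simp: L2_norm_of_def I_def[symmetric] Let_def split: if_splits)
  have s': "sqrt (enn2real I) < C" using s by (simp add: ennreal_less_iff)
  have "0 \<le> sqrt (enn2real I)" by simp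
  then show "0 < C" using s' by linarith
  have "enn2real I \<le> C\<^sup>2"
    using s' by (metis enn2real_nonneg less_imp_le real_sqrt_le_iff real_sqrt_unique sqrt_le_D)
  then have "ennreal (enn2real I) \<le> ennreal (C\<^sup>2)" by (rule ennreal_leI)
  then show "(\<integral>\<^sup>+ z. ennreal ((W z)\<^sup>2) \<partial>P) \<le> ennreal (C\<^sup>2)"
    using fin unfolding I_def[symmetric] by (metis ennreal_enn2real infinity_ennreal_def less_top)
qed

text \<open>
  Integrate \<open>x\<^sup>2 \<le> 2 (exp x - 1)\<close> at \<open>x = \<bar>W\<bar> / C\<close>.
\<close>
lemma psi1_norm_second_moment:
  assumes P: "prob_space P" and [measurable]: "W \<in> borel_measurable P"
    and less: "psi1_norm P W < ennreal C"
  shows "(\<integral>\<^sup>+ z. ennreal ((W z)\<^sup>2) \<partial>P) \<le> ennreal (2 * C\<^sup>2)"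
proof -
  interpret prob_space P by fact
  note C = psi1_norm_lessD[OF less]
  define J where "J = (\<integral>\<^sup>+ z. ennreal (exp (\<bar>W z\<bar> / C)) \<partial>P)"
  have pt: "ennreal ((W z)\<^sup>2) + ennreal (2 * C\<^sup>2) \<le> ennreal (2 * C\<^sup>2) * ennreal (exp (\<bar>W z\<bar> / C))" for z
  proof -
    have "(\<bar>W z\<bar> / C)\<^sup>2 \<le> 2 * (exp (\<bar>W z\<bar> / C) - 1)" using C by (intro square_le_exp) auto
    then have "C\<^sup>2 * (\<bar>W z\<bar> / C)\<^sup>2 \<le> C\<^sup>2 * (2 * (exp (\<bar>W z\<bar> / C) - 1))" by (intro mult_left_mono) auto
    moreover have "C\<^sup>2 * (\<bar>W z\<bar> / C)\<^sup>2 = (W z)\<^sup>2" using C by (simp add: power_divide)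
    ultimately have "(W z)\<^sup>2 + 2 * C\<^sup>2 \<le> 2 * C\<^sup>2 * exp (\<bar>W z\<bar> / C)" by (simp add: algebra_simps)
    then have "ennreal ((W z)\<^sup>2 + 2 * C\<^sup>2) \<le> ennreal (2 * C\<^sup>2 * exp (\<bar>W z\<bar> / C))" by (rule ennreal_leI)
    then show ?thesis by (simp add: ennreal_plus ennreal_mult)
  qed
  have "(\<integral>\<^sup>+ z. ennreal ((W z)\<^sup>2) \<partial>P) + ennreal (2 * C\<^sup>2) = (\<integral>\<^sup>+ z. ennreal ((W z)\<^sup>2) + ennreal (2 * C\<^sup>2) \<partial>P)"
    by (subst nn_integral_add) (auto simp: emeasure_space_1)
  also have "\<dots> \<le> (\<integral>\<^sup>+ z. ennreal (2 * C\<^sup>2) * ennreal (exp (\<bar>W z\<bar> / C)) \<partial>P)"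
    by (intro nn_integral_mono pt)
  also have "\<dots> = ennreal (2 * C\<^sup>2) * J"
    unfolding J_def by (rule nn_integral_cmult) measurable
  also have "\<dots> \<le> ennreal (2 * C\<^sup>2) * 2" using C(2) by (intro mult_left_mono) (auto simp: J_def)
  also have "\<dots> = ennreal (2 * C\<^sup>2) + ennreal (2 * C\<^sup>2)" by (simp add: mult_2_right)
  finally show ?thesis by simp
qed

text \<open>
  \<open>loss_norm\<close> for a random variable that need not be the loss of a predictor.
\<close>
fun rv_norm :: "norm_kind \<Rightarrow> 'a measure \<Rightarrow> ('a \<Rightarrow> real) \<Rightarrow> ennreal" where
  "rv_norm Psi1 P W = psi1_norm P W"
| "rv_norm L2 P W = L2_norm_of P W"

lemma loss_norm_eq: "loss_norm k l P f = rv_norm k P (\<lambda>(x, y). l y (f x))"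
  by (cases k) auto

lemma borel_measurable_rv_norm:
  assumes "prob_space P" "(\<lambda>(y, z). w y z) \<in> borel_measurable (N \<Otimes>\<^sub>M P)"
  shows "(\<lambda>y. rv_norm k P (w y)) \<in> borel_measurable N"
  using borel_measurable_psi1_norm[OF assms] borel_measurable_L2_norm[OF assms] by (cases k) auto

lemma rv_norm_lessD:
  assumes "prob_space P" "W \<in> borel_measurable P" "rv_norm k P W < ennreal C"
  shows "0 < C" "(\<integral>\<^sup>+ z. ennreal ((W z)\<^sup>2) \<partial>P) \<le> ennreal (2 * C\<^sup>2)"
proof (atomize (full), cases k)
  case Psi1
  then show "0 < C \<and> (\<integral>\<^sup>+ z. ennreal ((W z)\<^sup>2) \<partial>P) \<le> ennreal (2 * C\<^sup>2)"
    using assms psi1_norm_second_moment psi1_norm_lessD(1) by auto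
next
  case L2
  have "ennreal (C\<^sup>2) \<le> ennreal (2 * C\<^sup>2)" by (rule ennreal_leI) simp
  then show "0 < C \<and> (\<integral>\<^sup>+ z. ennreal ((W z)\<^sup>2) \<partial>P) \<le> ennreal (2 * C\<^sup>2)"
    using assms L2 L2_norm_lessD[of P W C] by (auto intro: order_trans)
qed

lemma integrable_of_rv_norm_finite:
  assumes P: "prob_space P" and W[measurable]: "W \<in> borel_measurable P" and fin: "rv_norm k P W \<noteq> \<infinity>"
  shows "integrable P W"
proof -
  interpret prob_space P by fact
  obtain C where C: "rv_norm k P W < ennreal C"
  proof (cases "rv_norm k P W")
    case (real r)
    then show ?thesis using that[of "r + 1"] by (auto simp: ennreal_less_iff)
  qed (use fin in auto)
  have "integrable P (\<lambda>z. (W z)\<^sup>2)"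
    by (rule integrableI_nonneg) (use rv_norm_lessD(2)[OF P W C] in \<open>auto intro: le_less_trans\<close>)
  then show ?thesis by (rule square_integrable_imp_integrable[OF W])
qed

section \<open>Concentration conditionally on the training data\<close>

lemma indep_vars_PiM_coordinates:
  assumes P: "prob_space P" and T: "T \<noteq> {}"
  shows "prob_space.indep_vars (PiM T (\<lambda>_. P)) (\<lambda>_. P) (\<lambda>i z. z i) T"
proof -
  interpret product_prob_space "\<lambda>_. P" T
    by (simp add: P product_prob_spaceI)
  have "distr (PiM T (\<lambda>_. P)) (PiM T (\<lambda>_. P)) (\<lambda>z. \<lambda>i\<in>T. z i) = distr (PiM T (\<lambda>_. P)) (PiM T (\<lambda>_. P)) (\<lambda>z. z)"
    by (intro distr_cong refl) (auto simp: space_PiM PiE_def extensional_restrict)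
  also have "\<dots> = PiM T (\<lambda>i. distr (PiM T (\<lambda>_. P)) P (\<lambda>z. z i))"
    by (simp add: PiM_component cong: PiM_cong)
  finally show ?thesis
    by (subst indep_vars_iff_distr_eq_PiM'[OF T]) auto
qed

text \<open>
  For \<open>AVG\<close> the sample average misses \<open>\<mu>\<close> by more than \<open>s\<close>. For \<open>MOM\<close> at least half of the batch means
  miss it by more than \<open>s\<close>; this contains the event that the median does, and unlike the median, which
  is defined by sorting, it is plainly measurable.
\<close>
definition deviates ::
    "estimator \<Rightarrow> nat \<Rightarrow> (nat \<Rightarrow> nat set) \<Rightarrow> nat set \<Rightarrow> real \<Rightarrow> real \<Rightarrow> (nat \<Rightarrow> real) \<Rightarrow> bool" where
  "deviates e B G T s \<mu> v \<longleftrightarrow> (case e of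
      AVG \<Rightarrow> s < \<bar>(\<Sum>i\<in>T. v i) / real (card T) - \<mu>\<bar>
    | MOM \<Rightarrow> B \<le> 2 * card {b. b < B \<and> s < \<bar>(\<Sum>i\<in>G b. v i) / real (card (G b)) - \<mu>\<bar>})"

text \<open>
  The range of the error factor \<open>c\<close> for which the tail bounds of the two estimators are available:
  \<open>c \<le> 8\<close> comes from the moment bound, \<open>16 \<le> c\<^sup>2 * h\<close> from Chebyshev's inequality for batches of at
  least \<open>h\<close> elements.
\<close>
definition admissible ::
    "estimator \<Rightarrow> norm_kind \<Rightarrow> nat \<Rightarrow> (nat \<Rightarrow> nat set) \<Rightarrow> nat set \<Rightarrow> real \<Rightarrow> bool" where
  "admissible e k B G T c \<longleftrightarrow> finite T \<and> T \<noteq> {} \<and> 0 < c \<and> (case e of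
      AVG \<Rightarrow> k = Psi1 \<and> c \<le> 8
    | MOM \<Rightarrow> disjoint_family_on G {..<B} \<and>
        (\<exists>h>0. 16 \<le> c\<^sup>2 * real h \<and> (\<forall>b<B. G b \<subseteq> T \<and> h \<le> card (G b))))"

lemma deviates_cong:
  assumes adm: "admissible e k B G T c" and eq: "\<And>i. i \<in> T \<Longrightarrow> v i = v' i"
  shows "deviates e B G T s \<mu> v \<longleftrightarrow> deviates e B G T s \<mu> v'"
proof (cases e)
  case AVG
  then show ?thesis using eq by (simp add: deviates_def cong: sum.cong)
next
  case MOM
  have "(\<Sum>i\<in>G b. v i) = (\<Sum>i\<in>G b. v' i)" if "b < B" for b
    using adm MOM that by (intro sum.cong refl eq) (auto simp: admissible_def)
  then have "{b. b < B \<and> s < \<bar>(\<Sum>i\<in>G b. v i) / real (card (G b)) - \<mu>\<bar>}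
      = {b. b < B \<and> s < \<bar>(\<Sum>i\<in>G b. v' i) / real (card (G b)) - \<mu>\<bar>}"
    by (intro Collect_cong conj_cong refl) simp
  then show ?thesis unfolding deviates_def MOM by simp
qed

definition failure_bound :: "estimator \<Rightarrow> nat \<Rightarrow> nat \<Rightarrow> real \<Rightarrow> real" where
  "failure_bound e B m c = (case e of
      AVG \<Rightarrow> 2 * exp (- real m * c\<^sup>2 / 32)
    | MOM \<Rightarrow> exp (- real B / 4))"

lemma deviation_prob_fixed_predictor:
  fixes W :: "'a \<Rightarrow> real"
  assumes P: "prob_space P" and W[measurable]: "W \<in> borel_measurable P" and pos: "\<And>z. 0 \<le> W z"
    and fin: "rv_norm k P W \<noteq> \<infinity>" and adm: "admissible e k B G T c"
  shows "measure (PiM T (\<lambda>_. P)) {z\<in>space (PiM T (\<lambda>_. P)).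
      deviates e B G T (c * enn2real (rv_norm k P W)) (\<integral>z. W z \<partial>P) (\<lambda>i. W (z i))}
    \<le> failure_bound e B (card T) c"
proof -
  define \<sigma> where "\<sigma> = enn2real (rv_norm k P W)"
  have \<sigma>: "rv_norm k P W = ennreal \<sigma>" "0 \<le> \<sigma>" using fin by (auto simp: \<sigma>_def less_top)
  have less: "rv_norm k P W < ennreal C" if "\<sigma> < C" for C
    using that \<sigma> by (simp add: ennreal_less_iff)
  have T: "finite T" "T \<noteq> {}" and c: "0 < c" using adm by (auto simp: admissible_def)
  interpret P: prob_space P by fact
  interpret Q: product_prob_space "\<lambda>_. P" T
    by (simp add: P product_prob_spaceI)
  note indQ = indep_vars_PiM_coordinates[OF P T(2)]
  have ind: "Q.indep_vars (\<lambda>_. borel) (\<lambda>i z. W (z i)) T"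
    by (rule Q.indep_vars_compose2[OF indQ]) simp
  have comp: "distr (PiM T (\<lambda>_. P)) P (\<lambda>z. z i) = P" if "i \<in> T" for i
    using Q.PiM_component[OF that] .
  have mean: "Q.expectation (\<lambda>z. W (z i)) = (\<integral>z. W z \<partial>P)" if "i \<in> T" for i
    using integral_distr[of "\<lambda>z. z i" "PiM T (\<lambda>_. P)" P W] comp[OF that] that by simp
  have nn: "(\<integral>\<^sup>+z. f (z i) \<partial>PiM T (\<lambda>_. P)) = (\<integral>\<^sup>+z. f z \<partial>P)"
    if "i \<in> T" "f \<in> borel_measurable P" for i f
    using nn_integral_distr[of "\<lambda>z. z i" "PiM T (\<lambda>_. P)" P f] comp[OF that(1)] that by simp
  show ?thesis
  proof (cases e)
    case AVG
    then have k: "k = Psi1" and c8: "c \<le> 8" using adm by (auto simp: admissible_def)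
    have "Q.prob {z\<in>space (PiM T (\<lambda>_. P)). c * \<sigma> < \<bar>(\<Sum>i\<in>T. W (z i)) / real (card T) - (\<integral>z. W z \<partial>P)\<bar>}
        \<le> 2 * exp (- real (card T) * c\<^sup>2 / 32)"
    proof (rule Q.prob_gr_limit_le)
      fix C assume "\<sigma> < C"
      then have psi: "psi1_norm P W < ennreal C" using less k by simp
      have psi_i: "(\<integral>\<^sup>+z. ennreal (exp (W (z i) / C)) \<partial>PiM T (\<lambda>_. P)) \<le> 2" if "i \<in> T" for i
        using psi1_norm_lessD(2)[OF psi] pos by (subst nn[OF that]) auto
      show "Q.prob {z\<in>space (PiM T (\<lambda>_. P)). c * C < \<bar>(\<Sum>i\<in>T. W (z i)) / real (card T) - (\<integral>z. W z \<partial>P)\<bar>}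
        \<le> 2 * exp (- real (card T) * c\<^sup>2 / 32)"
        by (rule Q.average_concentration[OF ind T])
          (use pos mean psi1_norm_lessD(1)[OF psi] c c8 psi_i in auto)
    qed (use c in auto)
    then show ?thesis unfolding \<sigma>_def[symmetric] by (simp add: deviates_def failure_bound_def AVG)
  next
    case MOM
    then obtain h where h: "0 < h" "16 \<le> c\<^sup>2 * real h" "\<And>b. b < B \<Longrightarrow> G b \<subseteq> T" "\<And>b. b < B \<Longrightarrow> h \<le> card (G b)"
      and disj: "disjoint_family_on G {..<B}"
      using adm by (auto simp: admissible_def)
    have sq_i: "(\<integral>\<^sup>+z. ennreal ((W (z i))\<^sup>2) \<partial>PiM T (\<lambda>_. P)) \<le> ennreal (2 * C\<^sup>2)"
      if "i \<in> T" "\<sigma> < C" for i C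
      using rv_norm_lessD(2)[OF P W less[OF that(2)]] by (subst nn[OF that(1)]) auto
    have "Q.prob {z\<in>space (PiM T (\<lambda>_. P)). B \<le> 2 * card {b. b < B \<and>
        c * \<sigma> < \<bar>(\<Sum>i\<in>G b. W (z i)) / real (card (G b)) - (\<integral>z. W z \<partial>P)\<bar>}} \<le> exp (- real B / 4)"
      by (rule Q.batch_means_concentration[OF ind T(1) h(3) disj h(4) h(1) mean \<sigma>(2) sq_i c h(2)])
    then show ?thesis unfolding \<sigma>_def[symmetric] by (simp add: deviates_def failure_bound_def MOM)
  qed
qed

lemma deviation_event_measurable:
  assumes [measurable]: "\<And>i. i \<in> T \<Longrightarrow> (\<lambda>x. v x i) \<in> borel_measurable N"
      "s \<in> borel_measurable N" "\<mu> \<in> borel_measurable N"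
    and adm: "admissible e k B G T c"
  shows "{x\<in>space N. deviates e B G T (s x) (\<mu> x) (v x)} \<in> sets N"
proof (cases e)
  case AVG
  then show ?thesis by (simp add: deviates_def)
next
  case MOM
  have G: "i \<in> T" if "b < B" "i \<in> G b" for b i using adm that MOM by (auto simp: admissible_def)
  define h where "h b x = \<bar>(\<Sum>i\<in>G b. v x i) / real (card (G b)) - \<mu> x\<bar>" for b x
  have [measurable]: "h b \<in> borel_measurable N" if "b < B" for b
    unfolding h_def using G[OF that] by measurable
  have "real (card {b. b < B \<and> s x < h b x}) = (\<Sum>b<B. if s x < h b x then 1 else 0)" for x
    by (simp add: sum.If_cases Int_def)
  then have "{x\<in>space N. deviates e B G T (s x) (\<mu> x) (v x)}
      = {x\<in>space N. real B \<le> 2 * (\<Sum>b<B. if s x < h b x then 1 else 0)}"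
    unfolding deviates_def h_def MOM by (auto simp flip: of_nat_le_iff[where 'a=real])
  also have "\<dots> \<in> sets N" by measurable
  finally show ?thesis .
qed

text \<open>
  The loss function \<open>w x\<close> is fitted on the coordinates outside \<open>T\<close> and evaluated on those in \<open>T\<close>. By
  Fubini the probability is an average, over the training coordinates, of the probabilities for a fixed
  predictor, and these are bounded uniformly. Where the norm is infinite there is nothing to bound, so
  these points are left out of \<open>A\<close>.
\<close>
lemma deviation_prob_trained_predictor:
  fixes w :: "(nat \<Rightarrow> 'a) \<Rightarrow> 'a \<Rightarrow> real"
  assumes P: "prob_space P" and I: "finite I" "T \<subseteq> I"
    and w[measurable]: "(\<lambda>(x, z). w x z) \<in> borel_measurable (PiM I (\<lambda>_. P) \<Otimes>\<^sub>M P)"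
    and pos: "\<And>x z. 0 \<le> w x z"
    and train: "\<And>x x'. (\<And>i. i \<in> I - T \<Longrightarrow> x i = x' i) \<Longrightarrow> w x = w x'"
    and adm: "admissible e k B G T c"
  defines "A \<equiv> {x\<in>space (PiM I (\<lambda>_. P)). rv_norm k P (w x) \<noteq> \<infinity> \<and>
      deviates e B G T (c * enn2real (rv_norm k P (w x))) (\<integral>z. w x z \<partial>P) (\<lambda>i. w x (x i))}"
  shows "A \<in> sets (PiM I (\<lambda>_. P))" and "measure (PiM I (\<lambda>_. P)) A \<le> failure_bound e B (card T) c"
proof -
  interpret P: prob_space P by fact
  interpret L: product_prob_space "\<lambda>_. P" I
    by (simp add: P product_prob_spaceI)
  interpret Q: product_prob_space "\<lambda>_. P" T
    by (simp add: P product_prob_spaceI)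
  interpret R: product_prob_space "\<lambda>_. P" "I - T"
    by (simp add: P product_prob_spaceI)
  have [measurable]: "(\<lambda>x. rv_norm k P (w x)) \<in> borel_measurable (PiM I (\<lambda>_. P))"
    by (rule borel_measurable_rv_norm[OF P w])
  have [measurable]: "(\<lambda>x. \<integral>z. w x z \<partial>P) \<in> borel_measurable (PiM I (\<lambda>_. P))"
    by (rule P.borel_measurable_lebesgue_integral) simp
  have coord: "(\<lambda>x. w x (x i)) \<in> borel_measurable (PiM I (\<lambda>_. P))" if "i \<in> T" for i
  proof -
    have "(\<lambda>x. (x, x i)) \<in> measurable (PiM I (\<lambda>_. P)) (PiM I (\<lambda>_. P) \<Otimes>\<^sub>M P)"
      using that I by auto
    from measurable_compose[OF this w] show ?thesis by simp
  qed
  have "A = {x\<in>space (PiM I (\<lambda>_. P)). rv_norm k P (w x) \<noteq> \<infinity>} \<inter>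
     {x\<in>space (PiM I (\<lambda>_. P)).
      deviates e B G T (c * enn2real (rv_norm k P (w x))) (\<integral>z. w x z \<partial>P) (\<lambda>i. w x (x i))}"
    by (auto simp: A_def)
  also have "\<dots> \<in> sets (PiM I (\<lambda>_. P))"
    by (intro sets.Int deviation_event_measurable[OF _ _ _ adm] coord) measurable
  finally show A: "A \<in> sets (PiM I (\<lambda>_. P))" .
  have IT: "I - T \<union> T = I" using I by auto
  have fb: "0 \<le> failure_bound e B (card T) c" by (cases e) (auto simp: failure_bound_def)
  have slice: "emeasure (PiM T (\<lambda>_. P)) ((\<lambda>y. merge (I - T) T (x, y)) -` A \<inter> space (PiM T (\<lambda>_. P)))
      \<le> ennreal (failure_bound e B (card T) c)" if x: "x \<in> space (PiM (I - T) (\<lambda>_. P))" for x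
  proof -
    let ?S = "(\<lambda>y. merge (I - T) T (x, y)) -` A \<inter> space (PiM T (\<lambda>_. P))"
    have same: "w (merge (I - T) T (x, y)) = w x" for y
      by (rule train) (auto simp: merge_def)
    have val: "w (merge (I - T) T (x, y)) (merge (I - T) T (x, y) i) = w x (y i)" if "i \<in> T" for y i
      using that by (simp add: same)
    have dev: "deviates e B G T s \<mu> (\<lambda>i. w (merge (I - T) T (x, y)) (merge (I - T) T (x, y) i))
        \<longleftrightarrow> deviates e B G T s \<mu> (\<lambda>i. w x (y i))" for y s \<mu>
      by (rule deviates_cong[OF adm]) (rule val)
    show ?thesis
    proof (cases "?S = {}")
      case False
      then obtain y0 where y0: "y0 \<in> space (PiM T (\<lambda>_. P))" "merge (I - T) T (x, y0) \<in> A" by auto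
      then have sp: "merge (I - T) T (x, y0) \<in> space (PiM I (\<lambda>_. P))"
        and fin: "rv_norm k P (w x) \<noteq> \<infinity>" by (auto simp: A_def same)
      have wx: "w x \<in> borel_measurable P"
        using measurable_Pair2[OF w sp] by (simp add: same)
      have wy: "(\<lambda>y. w x (y i)) \<in> borel_measurable (PiM T (\<lambda>_. P))" if "i \<in> T" for i
        by (rule measurable_compose[OF _ wx]) (use that in simp)
      have "?S \<subseteq> {z\<in>space (PiM T (\<lambda>_. P)).
          deviates e B G T (c * enn2real (rv_norm k P (w x))) (\<integral>z. w x z \<partial>P) (\<lambda>i. w x (z i))}"
        unfolding A_def using dev same by auto
      moreover have "{z\<in>space (PiM T (\<lambda>_. P)).
          deviates e B G T (c * enn2real (rv_norm k P (w x))) (\<integral>z. w x z \<partial>P) (\<lambda>i. w x (z i))} \<in> sets (PiM T (\<lambda>_. P))"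
        by (intro deviation_event_measurable[OF _ _ _ adm] borel_measurable_const wy)
      ultimately have "emeasure (PiM T (\<lambda>_. P)) ?S \<le> emeasure (PiM T (\<lambda>_. P)) {z\<in>space (PiM T (\<lambda>_. P)).
          deviates e B G T (c * enn2real (rv_norm k P (w x))) (\<integral>z. w x z \<partial>P) (\<lambda>i. w x (z i))}"
        by (rule emeasure_mono)
      also have "\<dots> \<le> ennreal (failure_bound e B (card T) c)"
        unfolding Q.emeasure_eq_measure
        by (intro ennreal_leI deviation_prob_fixed_predictor[OF P wx pos fin adm])
      finally show ?thesis .
    qed simp
  qed
  have "emeasure (PiM I (\<lambda>_. P)) A
      = (\<integral>\<^sup>+x. emeasure (PiM T (\<lambda>_. P)) ((\<lambda>y. merge (I - T) T (x, y)) -` A \<inter> space (PiM T (\<lambda>_. P)))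
          \<partial>PiM (I - T) (\<lambda>_. P))"
    using L.emeasure_fold_integral[of "I - T" T A] A I finite_subset[OF I(2,1)] unfolding IT by auto
  also have "\<dots> \<le> (\<integral>\<^sup>+x. ennreal (failure_bound e B (card T) c) \<partial>PiM (I - T) (\<lambda>_. P))"
    by (intro nn_integral_mono slice)
  also have "\<dots> = ennreal (failure_bound e B (card T) c)"
    by (simp add: R.emeasure_space_1)
  finally show "measure (PiM I (\<lambda>_. P)) A \<le> failure_bound e B (card T) c"
    using fb by (simp add: L.emeasure_eq_measure)
qed

text \<open>
  A finitely valued \<open>U\<close> that is independent of \<open>X\<close> can be conditioned on by summing over its values.
  In the application \<open>U\<close> is the split together with the subsamples, and \<open>X\<close> is the data.
\<close>
lemma (in prob_space) mixture_measurable: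
  fixes U :: "'a \<Rightarrow> 'u"
  assumes [measurable]: "X \<in> measurable M D" and V: "finite V" "\<And>\<omega>. \<omega> \<in> space M \<Longrightarrow> U \<omega> \<in> V"
    and U[measurable]: "\<And>u. u \<in> V \<Longrightarrow> {\<omega>\<in>space M. U \<omega> = u} \<in> events"
    and F[measurable]: "\<And>u. u \<in> V \<Longrightarrow> F u \<in> measurable D N"
  shows "(\<lambda>\<omega>. F (U \<omega>) (X \<omega>)) \<in> measurable M N"
proof (rule measurableI)
  fix \<omega> assume "\<omega> \<in> space M"
  then show "F (U \<omega>) (X \<omega>) \<in> space N"
    by (meson F V(2) assms(1) measurable_space)
next
  fix A assume A: "A \<in> sets N"
  have "(\<lambda>\<omega>. F (U \<omega>) (X \<omega>)) -` A \<inter> space M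
      = (\<Union>u\<in>V. {\<omega>\<in>space M. U \<omega> = u} \<inter> ((\<lambda>\<omega>. F u (X \<omega>)) -` A \<inter> space M))"
    using V(2) by auto
  also have "\<dots> \<in> events"
    using A by (intro sets.finite_UN V sets.Int U measurable_sets[OF measurable_compose[OF assms(1) F]])
  finally show "(\<lambda>\<omega>. F (U \<omega>) (X \<omega>)) -` A \<inter> space M \<in> events" .
qed

lemma (in prob_space) mixture_prob:
  fixes U :: "'a \<Rightarrow> 'u"
  assumes X[measurable]: "X \<in> measurable M D" and V: "finite V" "\<And>\<omega>. \<omega> \<in> space M \<Longrightarrow> U \<omega> \<in> V"
    and U: "\<And>u. u \<in> V \<Longrightarrow> {\<omega>\<in>space M. U \<omega> = u} \<in> events"
    and ind: "\<And>u A. u \<in> V \<Longrightarrow> A \<in> sets D \<Longrightarrow>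
      prob ({\<omega>\<in>space M. U \<omega> = u} \<inter> (X -` A \<inter> space M)) = prob {\<omega>\<in>space M. U \<omega> = u} * prob (X -` A \<inter> space M)"
    and A: "\<And>u. u \<in> V \<Longrightarrow> A u \<in> sets D"
  shows "{\<omega>\<in>space M. X \<omega> \<in> A (U \<omega>)} \<in> events"
    and "prob {\<omega>\<in>space M. X \<omega> \<in> A (U \<omega>)}
       = (\<Sum>u\<in>V. prob {\<omega>\<in>space M. U \<omega> = u} * measure (distr M D X) (A u))"
proof -
  define S where "S u = {\<omega>\<in>space M. U \<omega> = u} \<inter> (X -` A u \<inter> space M)" for u
  have S: "S u \<in> events" if "u \<in> V" for u
    unfolding S_def using U[OF that] measurable_sets[OF X A[OF that]] by auto
  have eq: "{\<omega>\<in>space M. X \<omega> \<in> A (U \<omega>)} = (\<Union>u\<in>V. S u)"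
    using V(2) by (auto simp: S_def)
  show "{\<omega>\<in>space M. X \<omega> \<in> A (U \<omega>)} \<in> events"
    unfolding eq using V S by (intro sets.finite_UN) auto
  have "prob (\<Union>u\<in>V. S u) = (\<Sum>u\<in>V. prob (S u))"
    using V S by (intro finite_measure_finite_Union) (auto simp: disjoint_family_on_def S_def)
  also have "\<dots> = (\<Sum>u\<in>V. prob {\<omega>\<in>space M. U \<omega> = u} * measure (distr M D X) (A u))"
    unfolding S_def by (intro sum.cong refl) (simp add: ind A measure_distr)
  finally show "prob {\<omega>\<in>space M. X \<omega> \<in> A (U \<omega>)}
       = (\<Sum>u\<in>V. prob {\<omega>\<in>space M. U \<omega> = u} * measure (distr M D X) (A u))"
    unfolding eq .
qed

lemma (in prob_space) sum_prob_values:
  assumes V: "finite V" "\<And>\<omega>. \<omega> \<in> space M \<Longrightarrow> U \<omega> \<in> V"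
    and U: "\<And>u. u \<in> V \<Longrightarrow> {\<omega>\<in>space M. U \<omega> = u} \<in> events"
  shows "(\<Sum>u\<in>V. prob {\<omega>\<in>space M. U \<omega> = u}) = 1"
proof -
  have "(\<Sum>u\<in>V. prob {\<omega>\<in>space M. U \<omega> = u}) = prob (\<Union>u\<in>V. {\<omega>\<in>space M. U \<omega> = u})"
    using V U by (intro finite_measure_finite_Union[symmetric]) (auto simp: disjoint_family_on_def)
  also have "(\<Union>u\<in>V. {\<omega>\<in>space M. U \<omega> = u}) = space M" using V by auto
  finally show ?thesis by (simp add: prob_space)
qed

section \<open>The experiment at one sample size\<close>

locale zs_experiment_at =
  fixes E :: "'w zero_step" and n :: nat
  assumes bags_pos: "1 \<le> bags E"
    and nu_pos: "0 < nu E"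
    and mom_A_pos: "0 < mom_A E"
    and loss_nonneg: "0 \<le> lossfun E y a"
    and loss_measurable[measurable]: "(\<lambda>(y, a). lossfun E y a) \<in> borel_measurable (borel \<Otimes>\<^sub>M borel)"
    and procedure_measurable: "measurable_procedure (proc E)"
    and avg_psi1: "est E = AVG \<Longrightarrow> norm_choice E = Psi1"
    and is_experiment: "zs_experiment E n"
begin

\<comment> \<open>keeps index ranges in the form \<open>{1..n}\<close>\<close>
declare One_nat_def [simp del]

abbreviation "\<Omega> \<equiv> prob_of E n"
abbreviation "P \<equiv> law E n"
abbreviation "m \<equiv> n_test E n"
abbreviation "D \<equiv> PiM {1..n} (\<lambda>_. law E n)"

sublocale prob_space \<Omega>
  using is_experiment by (simp add: zs_experiment_def)

lemma prob_law: "prob_space P" and sets_law: "sets P = sets (obs_space (pdim E n))"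
  and test_size: "0 < m" "m < n"
  using is_experiment by (auto simp: zs_experiment_def)

lemma test_set_mem: "\<omega> \<in> space \<Omega> \<Longrightarrow> test_set E n \<omega> \<in> test_splits E n"
  and subsample_mem: "\<omega> \<in> space \<Omega> \<Longrightarrow> \<xi> \<in> grid E n \<Longrightarrow> j \<in> {1..bags E} \<Longrightarrow>
    subsample E n \<xi> j \<omega> \<in> train_subsets E n \<xi> (test_set E n \<omega>)"
  and xihat_arg_min: "\<omega> \<in> space \<Omega> \<Longrightarrow>
    is_arg_min (\<lambda>\<xi>. est_risk E n \<omega> (bagged_predictor E n \<xi> \<omega>)) (\<lambda>\<xi>. \<xi> \<in> grid E n) (xihat E n \<omega>)"
  using is_experiment by (auto simp: zs_experiment_def)

lemma block_pos: "0 < block E n"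
proof -
  have "1 \<le> real n powr nu E" using test_size nu_pos by (intro ge_one_powr_ge_zero) auto
  then have "1 \<le> \<lfloor>real n powr nu E\<rfloor>" by (simp add: le_floor_iff)
  then show ?thesis by (simp add: block_def)
qed

lemma finite_grid: "finite (grid E n)"
  by (simp add: grid_def)

lemma grid_nonempty: "grid E n \<noteq> {}"
  using not_empty xihat_arg_min by (auto simp: is_arg_min_def)

lemma card_grid_pos: "0 < card (grid E n)"
  using finite_grid grid_nonempty by (simp add: card_gt_0_iff)

lemma card_grid_le: "card (grid E n) \<le> n"
proof -
  have "real (n_train E n) / real (block E n) \<le> real (n_train E n) / 1"
    using block_pos by (intro divide_left_mono) auto
  also have "\<dots> \<le> real n" by (simp add: n_train_def)
  finally have "\<lceil>real (n_train E n) / real (block E n) - 2\<rceil> \<le> int n"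
    by linarith
  then show ?thesis by (simp add: grid_def)
qed

lemma sub_size_pos:
  assumes "\<xi> \<in> grid E n"
  shows "0 < sub_size E n \<xi>"
proof -
  have "int \<xi> \<le> \<lceil>real (n_train E n) / real (block E n) - 2\<rceil>"
    using assms by (auto simp: grid_def)
  then have "real \<xi> < real (n_train E n) / real (block E n) - 2 + 1"
    by linarith
  then have "real \<xi> * real (block E n) < real (n_train E n)"
    using block_pos by (simp add: field_simps)
  then have "\<xi> * block E n < n_train E n"
    by (metis of_nat_less_iff of_nat_mult)
  then show ?thesis by (simp add: sub_size_def)
qed

lemma data_measurable[measurable]: "data E n \<in> measurable \<Omega> D"
  and distr_data: "distr \<Omega> D (data E n) = D"
proof -
  have ind: "indep_vars (\<lambda>_. P) (obs E n) {1..n}"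
    and law: "\<And>i. i \<in> {1..n} \<Longrightarrow> distr \<Omega> P (obs E n i) = P"
    using is_experiment by (auto simp: zs_experiment_def)
  have meas: "obs E n i \<in> measurable \<Omega> P" if "i \<in> {1..n}" for i
    using ind that by (auto simp: indep_vars_def)
  show "data E n \<in> measurable \<Omega> D"
    unfolding data_def[abs_def] by (intro measurable_restrict meas)
  have "distr \<Omega> D (\<lambda>\<omega>. \<lambda>i\<in>{1..n}. obs E n i \<omega>) = PiM {1..n} (\<lambda>i. distr \<Omega> P (obs E n i))"
    using indep_vars_iff_distr_eq_PiM'[where I="{1..n}" and M'="\<lambda>_. P" and X="obs E n"] ind meas test_size by auto
  also have "\<dots> = D" by (intro PiM_cong refl law)
  finally show "distr \<Omega> D (data E n) = D" by (simp add: data_def[abs_def])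
qed

lemma dataset_data: "S \<subseteq> {1..n} \<Longrightarrow> dataset (\<lambda>i. obs E n i \<omega>) S = dataset (data E n \<omega>) S"
  unfolding dataset_def data_def
  by (intro map_cong refl) (metis finite_atLeastAtMost finite_subset restrict_apply' set_sorted_list_of_set subsetD)

text \<open>
  The part of the randomization that enters the predictor at \<open>\<xi>\<close>. Filling in \<open>{}\<close> outside the range of
  \<open>j\<close> matches the default value of \<open>Pi_pmf\<close> in the joint law and leaves finitely many values.
\<close>
definition draw :: "nat \<Rightarrow> 'w \<Rightarrow> nat set \<times> (nat \<Rightarrow> nat set)" where
  "draw \<xi> \<omega> = (test_set E n \<omega>, \<lambda>j. if j \<in> {1..bags E} then subsample E n \<xi> j \<omega> else {})"

definition draws :: "nat \<Rightarrow> (nat set \<times> (nat \<Rightarrow> nat set)) set" where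
  "draws \<xi> = {(T, S). T \<in> test_splits E n \<and> (\<forall>j\<in>{1..bags E}. S j \<in> train_subsets E n \<xi> T) \<and>
     (\<forall>j. j \<notin> {1..bags E} \<longrightarrow> S j = {})}"

lemma finite_draws: "finite (draws \<xi>)"
proof (rule finite_subset)
  show "draws \<xi> \<subseteq> Pow {1..n} \<times> {S. \<forall>j. (j \<in> {1..bags E} \<longrightarrow> S j \<in> Pow {1..n}) \<and> (j \<notin> {1..bags E} \<longrightarrow> S j = {})}"
    by (auto simp: draws_def test_splits_def train_subsets_def)
  show "finite (Pow {1..n} \<times> {S. \<forall>j. (j \<in> {1..bags E} \<longrightarrow> S j \<in> Pow {1..n}) \<and> (j \<notin> {1..bags E} \<longrightarrow> S j = {})})"
    by (intro finite_cartesian_product finite_set_of_finite_funs) auto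
qed

lemma draw_mem: "\<xi> \<in> grid E n \<Longrightarrow> \<omega> \<in> space \<Omega> \<Longrightarrow> draw \<xi> \<omega> \<in> draws \<xi>"
  unfolding draw_def draws_def mem_Collect_eq case_prod_conv
  by (intro conjI ballI allI impI) (simp_all add: test_set_mem subsample_mem del: atLeastAtMost_iff)

text \<open>
  Independence from the data is available for events of the whole randomization, so each event of
  \<open>draw \<xi>\<close> is rewritten as one.
\<close>
lemma draw_event_randomization:
  assumes "\<xi> \<in> grid E n"
  shows "\<exists>B. {\<omega>\<in>space \<Omega>. Q (draw \<xi> \<omega>)} = randomization E n -` B \<inter> space \<Omega>"
proof -
  define h where "h r = (fst r, \<lambda>j. if j \<in> {1..bags E} then snd r \<xi> j else {})"
    for r :: "nat set \<times> (nat \<Rightarrow> nat \<Rightarrow> nat set)"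
  have "draw \<xi> \<omega> = h (randomization E n \<omega>)" for \<omega>
    unfolding draw_def h_def randomization_def fst_conv snd_conv restrict_apply'[OF assms]
    by (intro arg_cong2[where f=Pair] refl ext) (metis restrict_apply')
  then have "{\<omega>\<in>space \<Omega>. Q (draw \<xi> \<omega>)} = randomization E n -` {r. Q (h r)} \<inter> space \<Omega>"
    by (auto simp only: vimage_eq mem_Collect_eq)
  then show ?thesis by (rule exI)
qed

lemma indep_randomization: "indep_set
       {data E n -` A \<inter> space \<Omega> | A. A \<in> sets D}
       {randomization E n -` B \<inter> space \<Omega> | B. B \<in> UNIV}"
  using is_experiment by (simp add: zs_experiment_def)

lemma draw_events: "\<xi> \<in> grid E n \<Longrightarrow> {\<omega>\<in>space \<Omega>. Q (draw \<xi> \<omega>)} \<in> events"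
  using draw_event_randomization[of \<xi> Q] by (auto intro!: subsetD[OF indep_setD_ev2[OF indep_randomization]])

lemma draw_indep:
  assumes "\<xi> \<in> grid E n" "A \<in> sets D"
  shows "prob ({\<omega>\<in>space \<Omega>. Q (draw \<xi> \<omega>)} \<inter> (data E n -` A \<inter> space \<Omega>))
    = prob {\<omega>\<in>space \<Omega>. Q (draw \<xi> \<omega>)} * prob (data E n -` A \<inter> space \<Omega>)"
proof -
  obtain B where B: "{\<omega>\<in>space \<Omega>. Q (draw \<xi> \<omega>)} = randomization E n -` B \<inter> space \<Omega>"
    using draw_event_randomization[OF assms(1)] by blast
  have "prob ((data E n -` A \<inter> space \<Omega>) \<inter> (randomization E n -` B \<inter> space \<Omega>))
      = prob (data E n -` A \<inter> space \<Omega>) * prob (randomization E n -` B \<inter> space \<Omega>)"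
    by (rule indep_setD[OF indep_randomization]) (use assms in auto)
  then show ?thesis unfolding B by (simp add: Int_commute mult.commute)
qed

lemma distr_draw:
  assumes "\<xi> \<in> grid E n"
  shows "prob {\<omega>\<in>space \<Omega>. draw \<xi> \<omega> \<in> X} = measure_pmf.prob (split_subsample_law E n \<xi>) X"
proof -
  have "draw \<xi> \<in> measurable \<Omega> (count_space UNIV)"
  proof (rule measurableI)
    fix A assume "A \<in> sets (count_space (UNIV :: (nat set \<times> (nat \<Rightarrow> nat set)) set))"
    show "draw \<xi> -` A \<inter> space \<Omega> \<in> events"
      using draw_events[OF assms, of "\<lambda>u. u \<in> A"] by (simp add: vimage_def Int_def conj_commute)
  qed auto
  then have "measure (distr \<Omega> (count_space UNIV) (draw \<xi>)) X = prob (draw \<xi> -` X \<inter> space \<Omega>)"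
    by (rule measure_distr) simp
  moreover have "distr \<Omega> (count_space UNIV) (draw \<xi>) = measure_pmf (split_subsample_law E n \<xi>)"
    using is_experiment assms by (simp add: zs_experiment_def draw_def[abs_def])
  ultimately show ?thesis by (simp add: vimage_def Int_def conj_commute)
qed

text \<open>
  The right-hand side is free of \<open>j\<close>: all subsamples at the same \<open>\<xi>\<close> are identically distributed.
\<close>
lemma prob_subsample_eq:
  assumes "\<xi> \<in> grid E n" "j \<in> {1..bags E}"
  shows "prob {\<omega>\<in>space \<Omega>. subsample E n \<xi> j \<omega> = S}
    = pmf (bind_pmf (pmf_of_set (test_splits E n)) (\<lambda>T. pmf_of_set (train_subsets E n \<xi> T))) S"
proof -
  have "{\<omega>\<in>space \<Omega>. subsample E n \<xi> j \<omega> = S} = {\<omega>\<in>space \<Omega>. draw \<xi> \<omega> \<in> {u. snd u j = S}}"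
    by (rule Collect_cong) (simp only: draw_def snd_conv assms(2) if_True mem_Collect_eq)
  then have "prob {\<omega>\<in>space \<Omega>. subsample E n \<xi> j \<omega> = S}
      = measure_pmf.prob (split_subsample_law E n \<xi>) ((\<lambda>u. snd u j) -` {S})"
    using distr_draw[OF assms(1), where X="{u. snd u j = S}"] by (simp add: vimage_def)
  also have "\<dots> = pmf (map_pmf (\<lambda>u. snd u j) (split_subsample_law E n \<xi>)) S"
    by (simp add: pmf_map)
  also have "map_pmf (\<lambda>u. snd u j) (split_subsample_law E n \<xi>)
      = bind_pmf (pmf_of_set (test_splits E n)) (\<lambda>T. pmf_of_set (train_subsets E n \<xi> T))"
    using assms(2) unfolding split_subsample_law_def
    by (simp add: map_bind_pmf map_pmf_comp Pi_pmf_component)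
  finally show ?thesis .
qed

text \<open>
  The dataset of an index set lists its coordinates in increasing order, which reduces the claim to the
  measurability of the procedure in a family indexed by \<open>{..<card S}\<close>.
\<close>
lemma fit_measurable:
  assumes S: "S \<subseteq> {1..n}" "S \<noteq> {}"
  shows "(\<lambda>(x, z). proc E (pdim E n) (dataset x S) (fst z)) \<in> borel_measurable (D \<Otimes>\<^sub>M P)"
proof -
  let ?l = "sorted_list_of_set S" and ?k = "card S"
  have finS: "finite S" by (rule finite_subset[OF S(1)]) simp
  have set: "set ?l = S" and len: "length ?l = ?k" using finS by auto
  have "0 < ?k" using S finS by (simp add: card_gt_0_iff)
  then have k: "1 \<le> ?k" by linarith
  have [measurable_cong]: "sets P = sets (point_space (pdim E n) \<Otimes>\<^sub>M borel)"
    using sets_law by (simp add: obs_space_def)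
  have sets_obs: "sets P = sets (obs_space (pdim E n))" by (rule sets_law)
  have re: "dataset x S = map (\<lambda>i\<in>{..<?k}. x (?l ! i)) [0..<?k]" for x :: "nat \<Rightarrow> observation"
    unfolding dataset_def by (rule nth_equalityI) (auto simp: len)
  have nth: "?l ! i \<in> {1..n}" if "i < ?k" for i
    using S set len that by (metis nth_mem subsetD)
  have 1: "(\<lambda>u. (\<lambda>i\<in>{..<?k}. fst u (?l ! i))) \<in> measurable (D \<Otimes>\<^sub>M P) (PiM {..<?k} (\<lambda>_. obs_space (pdim E n)))"
  proof (rule measurable_restrict)
    fix i assume i: "i \<in> {..<?k}"
    have "(\<lambda>u. fst u (?l ! i)) \<in> measurable (D \<Otimes>\<^sub>M P) P"
      by (rule measurable_compose[OF measurable_fst]) (use nth i in simp)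
    then show "(\<lambda>u. fst u (?l ! i)) \<in> measurable (D \<Otimes>\<^sub>M P) (obs_space (pdim E n))"
      using measurable_cong_sets[OF refl sets_obs] by blast
  qed
  have 2: "(\<lambda>u. fst (snd u)) \<in> measurable (D \<Otimes>\<^sub>M P) (point_space (pdim E n))"
    by measurable
  have f: "(\<lambda>(z, x). proc E (pdim E n) (map z [0..<?k]) x)
      \<in> borel_measurable (PiM {..<?k} (\<lambda>_. obs_space (pdim E n)) \<Otimes>\<^sub>M point_space (pdim E n))"
    using procedure_measurable k by (simp add: measurable_procedure_def)
  have "(\<lambda>u. proc E (pdim E n) (map (\<lambda>i\<in>{..<?k}. fst u (?l ! i)) [0..<?k]) (fst (snd u)))
      \<in> borel_measurable (D \<Otimes>\<^sub>M P)"
    using measurable_compose[OF measurable_Pair[OF 1 2] f] by simp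
  then show ?thesis unfolding re by (simp add: case_prod_beta')
qed

definition loss_of :: "(point \<Rightarrow> real) \<Rightarrow> observation \<Rightarrow> real" where
  "loss_of f z = lossfun E (snd z) (f (fst z))"

lemma loss_of_nonneg: "0 \<le> loss_of f z"
  by (simp add: loss_of_def loss_nonneg)

lemma loss_of_measurable:
  assumes [measurable]: "(\<lambda>(x, z). f x (fst z)) \<in> borel_measurable (D \<Otimes>\<^sub>M P)"
  shows "(\<lambda>(x, z). loss_of (f x) z) \<in> borel_measurable (D \<Otimes>\<^sub>M P)"
proof -
  have [measurable_cong]: "sets P = sets (point_space (pdim E n) \<Otimes>\<^sub>M borel)"
    using sets_law by (simp add: obs_space_def)
  have "(\<lambda>u. (snd (snd u), f (fst u) (fst (snd u)))) \<in> measurable (D \<Otimes>\<^sub>M P) (borel \<Otimes>\<^sub>M borel)"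
    using assms by (intro measurable_Pair) (auto simp: case_prod_beta')
  from measurable_compose[OF this loss_measurable] show ?thesis
    by (simp add: loss_of_def case_prod_beta')
qed

lemma Risk_eq: "Risk E n f = (\<integral>\<^sup>+ z. ennreal (loss_of f z) \<partial>P)"
  by (simp add: Risk_def risk_def loss_of_def case_prod_beta')

lemma Risk_measurable:
  assumes "(\<lambda>(x, z). f x (fst z)) \<in> borel_measurable (D \<Otimes>\<^sub>M P)"
  shows "(\<lambda>x. Risk E n (f x)) \<in> borel_measurable D"
proof -
  interpret law: prob_space P by (rule prob_law)
  note [measurable] = loss_of_measurable[OF assms]
  show ?thesis unfolding Risk_eq by measurable
qed

definition bag_of :: "(nat \<Rightarrow> observation) \<Rightarrow> (nat \<Rightarrow> nat set) \<Rightarrow> predictor" where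
  "bag_of x S p = (\<Sum>j = 1..bags E. proc E (pdim E n) (dataset x (S j)) p) / real (bags E)"

lemma draws_subset:
  assumes "\<xi> \<in> grid E n" "u \<in> draws \<xi>" "j \<in> {1..bags E}"
  shows "snd u j \<subseteq> {1..n} - fst u" "snd u j \<noteq> {}"
proof -
  have "snd u j \<in> train_subsets E n \<xi> (fst u)"
    using assms(2,3) by (auto simp: draws_def)
  then show "snd u j \<subseteq> {1..n} - fst u" "snd u j \<noteq> {}"
    using sub_size_pos[OF assms(1)] by (auto simp: train_subsets_def)
qed

lemma bag_of_measurable:
  assumes "\<xi> \<in> grid E n" "u \<in> draws \<xi>"
  shows "(\<lambda>(x, z). bag_of x (snd u) (fst z)) \<in> borel_measurable (D \<Otimes>\<^sub>M P)"
proof -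
  have [measurable]: "(\<lambda>y. proc E (pdim E n) (dataset (fst y) (snd u j)) (fst (snd y)))
      \<in> borel_measurable (D \<Otimes>\<^sub>M P)" if "j \<in> {1..bags E}" for j
    using fit_measurable[of "snd u j"] draws_subset[OF assms that] by (auto simp: case_prod_beta')
  show ?thesis unfolding bag_of_def case_prod_beta' by measurable
qed

lemma bagged_predictor_eq:
  assumes "\<xi> \<in> grid E n" "\<omega> \<in> space \<Omega>"
  shows "bagged_predictor E n \<xi> \<omega> = bag_of (data E n \<omega>) (snd (draw \<xi> \<omega>))"
proof
  fix p
  have "subsample E n \<xi> j \<omega> \<subseteq> {1..n}" if "j \<in> {1..bags E}" for j
    using subsample_mem[OF assms(2,1) that] by (auto simp: train_subsets_def)
  then show "bagged_predictor E n \<xi> \<omega> p = bag_of (data E n \<omega>) (snd (draw \<xi> \<omega>)) p"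
    unfolding bagged_predictor_def bag_of_def base_predictor_def draw_def
    by (auto intro!: arg_cong2[where f="(/)"] sum.cong simp: dataset_data)
qed

lemma measurable_of_draw:
  assumes \<xi>: "\<xi> \<in> grid E n"
    and F: "\<And>u. u \<in> draws \<xi> \<Longrightarrow> (\<lambda>x. F (bag_of x (snd u))) \<in> borel_measurable D"
  shows "(\<lambda>\<omega>. F (bagged_predictor E n \<xi> \<omega>)) \<in> borel_measurable \<Omega>"
proof -
  have "(\<lambda>\<omega>. (\<lambda>u x. F (bag_of x (snd u))) (draw \<xi> \<omega>) (data E n \<omega>)) \<in> borel_measurable \<Omega>"
    by (rule mixture_measurable[where V="draws \<xi>" and D=D])
      (use finite_draws draw_mem[OF \<xi>] draw_events[OF \<xi>, where Q="\<lambda>v. v = _"] F in auto)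
  then show ?thesis
    by (subst measurable_cong[where g="\<lambda>\<omega>. F (bag_of (data E n \<omega>) (snd (draw \<xi> \<omega>)))"])
      (auto simp: bagged_predictor_eq[OF \<xi>])
qed

lemma sigma_hat_eq: "sigma_hat E n \<xi> \<omega> = rv_norm (norm_choice E) P (loss_of (bagged_predictor E n \<xi> \<omega>))"
  by (simp add: sigma_hat_def loss_norm_eq loss_of_def[abs_def] case_prod_beta')

lemma sigma_hat_measurable[measurable]:
  assumes "\<xi> \<in> grid E n"
  shows "sigma_hat E n \<xi> \<in> borel_measurable \<Omega>"
  unfolding sigma_hat_eq
  by (rule measurable_of_draw[OF assms, where F="\<lambda>f. rv_norm (norm_choice E) P (loss_of f)"],
      rule borel_measurable_rv_norm[OF prob_law], rule loss_of_measurable, rule bag_of_measurable[OF assms])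

lemma Risk_bagged_measurable[measurable]:
  assumes "\<xi> \<in> grid E n"
  shows "(\<lambda>\<omega>. Risk E n (bagged_predictor E n \<xi> \<omega>)) \<in> borel_measurable \<Omega>"
  by (rule measurable_of_draw[OF assms], rule Risk_measurable, rule bag_of_measurable[OF assms])

lemma kappa_hat_measurable[measurable]:
  assumes [simp]: "\<xi> \<in> grid E n"
  shows "kappa_hat E n \<xi> \<in> borel_measurable \<Omega>"
  unfolding kappa_hat_def[abs_def] by measurable

lemma max_exceeds:
  "{\<omega>\<in>space \<Omega>. ennreal K < sigma_max E n \<omega>} = (\<Union>\<xi>\<in>grid E n. {\<omega>\<in>space \<Omega>. ennreal K < sigma_hat E n \<xi> \<omega>})"
  "{\<omega>\<in>space \<Omega>. ennreal K < kappa_max E n \<omega>} = (\<Union>\<xi>\<in>grid E n. {\<omega>\<in>space \<Omega>. ennreal K < kappa_hat E n \<xi> \<omega>})"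
  using finite_grid grid_nonempty by (auto simp: sigma_max_def kappa_max_def Max_gr_iff)

lemma max_exceeds_events:
  "{\<omega>\<in>space \<Omega>. ennreal K < sigma_max E n \<omega>} \<in> events"
  "{\<omega>\<in>space \<Omega>. ennreal K < kappa_max E n \<omega>} \<in> events"
  unfolding max_exceeds using finite_grid by (intro sets.finite_UN; measurable)+

lemma base_predictor_eq:
  assumes "\<xi> \<in> grid E n" "\<omega> \<in> space \<Omega>" "j \<in> {1..bags E}"
  shows "base_predictor E n \<xi> j \<omega> = proc E (pdim E n) (dataset (data E n \<omega>) (subsample E n \<xi> j \<omega>))"
proof -
  have "subsample E n \<xi> j \<omega> \<subseteq> {1..n}"
    using subsample_mem[OF assms(2,1,3)] by (auto simp: train_subsets_def)
  then show ?thesis by (simp add: base_predictor_def dataset_data)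
qed

text \<open>
  Condition (DET) speaks about the first subsample; by equality in law the same
  probabilities hold for all the others.
\<close>
lemma prob_base_predictor:
  assumes \<xi>: "\<xi> \<in> grid E n" and j: "j \<in> {1..bags E}" and A: "A \<in> sets borel"
  shows "{\<omega>\<in>space \<Omega>. Risk E n (base_predictor E n \<xi> j \<omega>) \<in> A} \<in> events" (is "?X j \<in> _")
    and "prob {\<omega>\<in>space \<Omega>. Risk E n (base_predictor E n \<xi> j \<omega>) \<in> A}
       = prob {\<omega>\<in>space \<Omega>. Risk E n (base_predictor E n \<xi> 1 \<omega>) \<in> A}"
proof -
  define V where "V = {S. S \<subseteq> {1..n} \<and> S \<noteq> {}}"
  define Y where "Y S = {x\<in>space D. Risk E n (proc E (pdim E n) (dataset x S)) \<in> A}" for S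
  have V: "finite V" by (rule finite_subset[of _ "Pow {1..n}"]) (auto simp: V_def)
  have mem: "subsample E n \<xi> i \<omega> \<in> V" if "i \<in> {1..bags E}" "\<omega> \<in> space \<Omega>" for i \<omega>
    using subsample_mem[OF that(2) \<xi> that(1)] sub_size_pos[OF \<xi>] by (auto simp: V_def train_subsets_def)
  have Y: "Y S \<in> sets D" if "S \<in> V" for S
    unfolding Y_def using that A
    by (intro measurable_sets_Collect[OF Risk_measurable[OF fit_measurable]]) (auto simp: V_def)
  have as_draw: "{\<omega>\<in>space \<Omega>. subsample E n \<xi> i \<omega> = S} = {\<omega>\<in>space \<Omega>. (\<lambda>u. snd u i = S) (draw \<xi> \<omega>)}"
    if "i \<in> {1..bags E}" for i S
    by (rule Collect_cong) (simp only: draw_def snd_conv that if_True)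
  have eq: "?X i = {\<omega>\<in>space \<Omega>. data E n \<omega> \<in> Y (subsample E n \<xi> i \<omega>)}" if "i \<in> {1..bags E}" for i
    using measurable_space[OF data_measurable] by (auto simp: Y_def base_predictor_eq[OF \<xi> _ that])
  have mix: "?X i \<in> events" "prob (?X i) = (\<Sum>S\<in>V. prob {\<omega>\<in>space \<Omega>. subsample E n \<xi> i \<omega> = S} * measure D (Y S))"
    if i: "i \<in> {1..bags E}" for i
  proof -
    have ev: "{\<omega>\<in>space \<Omega>. subsample E n \<xi> i \<omega> = S} \<in> events" for S
      unfolding as_draw[OF i] by (rule draw_events[OF \<xi>])
    have ind: "prob ({\<omega>\<in>space \<Omega>. subsample E n \<xi> i \<omega> = S} \<inter> (data E n -` A \<inter> space \<Omega>))
        = prob {\<omega>\<in>space \<Omega>. subsample E n \<xi> i \<omega> = S} * prob (data E n -` A \<inter> space \<Omega>)"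
      if "A \<in> sets D" for S A
      unfolding as_draw[OF i] by (rule draw_indep[OF \<xi> that])
    show "?X i \<in> events" "prob (?X i) = (\<Sum>S\<in>V. prob {\<omega>\<in>space \<Omega>. subsample E n \<xi> i \<omega> = S} * measure D (Y S))"
      unfolding eq[OF i]
      using mixture_prob[OF data_measurable V mem[OF i] ev ind Y] unfolding distr_data by auto
  qed
  show "?X j \<in> events" by (rule mix(1)[OF j])
  have 1: "1 \<in> {1..bags E}" using bags_pos by simp
  show "prob (?X j) = prob (?X 1)"
    unfolding mix(2)[OF j] mix(2)[OF 1] prob_subsample_eq[OF \<xi> j] prob_subsample_eq[OF \<xi> 1] ..
qed

end

section \<open>Uniform accuracy of the estimated risks\<close>

abbreviation bagged_risk :: "'w zero_step \<Rightarrow> nat \<Rightarrow> nat \<Rightarrow> 'w \<Rightarrow> real" where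
  "bagged_risk E n \<xi> \<omega> \<equiv> enn2real (Risk E n (bagged_predictor E n \<xi> \<omega>))"

text \<open>
  Finiteness is part of the statement because \<open>bagged_risk\<close> is \<open>0\<close> for an infinite risk.
\<close>

abbreviation risk_estimated :: "'w zero_step \<Rightarrow> nat \<Rightarrow> nat \<Rightarrow> 'w \<Rightarrow> real \<Rightarrow> bool" where
  "risk_estimated E n \<xi> \<omega> b \<equiv> Risk E n (bagged_predictor E n \<xi> \<omega>) \<noteq> \<infinity> \<and>
     \<bar>est_risk E n \<omega> (bagged_predictor E n \<xi> \<omega>) - bagged_risk E n \<xi> \<omega>\<bar> \<le> b"

context zs_experiment_at
begin

text \<open>
  The estimator assigns positions in the sorted test set to batches; here the batches are sets of
  observation indices, as needed for independence.
\<close>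
definition batch_group :: "nat set \<Rightarrow> nat \<Rightarrow> nat set" where
  "batch_group T b = (\<lambda>k. sorted_list_of_set T ! k) ` {k. k < m \<and> batch E n k = b}"

lemma split_finite:
  assumes "T \<in> test_splits E n"
  shows "finite T" "T \<noteq> {}" "card T = m" "T \<subseteq> {1..n}"
proof -
  show T: "card T = m" "T \<subseteq> {1..n}" using assms by (auto simp: test_splits_def)
  show "finite T" by (rule finite_subset[OF T(2)]) simp
  show "T \<noteq> {}" using T(1) test_size by auto
qed

lemma inj_on_nth_split:
  assumes "T \<in> test_splits E n"
  shows "inj_on (\<lambda>k. sorted_list_of_set T ! k) {k. k < m}"
  using split_finite[OF assms] by (intro inj_on_nth) auto

lemma card_batch_group:
  assumes "T \<in> test_splits E n"
  shows "card (batch_group T b) = card {k. k < m \<and> batch E n k = b}"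
  unfolding batch_group_def
  by (rule card_image, rule inj_on_subset[OF inj_on_nth_split[OF assms]]) auto

lemma batch_group_subset:
  assumes "T \<in> test_splits E n"
  shows "batch_group T b \<subseteq> T"
proof
  fix i assume "i \<in> batch_group T b"
  then obtain k where "k < m" "i = sorted_list_of_set T ! k" by (auto simp: batch_group_def)
  then show "i \<in> T"
    using split_finite[OF assms] by (metis length_sorted_list_of_set nth_mem set_sorted_list_of_set)
qed

lemma disjoint_batch_groups:
  assumes "T \<in> test_splits E n"
  shows "disjoint_family_on (batch_group T) X"
  unfolding disjoint_family_on_def batch_group_def
  using inj_on_nth_split[OF assms] by (auto simp: inj_on_def)

lemma admissible_split:
  assumes T: "T \<in> test_splits E n" and c: "0 < c"
    and avg: "est E = AVG \<Longrightarrow> c \<le> 8"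
    and mom: "est E = MOM \<Longrightarrow> 0 < m div mom_batches E n \<and> 16 \<le> c\<^sup>2 * real (m div mom_batches E n)"
  shows "admissible (est E) (norm_choice E) (mom_batches E n) (batch_group T) T c"
proof (cases "est E")
  case AVG
  then show ?thesis using split_finite[OF T] c avg avg_psi1 by (simp add: admissible_def)
next
  case MOM
  have "equal_batches m (mom_batches E n) (batch E n)"
    using is_experiment MOM by (simp add: zs_experiment_def)
  then have "m div mom_batches E n \<le> card (batch_group T b)" if "b < mom_batches E n" for b
    using that unfolding card_batch_group[OF T] equal_batches_def by force
  then show ?thesis
    using split_finite[OF T] c mom MOM batch_group_subset[OF T] disjoint_batch_groups[OF T]
    by (auto simp: admissible_def)
qed

lemma est_risk_close:
  assumes \<omega>: "\<omega> \<in> space \<Omega>"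
    and nd: "\<not> deviates (est E) (mom_batches E n) (batch_group (test_set E n \<omega>)) (test_set E n \<omega>) s \<mu>
      (\<lambda>i. loss_of f (obs E n i \<omega>))"
  shows "\<bar>est_risk E n \<omega> f - \<mu>\<bar> \<le> s"
proof (cases "est E")
  case AVG
  then show ?thesis using nd by (simp add: deviates_def est_risk_def loss_of_def Let_def)
next
  case MOM
  let ?T = "test_set E n \<omega>"
  let ?l = "sorted_list_of_set ?T"
  define W where "W i = loss_of f (obs E n i \<omega>)" for i
  note T = test_set_mem[OF \<omega>]
  have cT: "card ?T = m" by (rule split_finite(3)[OF T])
  define h where "h b = (\<Sum>i\<in>batch_group ?T b. W i) / real (card (batch_group ?T b))" for b
  have sum: "(\<Sum>k | k < length (map W ?l) \<and> batch E n k = b. map W ?l ! k) = (\<Sum>i\<in>batch_group ?T b. W i)" for b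
  proof -
    have "(\<Sum>i\<in>batch_group ?T b. W i) = (\<Sum>k | k < m \<and> batch E n k = b. W (?l ! k))"
      unfolding batch_group_def
      by (subst sum.reindex) (auto intro!: inj_on_subset[OF inj_on_nth_split[OF T]])
    also have "\<dots> = (\<Sum>k | k < length (map W ?l) \<and> batch E n k = b. map W ?l ! k)"
      by (intro sum.cong) (simp_all add: cT)
    finally show ?thesis ..
  qed
  have "est_risk E n \<omega> f = median_of_means (mom_batches E n) (batch E n) (map W ?l)"
    by (simp add: est_risk_def MOM W_def[abs_def] loss_of_def Let_def)
  also have "\<dots> = median (map h [0..<mom_batches E n])"
    unfolding median_of_means_def h_def sum by (simp add: cT card_batch_group[OF T])
  finally have "est_risk E n \<omega> f = median (map h [0..<mom_batches E n])" .
  then show ?thesis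
    using median_of_majority[where B="mom_batches E n" and s=s and h=h and \<mu>=\<mu>] nd
    unfolding deviates_def MOM by (simp add: h_def W_def)
qed

text \<open>
  For every value of the draw the exceptional event has the bounded probability in the space of the
  data; the draw is independent of the data, so the mixture obeys the same bound.
\<close>
lemma deviation_event:
  assumes \<xi>: "\<xi> \<in> grid E n" and c: "0 < c"
    and avg: "est E = AVG \<Longrightarrow> c \<le> 8"
    and mom: "est E = MOM \<Longrightarrow> 0 < m div mom_batches E n \<and> 16 \<le> c\<^sup>2 * real (m div mom_batches E n)"
  shows "\<exists>A\<in>events. prob A \<le> failure_bound (est E) (mom_batches E n) m c \<and>
    (\<forall>\<omega>\<in>space \<Omega> - A. sigma_hat E n \<xi> \<omega> \<noteq> \<infinity> \<longrightarrow> risk_estimated E n \<xi> \<omega> (c * enn2real (sigma_hat E n \<xi> \<omega>)))"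
proof -
  define w where "w u x = loss_of (bag_of x (snd u))" for u :: "nat set \<times> (nat \<Rightarrow> nat set)" and x
  define A where "A u = {x\<in>space D. rv_norm (norm_choice E) P (w u x) \<noteq> \<infinity> \<and>
      deviates (est E) (mom_batches E n) (batch_group (fst u)) (fst u)
        (c * enn2real (rv_norm (norm_choice E) P (w u x))) (\<integral>z. w u x z \<partial>P) (\<lambda>i. w u x (x i))}" for u
  have w: "(\<lambda>(x, z). w u x z) \<in> borel_measurable (D \<Otimes>\<^sub>M P)" if "u \<in> draws \<xi>" for u
    unfolding w_def by (rule loss_of_measurable, rule bag_of_measurable[OF \<xi> that])
  have A: "A u \<in> sets D" "measure D (A u) \<le> failure_bound (est E) (mom_batches E n) m c"
    if u: "u \<in> draws \<xi>" for u
  proof -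
    have T: "fst u \<in> test_splits E n" using u by (auto simp: draws_def)
    have dep: "w u x = w u x'" if "\<And>i. i \<in> {1..n} - fst u \<Longrightarrow> x i = x' i" for x x'
    proof -
      have "dataset x (snd u j) = dataset x' (snd u j)" if j: "j \<in> {1..bags E}" for j
      proof -
        have "finite (snd u j)"
          by (rule finite_subset[OF draws_subset(1)[OF \<xi> u j]]) simp
        then show ?thesis
          using draws_subset(1)[OF \<xi> u j] \<open>\<And>i. i \<in> {1..n} - fst u \<Longrightarrow> x i = x' i\<close>
          unfolding dataset_def by (intro map_cong refl) auto
      qed
      then have "bag_of x (snd u) = bag_of x' (snd u)"
        unfolding bag_of_def by (intro ext arg_cong2[where f="(/)"] sum.cong refl) simp
      then show ?thesis by (simp add: w_def)
    qed
    note X = deviation_prob_trained_predictor[OF prob_law _ split_finite(4)[OF T] w[OF u] _ dep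
        admissible_split[OF T c avg mom]]
    show "A u \<in> sets D" "measure D (A u) \<le> failure_bound (est E) (mom_batches E n) m c"
      using X unfolding A_def split_finite(3)[OF T] by (auto simp: w_def loss_of_nonneg)
  qed
  have ev: "{\<omega>\<in>space \<Omega>. draw \<xi> \<omega> = u} \<in> events" for u
    by (rule draw_events[OF \<xi>, where Q="\<lambda>v. v = u"])
  have ind: "prob ({\<omega>\<in>space \<Omega>. draw \<xi> \<omega> = u} \<inter> (data E n -` S \<inter> space \<Omega>))
      = prob {\<omega>\<in>space \<Omega>. draw \<xi> \<omega> = u} * prob (data E n -` S \<inter> space \<Omega>)"
    if "S \<in> sets D" for u S
    by (rule draw_indep[OF \<xi> that, where Q="\<lambda>v. v = u"])
  define F where "F = {\<omega>\<in>space \<Omega>. data E n \<omega> \<in> A (draw \<xi> \<omega>)}"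
  have F: "F \<in> events"
    "prob F = (\<Sum>u\<in>draws \<xi>. prob {\<omega>\<in>space \<Omega>. draw \<xi> \<omega> = u} * measure D (A u))"
    using mixture_prob[OF data_measurable finite_draws draw_mem[OF \<xi>] ev ind A(1)]
    unfolding F_def distr_data by auto
  have "prob F \<le> (\<Sum>u\<in>draws \<xi>. prob {\<omega>\<in>space \<Omega>. draw \<xi> \<omega> = u} * failure_bound (est E) (mom_batches E n) m c)"
    unfolding F(2) by (intro sum_mono mult_left_mono A(2)) auto
  also have "\<dots> = failure_bound (est E) (mom_batches E n) m c"
    using sum_prob_values[OF finite_draws draw_mem[OF \<xi>] ev] by (simp flip: sum_distrib_right)
  finally have pF: "prob F \<le> failure_bound (est E) (mom_batches E n) m c" .
  have "risk_estimated E n \<xi> \<omega> (c * enn2real (sigma_hat E n \<xi> \<omega>))"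
    if \<omega>: "\<omega> \<in> space \<Omega> - F" and fin: "sigma_hat E n \<xi> \<omega> \<noteq> \<infinity>" for \<omega>
  proof -
    have sp: "\<omega> \<in> space \<Omega>" using \<omega> by simp
    let ?f = "bagged_predictor E n \<xi> \<omega>"
    have wf: "w (draw \<xi> \<omega>) (data E n \<omega>) = loss_of ?f"
      by (simp add: w_def bagged_predictor_eq[OF \<xi> sp])
    have meas: "loss_of ?f \<in> borel_measurable P"
      using measurable_Pair2[OF w[OF draw_mem[OF \<xi> sp]] measurable_space[OF data_measurable sp]]
      by (simp add: wf)
    have int: "integrable P (loss_of ?f)"
      using integrable_of_rv_norm_finite[OF prob_law meas] fin by (simp add: sigma_hat_eq)
    have R: "Risk E n ?f = ennreal (\<integral>z. loss_of ?f z \<partial>P)"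
      unfolding Risk_eq by (rule nn_integral_eq_integral[OF int]) (simp add: loss_of_nonneg)
    have "0 \<le> (\<integral>z. loss_of ?f z \<partial>P)" by (simp add: loss_of_nonneg)
    then have R': "enn2real (Risk E n ?f) = (\<integral>z. loss_of ?f z \<partial>P)" using R by simp
    have test: "data E n \<omega> i = obs E n i \<omega>" if "i \<in> test_set E n \<omega>" for i
      using that split_finite(4)[OF test_set_mem[OF sp]] by (auto simp: data_def)
    have "\<not> deviates (est E) (mom_batches E n) (batch_group (test_set E n \<omega>)) (test_set E n \<omega>)
        (c * enn2real (sigma_hat E n \<xi> \<omega>)) (\<integral>z. loss_of ?f z \<partial>P) (\<lambda>i. loss_of ?f (data E n \<omega> i))"
    proof -
      have fst: "fst (draw \<xi> \<omega>) = test_set E n \<omega>" by (simp add: draw_def)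
      have "data E n \<omega> \<notin> A (draw \<xi> \<omega>)" using \<omega> by (auto simp: F_def)
      then show ?thesis
        using fin measurable_space[OF data_measurable sp] unfolding A_def fst sigma_hat_eq by (simp add: wf)
    qed
    then have "\<not> deviates (est E) (mom_batches E n) (batch_group (test_set E n \<omega>)) (test_set E n \<omega>)
        (c * enn2real (sigma_hat E n \<xi> \<omega>)) (\<integral>z. loss_of ?f z \<partial>P) (\<lambda>i. loss_of ?f (obs E n i \<omega>))"
      using deviates_cong[OF admissible_split[OF test_set_mem[OF sp] c avg mom],
          where v="\<lambda>i. loss_of ?f (data E n \<omega> i)" and v'="\<lambda>i. loss_of ?f (obs E n i \<omega>)"]
      by (simp add: test)
    then show ?thesis using est_risk_close[OF sp] R R' by simp
  qed
  then show ?thesis using F(1) pF by (intro bexI[of _ F]) auto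
qed

text \<open>
  The choice of \<open>\<eta>\<close> makes the number of batches logarithmic in \<open>n\<close>: the lower bound keeps the failure
  probability summable over the grid, the upper bound keeps the batches large. The assumption \<open>3 \<le> n\<close>
  ensures \<open>1 \<le> ln n\<close>, which absorbs the rounding.
\<close>
lemma mom_batches_bounds:
  assumes n: "3 \<le> n"
  shows "8 * ln (real n powr mom_A E * real (card (grid E n))) \<le> real (mom_batches E n)"
    and "real (mom_batches E n) \<le> (8 * mom_A E + 9) * ln (real n)"
    and "0 < mom_batches E n"
proof -
  let ?g = "real (card (grid E n))"
  define \<eta> where "\<eta> = real n powr (- mom_A E) / ?g"
  have g: "1 \<le> ?g" "?g \<le> real n" using card_grid_pos card_grid_le by auto
  have n1: "exp 1 \<le> real n" using n exp_le by linarith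
  then have ln1: "1 \<le> ln (real n)" using n by (subst ln_ge_iff) auto
  have inv: "1 / \<eta> = real n powr mom_A E * ?g"
    by (simp add: \<eta>_def powr_minus field_simps)
  have L: "ln (1 / \<eta>) = mom_A E * ln (real n) + ln ?g"
    unfolding inv using g n by (subst ln_mult) (auto simp: ln_powr)
  have lg: "0 \<le> ln ?g" "ln ?g \<le> ln (real n)" using g n by auto
  have A: "0 < mom_A E * ln (real n)" using mom_A_pos ln1 by simp
  have B: "mom_batches E n = nat \<lceil>8 * ln (1 / \<eta>)\<rceil>"
    by (simp add: mom_batches_def \<eta>_def Let_def)
  have pos: "0 < 8 * ln (1 / \<eta>)" using L A lg by linarith
  show "8 * ln (real n powr mom_A E * ?g) \<le> real (mom_batches E n)"
    unfolding B inv[symmetric] by (rule real_nat_ceiling_ge)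
  show "0 < mom_batches E n" unfolding B using pos by linarith
  have "real (mom_batches E n) \<le> 8 * ln (1 / \<eta>) + 1"
    unfolding B using pos by linarith
  also have "\<dots> \<le> 8 * (mom_A E * ln (real n) + ln (real n)) + ln (real n)"
    unfolding L using lg ln1 by (simp add: algebra_simps)
  finally show "real (mom_batches E n) \<le> (8 * mom_A E + 9) * ln (real n)"
    by (simp add: algebra_simps)
qed

lemma failure_bound_grid:
  assumes n: "3 \<le> n" and c: "c\<^sup>2 = 32 * (8 * mom_A E + 9) * (ln (real n) / real m)"
  shows "real (card (grid E n)) * failure_bound (est E) (mom_batches E n) m c
    \<le> 2 / real n + real n powr (- mom_A E)"
proof -
  let ?g = "real (card (grid E n))"
  have g: "1 \<le> ?g" "?g \<le> real n" using card_grid_pos card_grid_le by auto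
  show ?thesis
  proof (cases "est E")
    case AVG
    have m: "real m * c\<^sup>2 / 32 = (8 * mom_A E + 9) * ln (real n)"
      using test_size unfolding c by simp
    have "2 * ln (real n) \<le> (8 * mom_A E + 9) * ln (real n)"
      using mom_A_pos n by (intro mult_right_mono) auto
    then have "exp (- real m * c\<^sup>2 / 32) \<le> exp (- (2 * ln (real n)))"
      using m by simp
    also have "\<dots> = 1 / (real n)\<^sup>2"
      using n by (simp add: exp_minus field_simps exp_double)
    finally have "?g * (2 * exp (- real m * c\<^sup>2 / 32)) \<le> real n * (2 * (1 / (real n)\<^sup>2))"
      using g by (intro mult_mono) auto
    also have "\<dots> = 2 / real n" using n by (simp add: power2_eq_square)
    finally show ?thesis using AVG by (simp add: failure_bound_def add_increasing2)
  next
    case MOM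
    define \<zeta> where "\<zeta> = real n powr mom_A E * ?g"
    have z: "0 < \<zeta>" using g n by (simp add: \<zeta>_def)
    have "1 * 1 \<le> real n powr mom_A E * ?g"
      using g n mom_A_pos by (intro mult_mono ge_one_powr_ge_zero) auto
    then have lz: "0 \<le> ln \<zeta>" by (simp add: \<zeta>_def)
    have "8 * ln \<zeta> \<le> real (mom_batches E n)" using mom_batches_bounds(1)[OF n] by (simp add: \<zeta>_def)
    then have "exp (- real (mom_batches E n) / 4) \<le> exp (- ln \<zeta>)" using lz by simp
    also have "\<dots> = 1 / \<zeta>" using z by (simp add: exp_minus inverse_eq_divide)
    finally have "?g * exp (- real (mom_batches E n) / 4) \<le> ?g * (1 / \<zeta>)"
      using g by (intro mult_left_mono) auto
    also have "\<dots> = real n powr (- mom_A E)"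
      using g by (simp add: \<zeta>_def powr_minus field_simps)
    finally show ?thesis using MOM by (simp add: failure_bound_def add_increasing)
  qed
qed

text \<open>
  The constant in \<open>c\<close> serves both estimators. There are \<open>B \<le> (8 A + 9) ln n\<close> batches, and \<open>c \<le> 1\<close>
  gives \<open>B \<le> m\<close>, so each has at least \<open>m div B \<ge> m / (2 B)\<close> elements and \<open>c\<^sup>2 * (m div B) \<ge> 16\<close>; and for the average the exponent
  \<open>m * c\<^sup>2 / 32 = (8 A + 9) ln n\<close> exceeds \<open>2 ln n\<close>, which beats the number of grid points.
\<close>
lemma uniform_concentration:
  assumes n: "3 \<le> n" and c: "c = sqrt (32 * (8 * mom_A E + 9) * (ln (real n) / real m))" and c1: "c \<le> 1"
  shows "\<exists>A\<in>events. prob A \<le> 2 / real n + real n powr (- mom_A E) \<and>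
    (\<forall>\<omega>\<in>space \<Omega> - A. \<forall>\<xi>\<in>grid E n. sigma_hat E n \<xi> \<omega> \<noteq> \<infinity> \<longrightarrow>
      risk_estimated E n \<xi> \<omega> (c * enn2real (sigma_hat E n \<xi> \<omega>)))"
    (is "\<exists>A\<in>events. _ \<and> (\<forall>\<omega>\<in>space \<Omega> - A. \<forall>\<xi>\<in>grid E n. ?good \<xi> \<omega>)")
proof -
  let ?B = "mom_batches E n" and ?k = "8 * mom_A E + 9" and ?L = "ln (real n)"
  have k: "0 < ?k" using mom_A_pos by simp
  have L: "0 < ?L" and m: "0 < real m" using n test_size by auto
  have csq: "c\<^sup>2 = 32 * ?k * (?L / real m)" using c k L m by simp
  have cpos: "0 < c" unfolding c using k L m by simp
  have c2: "c\<^sup>2 \<le> 1" using c1 cpos by (simp add: power_le_one)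
  have mom: "0 < m div ?B \<and> 16 \<le> c\<^sup>2 * real (m div ?B)"
  proof -
    note B = mom_batches_bounds[OF n]
    have "32 * (?k * ?L) \<le> real m" using c2 m unfolding csq by (simp add: field_simps)
    moreover have "0 < ?k * ?L" using k L by simp
    ultimately have "real ?B \<le> real m" using B(2) by linarith
    then have "?B \<le> m" by simp
    then have h: "1 \<le> m div ?B" using B(3) by (simp add: Suc_le_eq div_greater_zero_iff One_nat_def)
    have "m = ?B * (m div ?B) + m mod ?B" by simp
    moreover have "m mod ?B < ?B" using B(3) by simp
    moreover have "?B * 1 \<le> ?B * (m div ?B)" using h by (intro mult_left_mono) auto
    ultimately have "m < 2 * (?B * (m div ?B))" by linarith
    then have "real m < 2 * (real ?B * real (m div ?B))"
      by (metis of_nat_less_iff of_nat_mult of_nat_numeral)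
    also have "real ?B * real (m div ?B) \<le> ?k * ?L * real (m div ?B)"
      using B(2) by (intro mult_right_mono) auto
    finally have y: "real m < 2 * (?k * ?L * real (m div ?B))" by simp
    have "c\<^sup>2 * real (m div ?B) = 32 * (?k * ?L * real (m div ?B)) / real m"
      unfolding csq by simp
    moreover have "16 \<le> 32 * (?k * ?L * real (m div ?B)) / real m"
      using y m unfolding pos_le_divide_eq[OF m] by linarith
    ultimately have "16 \<le> c\<^sup>2 * real (m div ?B)" by linarith
    then show ?thesis using h by linarith
  qed
  have "\<exists>A\<in>events. prob A \<le> failure_bound (est E) ?B m c \<and> (\<forall>\<omega>\<in>space \<Omega> - A. ?good \<xi> \<omega>)"
    if "\<xi> \<in> grid E n" for \<xi>
    using that c1 mom by (intro deviation_event cpos) auto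
  then obtain A where A: "\<And>\<xi>. \<xi> \<in> grid E n \<Longrightarrow> A \<xi> \<in> events"
    "\<And>\<xi>. \<xi> \<in> grid E n \<Longrightarrow> prob (A \<xi>) \<le> failure_bound (est E) ?B m c"
    "\<And>\<xi>. \<xi> \<in> grid E n \<Longrightarrow> \<forall>\<omega>\<in>space \<Omega> - A \<xi>. ?good \<xi> \<omega>"
    by metis
  have "prob (\<Union>\<xi>\<in>grid E n. A \<xi>) \<le> (\<Sum>\<xi>\<in>grid E n. prob (A \<xi>))"
    using A(1) finite_grid by (intro measure_UNION_le) auto
  also have "\<dots> \<le> (\<Sum>\<xi>\<in>grid E n. failure_bound (est E) ?B m c)"
    by (intro sum_mono A(2))
  also have "\<dots> \<le> 2 / real n + real n powr (- mom_A E)"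
    using failure_bound_grid[OF n csq] by simp
  finally have "prob (\<Union>\<xi>\<in>grid E n. A \<xi>) \<le> 2 / real n + real n powr (- mom_A E)" .
  moreover have "(\<Union>\<xi>\<in>grid E n. A \<xi>) \<in> events"
    using A(1) finite_grid by (intro sets.finite_UN) auto
  ultimately show ?thesis using A(3) by (intro bexI[of _ "\<Union>\<xi>\<in>grid E n. A \<xi>"]) auto
qed

end

section \<open>Selection of a near minimizer\<close>

lemma rel_dev_le_iff:
  assumes r: "0 < r"
  shows "rel_dev R r \<le> ereal \<delta> \<longleftrightarrow> R \<noteq> \<infinity> \<and> \<bar>enn2real R - r\<bar> \<le> \<delta> * r"
proof (cases R)
  case (real \<rho>)
  then have "rel_dev R r = ereal (\<bar>\<rho> - r\<bar> / r)" using r by (simp add: rel_dev_def)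
  then show ?thesis using real r by (simp add: field_simps)
next
  case top
  then show ?thesis using r by (simp add: rel_dev_def)
qed

lemma rel_excess_le:
  assumes "0 < r" "R \<noteq> \<infinity>" "enn2real R \<le> (1 + \<epsilon>) * r" "0 \<le> \<epsilon>"
  shows "\<bar>rel_excess R r\<bar> \<le> ereal \<epsilon>"
proof (cases R)
  case (real \<rho>)
  then have "rel_excess R r = ereal (max (\<rho> - r) 0 / r)"
    using assms(1) by (simp add: rel_excess_def zero_ereal_def del: ereal_max flip: ereal_max)
  moreover have "max (\<rho> - r) 0 / r \<le> \<epsilon>"
    using assms real by (simp add: field_simps)
  moreover have "0 \<le> max (\<rho> - r) 0 / r" using assms(1) by simp
  ultimately show ?thesis by simp
qed (use assms in auto)

lemma abs_rel_dev [simp]: "0 < r \<Longrightarrow> \<bar>rel_dev R r\<bar> = rel_dev R r"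
  by (cases R) (simp_all add: rel_dev_def)

lemma rel_dev_sets: "{R. ereal \<delta> < rel_dev R r} \<in> sets borel"
proof -
  have "(\<lambda>R. rel_dev R r) \<in> borel_measurable borel" unfolding rel_dev_def by measurable
  then show ?thesis using borel_measurable_less[of "\<lambda>_. ereal \<delta>" borel "\<lambda>R. rel_dev R r"] by simp
qed

text \<open>
  Compare \<open>R a\<close> with \<open>Rhat a \<le> Rhat b\<close> and then with \<open>R b\<close>. Since the error at \<open>a\<close> is itself
  proportional to the unknown \<open>R a\<close>, it is moved to the left, which gives
  \<open>(1 - \<delta>) R a \<le> ((1 + \<delta>)\<^sup>2 + 2 \<delta>) r\<close>; the value of \<open>\<delta>\<close> is chosen so that
  \<open>\<delta> (6 + \<epsilon>) = \<epsilon>\<close> makes the right-hand side at most \<open>(1 - \<delta>) (1 + \<epsilon>) r\<close>.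
\<close>
lemma select_near_minimizer:
  fixes R Rhat :: "'a \<Rightarrow> real"
  assumes close: "\<And>x. x \<in> G \<Longrightarrow> \<bar>Rhat x - R x\<bar> \<le> \<delta> * (R x + r)"
    and a: "a \<in> G" and b: "b \<in> G" and less: "Rhat a \<le> Rhat b"
    and bound: "R b \<le> (1 + \<delta>) * r"
    and \<epsilon>: "0 < \<epsilon>" and \<delta>: "\<delta> = \<epsilon> / (6 + \<epsilon>)" and r: "0 < r"
  shows "R a \<le> (1 + \<epsilon>) * r"
proof -
  have d: "0 < \<delta>" "\<delta> < 1" and de: "\<delta> * (6 + \<epsilon>) = \<epsilon>" using \<epsilon> by (auto simp: \<delta>)
  have "R a - \<delta> * (R a + r) \<le> Rhat a" "Rhat b \<le> R b + \<delta> * (R b + r)"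
    using close[OF a] close[OF b] by linarith+
  then have "(1 - \<delta>) * R a \<le> (1 + \<delta>) * R b + 2 * \<delta> * r"
    using less by (simp add: algebra_simps)
  also have "\<dots> \<le> (1 + \<delta>) * ((1 + \<delta>) * r) + 2 * \<delta> * r"
    using bound d by (intro add_right_mono mult_left_mono) auto
  also have "\<dots> = ((1 + \<delta>) * (1 + \<delta>) + 2 * \<delta>) * r" by (simp add: algebra_simps)
  also have "\<dots> \<le> ((1 - \<delta>) * (1 + \<epsilon>)) * r"
  proof (intro mult_right_mono)
    have "\<delta> * \<delta> \<le> \<delta> * 1" using d by (intro mult_left_mono) auto
    then show "(1 + \<delta>) * (1 + \<delta>) + 2 * \<delta> \<le> (1 - \<delta>) * (1 + \<epsilon>)"
      using de by (simp add: algebra_simps)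
  qed (use r in simp)
  finally have "(1 - \<delta>) * R a \<le> (1 - \<delta>) * ((1 + \<epsilon>) * r)" by (simp add: mult.assoc)
  then show ?thesis using d by simp
qed

context zs_experiment_at
begin

lemma Rdet_min_attained:
  obtains \<xi> where "\<xi> \<in> grid E n" "Rdet (sub_size E n \<xi>) = Rdet_min E Rdet n"
proof -
  have "Rdet_min E Rdet n \<in> (\<lambda>\<xi>. Rdet (sub_size E n \<xi>)) ` grid E n"
    unfolding Rdet_min_def using finite_grid grid_nonempty by (intro Min_in) auto
  then show ?thesis using that by auto
qed

lemma Rdet_min_le: "\<xi> \<in> grid E n \<Longrightarrow> Rdet_min E Rdet n \<le> Rdet (sub_size E n \<xi>)"
  unfolding Rdet_min_def using finite_grid by (intro Min_le) auto

lemma xihat_mem: "\<omega> \<in> space \<Omega> \<Longrightarrow> xihat E n \<omega> \<in> grid E n"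
  and xihat_le: "\<omega> \<in> space \<Omega> \<Longrightarrow> \<xi> \<in> grid E n \<Longrightarrow>
    est_risk E n \<omega> (bagged_predictor E n (xihat E n \<omega>) \<omega>) \<le> est_risk E n \<omega> (bagged_predictor E n \<xi> \<omega>)"
  using xihat_arg_min by (auto simp: is_arg_min_def not_less)

lemma rel_dev_event:
  assumes "\<xi> \<in> grid E n" "j \<in> {1..bags E}"
  shows "{\<omega>\<in>space \<Omega>. ereal \<delta> < rel_dev (Risk E n (base_predictor E n \<xi> j \<omega>)) r} \<in> events"
    and "prob {\<omega>\<in>space \<Omega>. ereal \<delta> < rel_dev (Risk E n (base_predictor E n \<xi> j \<omega>)) r}
       = prob {\<omega>\<in>space \<Omega>. ereal \<delta> < rel_dev (Risk E n (base_predictor E n \<xi> 1 \<omega>)) r}"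
  using prob_base_predictor[OF assms rel_dev_sets[of \<delta> r]] by simp_all

lemma bagged_predictor_single:
  "bags E = 1 \<Longrightarrow> bagged_predictor E n \<xi> \<omega> = base_predictor E n \<xi> 1 \<omega>"
  by (simp add: bagged_predictor_def)

lemma base_loss_measurable:
  assumes "\<xi> \<in> grid E n" "j \<in> {1..bags E}" "\<omega> \<in> space \<Omega>"
  shows "loss_of (base_predictor E n \<xi> j \<omega>) \<in> borel_measurable P"
proof -
  let ?S = "subsample E n \<xi> j \<omega>"
  have "?S \<in> train_subsets E n \<xi> (test_set E n \<omega>)" by (rule subsample_mem[OF assms(3,1,2)])
  then have "?S \<subseteq> {1..n}" "?S \<noteq> {}"
    using sub_size_pos[OF assms(1)] by (auto simp: train_subsets_def)
  note loss_of_measurable[OF fit_measurable[OF this]]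
  from measurable_Pair2[OF this measurable_space[OF data_measurable assms(3)]]
  show ?thesis by (simp add: base_predictor_eq[OF assms(1,3,2)])
qed

text \<open>
  Jensen's inequality for the average over the bags, integrated over the fresh observation.
\<close>
lemma Risk_bagged_le:
  assumes conv: "\<And>y. convex_on UNIV (lossfun E y)"
    and \<xi>: "\<xi> \<in> grid E n" and \<omega>: "\<omega> \<in> space \<Omega>"
    and b: "\<And>j. j \<in> {1..bags E} \<Longrightarrow> Risk E n (base_predictor E n \<xi> j \<omega>) \<le> ennreal b" and b0: "0 \<le> b"
  shows "Risk E n (bagged_predictor E n \<xi> \<omega>) \<le> ennreal b"
proof -
  let ?M = "bags E" and ?g = "\<lambda>j. base_predictor E n \<xi> j \<omega>"
  have M: "0 < real ?M" using bags_pos by simp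
  have pt: "ennreal (loss_of (bagged_predictor E n \<xi> \<omega>) z)
      \<le> (\<Sum>j = 1..?M. ennreal (1 / real ?M) * ennreal (loss_of (?g j) z))" for z
  proof -
    have "loss_of (bagged_predictor E n \<xi> \<omega>) z
        = lossfun E (snd z) (\<Sum>j = 1..?M. (1 / real ?M) *\<^sub>R ?g j (fst z))"
      by (simp add: loss_of_def bagged_predictor_def sum_divide_distrib)
    also have "\<dots> \<le> (\<Sum>j = 1..?M. (1 / real ?M) * lossfun E (snd z) (?g j (fst z)))"
      by (rule convex_on_sum[OF _ _ conv]) (use bags_pos in auto)
    also have "\<dots> = (\<Sum>j = 1..?M. 1 / real ?M * loss_of (?g j) z)" by (simp add: loss_of_def)
    finally have "ennreal (loss_of (bagged_predictor E n \<xi> \<omega>) z)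
        \<le> ennreal (\<Sum>j = 1..?M. 1 / real ?M * loss_of (?g j) z)" by (rule ennreal_leI)
    also have "\<dots> = (\<Sum>j = 1..?M. ennreal (1 / real ?M * loss_of (?g j) z))"
      by (rule sum_ennreal[symmetric]) (simp add: loss_of_nonneg)
    also have "\<dots> = (\<Sum>j = 1..?M. ennreal (1 / real ?M) * ennreal (loss_of (?g j) z))"
      by (intro sum.cong refl ennreal_mult) (auto simp: loss_of_nonneg)
    finally show ?thesis .
  qed
  have [measurable]: "loss_of (?g j) \<in> borel_measurable P" if "j \<in> {1..?M}" for j
    by (rule base_loss_measurable[OF \<xi> that \<omega>])
  have "Risk E n (bagged_predictor E n \<xi> \<omega>)
      \<le> (\<integral>\<^sup>+ z. (\<Sum>j = 1..?M. ennreal (1 / real ?M) * ennreal (loss_of (?g j) z)) \<partial>P)"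
    unfolding Risk_eq by (intro nn_integral_mono pt)
  also have "\<dots> = (\<Sum>j = 1..?M. ennreal (1 / real ?M) * Risk E n (?g j))"
    unfolding Risk_eq by (subst nn_integral_sum) (auto intro!: sum.cong nn_integral_cmult)
  also have "\<dots> \<le> (\<Sum>j = 1..?M. ennreal (1 / real ?M) * ennreal b)"
    by (intro sum_mono mult_left_mono b) auto
  also have "\<dots> = ennreal (\<Sum>j = 1..?M. 1 / real ?M * b)"
    using b0 by (subst sum_ennreal[symmetric]) (auto simp flip: ennreal_mult)
  also have "(\<Sum>j = 1..?M. 1 / real ?M * b) = b" using M by simp
  finally show ?thesis .
qed

lemma zs_risk_le:
  assumes \<omega>: "\<omega> \<in> space \<Omega>" and r: "0 < Rdet_min E Rdet n"
    and \<epsilon>: "0 < \<epsilon>" and \<delta>: "\<delta> = \<epsilon> / (6 + \<epsilon>)"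
    and close: "\<forall>\<xi>\<in>grid E n. risk_estimated E n \<xi> \<omega> (\<delta> * (bagged_risk E n \<xi> \<omega> + Rdet_min E Rdet n))"
    and \<xi>: "\<xi> \<in> grid E n"
    and bound: "Risk E n (bagged_predictor E n \<xi> \<omega>) \<le> ennreal ((1 + \<delta>) * Rdet_min E Rdet n)"
  shows "Risk E n (zs_predictor E n \<omega>) \<noteq> \<infinity>"
    and "enn2real (Risk E n (zs_predictor E n \<omega>)) \<le> (1 + \<epsilon>) * Rdet_min E Rdet n"
proof -
  show "Risk E n (zs_predictor E n \<omega>) \<noteq> \<infinity>"
    using close xihat_mem[OF \<omega>] by (simp add: zs_predictor_def)
  have d: "0 < \<delta>" using \<epsilon> by (simp add: \<delta>)
  have "bagged_risk E n \<xi> \<omega> \<le> (1 + \<delta>) * Rdet_min E Rdet n"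
    using bound d r by (intro enn2real_leI) auto
  then show "enn2real (Risk E n (zs_predictor E n \<omega>)) \<le> (1 + \<epsilon>) * Rdet_min E Rdet n"
    unfolding zs_predictor_def
    by (intro select_near_minimizer[where G="grid E n" and b=\<xi> and a="xihat E n \<omega>" and \<delta>=\<delta>
          and R="\<lambda>\<xi>. bagged_risk E n \<xi> \<omega>"
          and Rhat="\<lambda>\<xi>. est_risk E n \<omega> (bagged_predictor E n \<xi> \<omega>)"])
      (use close xihat_mem[OF \<omega>] xihat_le[OF \<omega> \<xi>] \<xi> \<epsilon> \<delta> r in auto)
qed

end

lemma eventually_zs_experiment_at:
  assumes "zero_step_setting E"
  shows "\<forall>\<^sub>F n in sequentially. zs_experiment_at E n"
proof -
  have "\<forall>\<^sub>F n in sequentially. zs_experiment E n"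
    using assms by (simp add: zero_step_setting_def)
  then show ?thesis
    by (rule eventually_mono) (use assms in \<open>auto simp: zero_step_setting_def zs_experiment_at_def\<close>)
qed

definition rate :: "'w zero_step \<Rightarrow> nat \<Rightarrow> real" where
  "rate E n = sqrt (32 * (8 * mom_A E + 9) * (ln (real n) / real (n_test E n)))"

lemma rate_tendsto_0:
  assumes "zero_step_setting E"
  shows "rate E \<longlonglongrightarrow> 0"
proof -
  have "(\<lambda>n. ln (real n) / real (n_test E n)) \<longlonglongrightarrow> 0"
    using assms by (simp add: zero_step_setting_def)
  from tendsto_real_sqrt[OF tendsto_mult_right_zero[OF this, of "32 * (8 * mom_A E + 9)"]]
  show ?thesis by (simp add: rate_def[abs_def])
qed

lemma eventually_uniform_concentration:
  assumes S: "zero_step_setting E" and \<epsilon>: "0 < \<epsilon>"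
  shows "\<forall>\<^sub>F n in sequentially. zs_experiment_at E n \<and>
    (\<exists>A\<in>sets (prob_of E n). measure (prob_of E n) A \<le> \<epsilon> \<and>
    (\<forall>\<omega>\<in>space (prob_of E n) - A. \<forall>\<xi>\<in>grid E n. sigma_hat E n \<xi> \<omega> \<noteq> \<infinity> \<longrightarrow>
      risk_estimated E n \<xi> \<omega> (rate E n * enn2real (sigma_hat E n \<xi> \<omega>))))"
proof -
  have A: "0 < mom_A E" using S by (simp add: zero_step_setting_def)
  have "(\<lambda>n. 2 / real n + real n powr (- mom_A E)) \<longlonglongrightarrow> 0 + 0"
    by (intro tendsto_add lim_const_over_n tendsto_neg_powr filterlim_real_sequentially) (use A in simp)
  then have small: "\<forall>\<^sub>F n in sequentially. 2 / real n + real n powr (- mom_A E) < \<epsilon>"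
    using \<epsilon> by (intro order_tendstoD(2)) simp_all
  have rate: "\<forall>\<^sub>F n in sequentially. rate E n < 1"
    by (rule order_tendstoD(2)[OF rate_tendsto_0[OF S]]) simp
  show ?thesis
    using eventually_zs_experiment_at[OF S] small rate eventually_ge_at_top[of 3]
  proof eventually_elim
    case (elim n)
    interpret zs_experiment_at E n by (rule elim(1))
    show ?case
      using uniform_concentration[OF elim(4) rate_def] elim zs_experiment_at_axioms
      by (meson less_imp_le order_trans)
  qed
qed

text \<open>
  What (O1) and (O2) have in common: the concentration error at every grid point is at most
  \<open>\<delta> (R + r)\<close>. An infinite risk is excluded separately, by the finiteness of the norm.
\<close>
abbreviation errors_dominated ::
    "'w zero_step \<Rightarrow> (nat \<Rightarrow> real) \<Rightarrow> nat \<Rightarrow> real \<Rightarrow> 'w \<Rightarrow> bool" where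
  "errors_dominated E Rdet n \<delta> \<omega> \<equiv> (\<forall>\<xi>\<in>grid E n. sigma_hat E n \<xi> \<omega> \<noteq> \<infinity> \<and>
     (Risk E n (bagged_predictor E n \<xi> \<omega>) \<noteq> \<infinity> \<longrightarrow> rate E n * enn2real (sigma_hat E n \<xi> \<omega>)
       \<le> \<delta> * (bagged_risk E n \<xi> \<omega> + Rdet_min E Rdet n)))"

lemma eventually_Rdet_min_pos:
  assumes S: "zero_step_setting E"
    and pos: "\<forall>\<^sub>F n in sequentially. \<forall>\<xi>\<in>grid E n. 0 < Rdet (sub_size E n \<xi>)"
  shows "\<forall>\<^sub>F n in sequentially. zs_experiment_at E n \<and> 0 < Rdet_min E Rdet n"
  using eventually_zs_experiment_at[OF S] pos
proof eventually_elim
  case (elim n)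
  interpret zs_experiment_at E n by (rule elim(1))
  obtain \<xi> where "\<xi> \<in> grid E n" "Rdet (sub_size E n \<xi>) = Rdet_min E Rdet n"
    by (rule Rdet_min_attained)
  then show ?case using elim zs_experiment_at_axioms by metis
qed

text \<open>
  \<open>sigma_hat \<le> K\<close> and \<open>rate E n * K \<le> \<delta> r\<close>, because \<open>r / rate E n\<close> tends to infinity. The number \<open>K\<close>
  provided by \<open>Op1\<close> may be negative, hence \<open>max K 0\<close>.
\<close>
lemma errors_dominated_O1:
  assumes S: "zero_step_setting E"
    and pos: "\<forall>\<^sub>F n in sequentially. \<forall>\<xi>\<in>grid E n. 0 < Rdet (sub_size E n \<xi>)"
    and O1: "O1 E Rdet" and \<epsilon>: "0 < \<epsilon>" and \<delta>: "0 < \<delta>"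
  shows "\<exists>X. \<forall>\<^sub>F n in sequentially. X n \<in> sets (prob_of E n) \<and> measure (prob_of E n) (X n) \<le> \<epsilon> \<and>
    (\<forall>\<omega>\<in>space (prob_of E n) - X n. errors_dominated E Rdet n \<delta> \<omega>)"
proof -
  note minpos = eventually_Rdet_min_pos[OF S pos]
  have Apos: "0 < mom_A E" using S by (simp add: zero_step_setting_def)
  obtain K where K: "\<forall>\<^sub>F n in sequentially.
      measure (prob_of E n) {\<omega>\<in>space (prob_of E n). ennreal K < sigma_max E n \<omega>} \<le> \<epsilon>"
    using O1 \<epsilon> unfolding O1_def Op1_def by blast
  define X where "X n = {\<omega>\<in>space (prob_of E n). ennreal K < sigma_max E n \<omega>}" for n
  define C where "C = sqrt (32 * (8 * mom_A E + 9))"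
  have "\<forall>\<^sub>F n in sequentially.
      max K 0 * C / \<delta> \<le> Rdet_min E Rdet n * sqrt (real (n_test E n) / ln (real n))"
    using O1 unfolding O1_def filterlim_at_top by blast
  then have "\<forall>\<^sub>F n in sequentially. X n \<in> sets (prob_of E n) \<and> measure (prob_of E n) (X n) \<le> \<epsilon> \<and>
    (\<forall>\<omega>\<in>space (prob_of E n) - X n. errors_dominated E Rdet n \<delta> \<omega>)"
    using K minpos eventually_ge_at_top[of 3]
  proof eventually_elim
    case (elim n)
    interpret zs_experiment_at E n using elim(3) by blast
    have pos': "0 < real (n_test E n)" "0 < ln (real n)" using elim(4) test_size by auto
    have rt: "rate E n = C * sqrt (ln (real n) / real (n_test E n))"
      unfolding rate_def C_def by (rule real_sqrt_mult)
    have inv: "sqrt (ln (real n) / real (n_test E n)) * sqrt (real (n_test E n) / ln (real n)) = 1"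
      unfolding real_sqrt_mult[symmetric] using pos' by simp
    have "max K 0 * C / \<delta> * sqrt (ln (real n) / real (n_test E n))
        \<le> Rdet_min E Rdet n * sqrt (real (n_test E n) / ln (real n)) * sqrt (ln (real n) / real (n_test E n))"
      using elim(1) pos' by (intro mult_right_mono) auto
    also have "\<dots> = Rdet_min E Rdet n" using inv by (metis mult.assoc mult.commute mult.right_neutral)
    finally have "max K 0 * rate E n / \<delta> \<le> Rdet_min E Rdet n" by (simp add: rt mult_ac)
    then have key: "rate E n * max K 0 \<le> \<delta> * Rdet_min E Rdet n"
      using \<delta> by (simp add: field_simps)
    have r0: "0 \<le> rate E n" using pos' Apos by (simp add: rate_def)
    have "sigma_hat E n \<xi> \<omega> \<noteq> \<infinity> \<and> rate E n * enn2real (sigma_hat E n \<xi> \<omega>)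
        \<le> \<delta> * (bagged_risk E n \<xi> \<omega> + Rdet_min E Rdet n)"
      if "\<omega> \<in> space (prob_of E n) - X n" "\<xi> \<in> grid E n" for \<omega> \<xi>
    proof -
      have s: "sigma_hat E n \<xi> \<omega> \<le> ennreal K"
        using that max_exceeds(1)[of K] by (auto simp: X_def not_less)
      have "enn2real (sigma_hat E n \<xi> \<omega>) \<le> max K 0"
        using s by (intro enn2real_leI) (auto simp: max_def ennreal_neg split: if_splits)
      then have "rate E n * enn2real (sigma_hat E n \<xi> \<omega>) \<le> \<delta> * Rdet_min E Rdet n"
        using key mult_left_mono[OF _ r0] by (meson order_trans)
      also have "\<dots> \<le> \<delta> * (bagged_risk E n \<xi> \<omega> + Rdet_min E Rdet n)"
        using \<delta> by (intro mult_left_mono) auto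
      finally show ?thesis using s by (auto simp: top_unique)
    qed
    then show ?case using elim(2) max_exceeds_events(1)[of K] unfolding X_def by auto
  qed
  then show ?thesis by blast
qed

text \<open>
  \<open>sigma_hat \<le> K R\<close> and \<open>rate E n * K \<le> \<delta>\<close>, because the rate tends to zero.
\<close>
lemma errors_dominated_O2:
  assumes S: "zero_step_setting E"
    and pos: "\<forall>\<^sub>F n in sequentially. \<forall>\<xi>\<in>grid E n. 0 < Rdet (sub_size E n \<xi>)"
    and O2: "O2 E" and \<epsilon>: "0 < \<epsilon>" and \<delta>: "0 < \<delta>"
  shows "\<exists>X. \<forall>\<^sub>F n in sequentially. X n \<in> sets (prob_of E n) \<and> measure (prob_of E n) (X n) \<le> \<epsilon> \<and>
    (\<forall>\<omega>\<in>space (prob_of E n) - X n. errors_dominated E Rdet n \<delta> \<omega>)"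
proof -
  note minpos = eventually_Rdet_min_pos[OF S pos]
  have Apos: "0 < mom_A E" using S by (simp add: zero_step_setting_def)
  obtain K where K: "\<forall>\<^sub>F n in sequentially.
      measure (prob_of E n) {\<omega>\<in>space (prob_of E n). ennreal K < kappa_max E n \<omega>} \<le> \<epsilon>"
    using O2 \<epsilon> unfolding O2_def Op1_def by blast
  define X where "X n = {\<omega>\<in>space (prob_of E n). ennreal K < kappa_max E n \<omega>}" for n
  have "(\<lambda>n. rate E n * max K 0) \<longlonglongrightarrow> 0"
    by (intro tendsto_mult_left_zero rate_tendsto_0[OF S])
  then have "\<forall>\<^sub>F n in sequentially. rate E n * max K 0 < \<delta>"
    using \<delta> by (rule order_tendstoD(2))
  then have "\<forall>\<^sub>F n in sequentially. X n \<in> sets (prob_of E n) \<and> measure (prob_of E n) (X n) \<le> \<epsilon> \<and>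
    (\<forall>\<omega>\<in>space (prob_of E n) - X n. errors_dominated E Rdet n \<delta> \<omega>)"
    using K minpos eventually_ge_at_top[of 3]
  proof eventually_elim
    case (elim n)
    interpret zs_experiment_at E n using elim(3) by blast
    have r0: "0 \<le> rate E n" using elim(4) Apos by (simp add: rate_def)
    have "sigma_hat E n \<xi> \<omega> \<noteq> \<infinity> \<and> (Risk E n (bagged_predictor E n \<xi> \<omega>) \<noteq> \<infinity> \<longrightarrow>
        rate E n * enn2real (sigma_hat E n \<xi> \<omega>)
        \<le> \<delta> * (bagged_risk E n \<xi> \<omega> + Rdet_min E Rdet n))"
      if "\<omega> \<in> space (prob_of E n) - X n" "\<xi> \<in> grid E n" for \<omega> \<xi>
    proof -
      let ?R = "Risk E n (bagged_predictor E n \<xi> \<omega>)"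
      have k: "kappa_hat E n \<xi> \<omega> \<le> ennreal K"
        using that max_exceeds(2)[of K] by (auto simp: X_def not_less)
      then have s: "sigma_hat E n \<xi> \<omega> \<noteq> \<infinity>" by (auto simp: kappa_hat_def top_unique split: if_splits)
      then have div: "sigma_hat E n \<xi> \<omega> / ?R \<le> ennreal (max K 0)"
        using k by (auto simp: kappa_hat_def max_def ennreal_neg split: if_splits)
      have "rate E n * enn2real (sigma_hat E n \<xi> \<omega>) \<le> \<delta> * (enn2real ?R + Rdet_min E Rdet n)"
        if fin: "?R \<noteq> \<infinity>"
      proof -
        have "enn2real (sigma_hat E n \<xi> \<omega>) \<le> max K 0 * enn2real ?R"
        proof (cases "?R = 0")
          case True
          then have "sigma_hat E n \<xi> \<omega> = 0"
            using div s by (auto simp: ennreal_divide_zero top_unique ennreal_divide_eq_top_iff split: if_splits)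
          then show ?thesis by simp
        next
          case False
          then have "sigma_hat E n \<xi> \<omega> = sigma_hat E n \<xi> \<omega> / ?R * ?R"
            using fin by (simp add: ennreal_divide_times ennreal_divide_self less_top)
          also have "\<dots> \<le> ennreal (max K 0) * ?R" using div by (intro mult_right_mono) auto
          also have "\<dots> = ennreal (max K 0 * enn2real ?R)"
            using fin by (simp add: ennreal_mult less_top)
          finally show ?thesis by (intro enn2real_leI) auto
        qed
        then have "rate E n * enn2real (sigma_hat E n \<xi> \<omega>) \<le> rate E n * (max K 0 * enn2real ?R)"
          using r0 by (intro mult_left_mono) auto
        also have "\<dots> = (rate E n * max K 0) * enn2real ?R" by simp
        also have "\<dots> \<le> \<delta> * enn2real ?R" using elim(1) by (intro mult_right_mono) auto
        also have "\<dots> \<le> \<delta> * (enn2real ?R + Rdet_min E Rdet n)"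
          using \<delta> elim(3) by (intro mult_left_mono) auto
        finally show ?thesis .
      qed
      then show ?thesis using s by blast
    qed
    then show ?case using elim(2) max_exceeds_events(2)[of K] unfolding X_def by auto
  qed
  then show ?thesis by blast
qed

text \<open>
  Off a small event the norms are finite, so the concentration bound holds at every grid point, and
  its right-hand side is dominated by \<open>\<delta> (R + r)\<close>.
\<close>
lemma eventually_est_close:
  assumes S: "zero_step_setting E"
    and pos: "\<forall>\<^sub>F n in sequentially. \<forall>\<xi>\<in>grid E n. 0 < Rdet (sub_size E n \<xi>)"
    and O: "O1 E Rdet \<or> O2 E" and \<epsilon>: "0 < \<epsilon>" and \<delta>: "0 < \<delta>"
  shows "\<forall>\<^sub>F n in sequentially. zs_experiment_at E n \<and> 0 < Rdet_min E Rdet n \<and>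
    (\<exists>A\<in>sets (prob_of E n). measure (prob_of E n) A \<le> \<epsilon> \<and>
    (\<forall>\<omega>\<in>space (prob_of E n) - A. \<forall>\<xi>\<in>grid E n.
      risk_estimated E n \<xi> \<omega> (\<delta> * (bagged_risk E n \<xi> \<omega> + Rdet_min E Rdet n))))"
proof -
  have e2: "0 < \<epsilon> / 2" using \<epsilon> by simp
  note minpos = eventually_Rdet_min_pos[OF S pos]
  obtain X where X: "\<forall>\<^sub>F n in sequentially. X n \<in> sets (prob_of E n) \<and> measure (prob_of E n) (X n) \<le> \<epsilon> / 2 \<and>
      (\<forall>\<omega>\<in>space (prob_of E n) - X n. errors_dominated E Rdet n \<delta> \<omega>)"
    using errors_dominated_O1[OF S pos _ e2 \<delta>] errors_dominated_O2[OF S pos _ e2 \<delta>] O by blast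
  show ?thesis
    using X minpos eventually_uniform_concentration[OF S e2]
  proof eventually_elim
    case (elim n)
    interpret zs_experiment_at E n using elim(2) by blast
    obtain A where A: "A \<in> events" "prob A \<le> \<epsilon> / 2"
      "\<And>\<omega> \<xi>. \<omega> \<in> space (prob_of E n) - A \<Longrightarrow> \<xi> \<in> grid E n \<Longrightarrow> sigma_hat E n \<xi> \<omega> \<noteq> \<infinity> \<Longrightarrow>
      risk_estimated E n \<xi> \<omega> (rate E n * enn2real (sigma_hat E n \<xi> \<omega>))"
      using elim(3) by blast
    have "prob (A \<union> X n) \<le> prob A + prob (X n)" using A elim(1) by (intro measure_Un_le) auto
    then have "prob (A \<union> X n) \<le> \<epsilon>" using A(2) elim(1) by linarith
    moreover have "risk_estimated E n \<xi> \<omega> (\<delta> * (bagged_risk E n \<xi> \<omega> + Rdet_min E Rdet n))"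
      if "\<omega> \<in> space (prob_of E n) - (A \<union> X n)" "\<xi> \<in> grid E n" for \<omega> \<xi>
    proof -
      have s: "sigma_hat E n \<xi> \<omega> \<noteq> \<infinity>" using elim(1) that by auto
      have a: "Risk E n (bagged_predictor E n \<xi> \<omega>) \<noteq> \<infinity>"
        "\<bar>est_risk E n \<omega> (bagged_predictor E n \<xi> \<omega>) - bagged_risk E n \<xi> \<omega>\<bar>
        \<le> rate E n * enn2real (sigma_hat E n \<xi> \<omega>)"
        using A(3)[OF _ that(2) s] that(1) by auto
      have "rate E n * enn2real (sigma_hat E n \<xi> \<omega>)
          \<le> \<delta> * (bagged_risk E n \<xi> \<omega> + Rdet_min E Rdet n)"
        using elim(1) that a(1) by auto
      then show ?thesis using a by linarith
    qed
    ultimately show ?case using elim A(1) by (intro conjI bexI[of _ "A \<union> X n"]) auto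
  qed
qed

lemma op1I:
  assumes "\<And>\<epsilon> \<eta>. 0 < \<epsilon> \<Longrightarrow> 0 < \<eta> \<Longrightarrow>
    \<forall>\<^sub>F n in sequentially. measure (Q n) {\<omega>\<in>space (Q n). ereal \<epsilon> < \<bar>X n \<omega>\<bar>} \<le> \<eta>"
  shows "op1 Q X"
  unfolding op1_def
proof (intro allI impI)
  fix \<epsilon> :: real assume e: "0 < \<epsilon>"
  show "(\<lambda>n. measure (Q n) {\<omega>\<in>space (Q n). ereal \<epsilon> < \<bar>X n \<omega>\<bar>}) \<longlonglongrightarrow> 0"
  proof (rule order_tendstoI)
    fix a :: real assume "0 < a"
    then have "\<forall>\<^sub>F n in sequentially. measure (Q n) {\<omega>\<in>space (Q n). ereal \<epsilon> < \<bar>X n \<omega>\<bar>} \<le> a / 2"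
      using assms[OF e, of "a / 2"] by simp
    then show "\<forall>\<^sub>F n in sequentially. measure (Q n) {\<omega>\<in>space (Q n). ereal \<epsilon> < \<bar>X n \<omega>\<bar>} < a"
      by (rule eventually_mono) (use \<open>0 < a\<close> in linarith)
  next
    fix a :: real assume "a < 0"
    then show "\<forall>\<^sub>F n in sequentially. a < measure (Q n) {\<omega>\<in>space (Q n). ereal \<epsilon> < \<bar>X n \<omega>\<bar>}"
      by (intro always_eventually allI less_le_trans[OF _ measure_nonneg])
  qed
qed

text \<open>
  (DET) is applied at the deterministic minimizer \<open>\<xi>\<close> of \<open>Rdet\<close> on the grid: its supremum over the
  grid dominates the probability at this \<open>\<xi>\<close>, and the number of bags does not
  grow with \<open>n\<close>, so a union bound over the bags suffices.
\<close>
lemma zs_excess_op1: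
  assumes S: "zero_step_setting E"
    and pos: "\<forall>\<^sub>F n in sequentially. \<forall>\<xi>\<in>grid E n. 0 < Rdet (sub_size E n \<xi>)"
    and O: "O1 E Rdet \<or> O2 E"
    and conv: "\<forall>y. convex_on UNIV (lossfun E y)" and DET: "DET E Rdet"
  shows "op1 (prob_of E) (\<lambda>n \<omega>. rel_excess (Risk E n (zs_predictor E n \<omega>)) (Rdet_min E Rdet n))"
proof (rule op1I)
  fix \<epsilon> \<eta> :: real assume e: "0 < \<epsilon>" and h: "0 < \<eta>"
  define \<delta> where "\<delta> = \<epsilon> / (6 + \<epsilon>)"
  define M where "M = real (bags E)"
  have d: "0 < \<delta>" using e by (simp add: \<delta>_def)
  have M: "1 \<le> M" using S by (simp add: zero_step_setting_def M_def)
  have h2: "0 < \<eta> / 2" "0 < \<eta> / (2 * M)" using h M by auto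
  define Z where "Z n \<xi> j = {\<omega>\<in>space (prob_of E n).
      ereal \<delta> < rel_dev (Risk E n (base_predictor E n \<xi> j \<omega>)) (Rdet (sub_size E n \<xi>))}" for n \<xi> j
  have "(\<lambda>n. SUP \<xi>\<in>grid E n. measure (prob_of E n) (Z n \<xi> 1)) \<longlonglongrightarrow> 0"
    using DET d unfolding DET_def Z_def by blast
  then have sup: "\<forall>\<^sub>F n in sequentially. (SUP \<xi>\<in>grid E n. measure (prob_of E n) (Z n \<xi> 1)) < \<eta> / (2 * M)"
    using h2(2) by (rule order_tendstoD(2))
  show "\<forall>\<^sub>F n in sequentially. measure (prob_of E n) {\<omega>\<in>space (prob_of E n).
      ereal \<epsilon> < \<bar>rel_excess (Risk E n (zs_predictor E n \<omega>)) (Rdet_min E Rdet n)\<bar>} \<le> \<eta>"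
    using eventually_est_close[OF S pos O h2(1) d] sup
  proof eventually_elim
    case (elim n)
    interpret zs_experiment_at E n using elim(1) by blast
    have r: "0 < Rdet_min E Rdet n" using elim(1) by blast
    obtain A where A: "A \<in> events" "prob A \<le> \<eta> / 2" and close: "\<And>\<omega>. \<omega> \<in> space (prob_of E n) - A \<Longrightarrow>
      \<forall>\<xi>\<in>grid E n. risk_estimated E n \<xi> \<omega> (\<delta> * (bagged_risk E n \<xi> \<omega> + Rdet_min E Rdet n))"
      using elim(1) by blast
    obtain \<xi> where \<xi>: "\<xi> \<in> grid E n" "Rdet (sub_size E n \<xi>) = Rdet_min E Rdet n"
      by (rule Rdet_min_attained)
    have Z: "Z n \<xi> j \<in> events" "prob (Z n \<xi> j) \<le> \<eta> / (2 * M)" if j: "j \<in> {1..bags E}" for j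
    proof -
      show "Z n \<xi> j \<in> events" unfolding Z_def by (rule rel_dev_event(1)[OF \<xi>(1) j])
      have "prob (Z n \<xi> j) = prob (Z n \<xi> 1)" unfolding Z_def by (rule rel_dev_event(2)[OF \<xi>(1) j])
      also have "\<dots> \<le> (SUP \<xi>\<in>grid E n. prob (Z n \<xi> 1))"
        using finite_grid by (intro cSUP_upper \<xi>(1)) auto
      finally show "prob (Z n \<xi> j) \<le> \<eta> / (2 * M)" using elim(2) by linarith
    qed
    define U where "U = (\<Union>j\<in>{1..bags E}. Z n \<xi> j)"
    have U: "U \<in> events" unfolding U_def by (intro sets.finite_UN Z) auto
    have "prob U \<le> (\<Sum>j\<in>{1..bags E}. prob (Z n \<xi> j))"
      unfolding U_def by (intro measure_UNION_le Z) auto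
    also have "\<dots> \<le> (\<Sum>j\<in>{1..bags E}. \<eta> / (2 * M))" by (intro sum_mono Z)
    also have "\<dots> = \<eta> / 2" using M by (simp add: M_def)
    finally have pU: "prob U \<le> \<eta> / 2" .
    have "{\<omega>\<in>space (prob_of E n).
        ereal \<epsilon> < \<bar>rel_excess (Risk E n (zs_predictor E n \<omega>)) (Rdet_min E Rdet n)\<bar>} \<subseteq> A \<union> U"
    proof
      fix \<omega> assume w: "\<omega> \<in> {\<omega>\<in>space (prob_of E n).
        ereal \<epsilon> < \<bar>rel_excess (Risk E n (zs_predictor E n \<omega>)) (Rdet_min E Rdet n)\<bar>}"
      show "\<omega> \<in> A \<union> U"
      proof (rule ccontr)
        assume n: "\<omega> \<notin> A \<union> U"
        have sp: "\<omega> \<in> space (prob_of E n)" using w by simp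
        have b: "Risk E n (base_predictor E n \<xi> j \<omega>) \<le> ennreal ((1 + \<delta>) * Rdet_min E Rdet n)"
          if j: "j \<in> {1..bags E}" for j
        proof -
          let ?R = "Risk E n (base_predictor E n \<xi> j \<omega>)"
          have "rel_dev ?R (Rdet_min E Rdet n) \<le> ereal \<delta>"
            using n j sp \<xi>(2) by (auto simp: U_def Z_def not_less)
          then have R: "?R \<noteq> \<infinity>" "enn2real ?R \<le> (1 + \<delta>) * Rdet_min E Rdet n"
            unfolding rel_dev_le_iff[OF r] by (auto simp: algebra_simps abs_le_iff)
          then show ?thesis by (metis ennreal_enn2real ennreal_leI infinity_ennreal_def less_top)
        qed
        have bb: "Risk E n (bagged_predictor E n \<xi> \<omega>) \<le> ennreal ((1 + \<delta>) * Rdet_min E Rdet n)"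
          by (rule Risk_bagged_le[OF _ \<xi>(1) sp b]) (use conv d r in auto)
        have "\<omega> \<in> space (prob_of E n) - A" using n sp by simp
        note zs = zs_risk_le[OF sp r e \<delta>_def close[OF this] \<xi>(1) bb]
        have "\<bar>rel_excess (Risk E n (zs_predictor E n \<omega>)) (Rdet_min E Rdet n)\<bar> \<le> ereal \<epsilon>"
          by (rule rel_excess_le[OF r zs]) (use e in simp)
        then show False using w by auto
      qed
    qed
    then have "prob {\<omega>\<in>space (prob_of E n).
        ereal \<epsilon> < \<bar>rel_excess (Risk E n (zs_predictor E n \<omega>)) (Rdet_min E Rdet n)\<bar>} \<le> prob (A \<union> U)"
      by (rule finite_measure_mono) (use A U in auto)
    also have "\<dots> \<le> prob A + prob U" using A U by (intro measure_Un_le)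
    finally show ?case using A(2) pU by linarith
  qed
qed

text \<open>
  The lower bound concerns the random grid point selected by the data, so it takes the uniform
  condition (DET*); the upper bound is the comparison with the deterministic minimizer as above.
\<close>
lemma zs_deviation_op1:
  assumes S: "zero_step_setting E"
    and pos: "\<forall>\<^sub>F n in sequentially. \<forall>\<xi>\<in>grid E n. 0 < Rdet (sub_size E n \<xi>)"
    and O: "O1 E Rdet \<or> O2 E"
    and one: "bags E = 1" and DET: "DET_star E Rdet"
  shows "op1 (prob_of E) (\<lambda>n \<omega>. rel_dev (Risk E n (zs_predictor E n \<omega>)) (Rdet_min E Rdet n))"
proof (rule op1I)
  fix \<epsilon> \<eta> :: real assume e: "0 < \<epsilon>" and h: "0 < \<eta>"
  define \<delta> where "\<delta> = \<epsilon> / (6 + \<epsilon>)"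
  have d: "0 < \<delta>" "\<delta> \<le> 1" "\<delta> \<le> \<epsilon>" using e by (auto simp: \<delta>_def field_simps)
  have h2: "0 < \<eta> / 2" using h by auto
  define U where "U n = {\<omega>\<in>space (prob_of E n). ereal \<delta> < (SUP \<xi>\<in>grid E n.
      rel_dev (Risk E n (base_predictor E n \<xi> 1 \<omega>)) (Rdet (sub_size E n \<xi>)))}" for n
  have "(\<lambda>n. measure (prob_of E n) (U n)) \<longlonglongrightarrow> 0"
    using DET d(1) unfolding DET_star_def U_def by blast
  then have sup: "\<forall>\<^sub>F n in sequentially. measure (prob_of E n) (U n) < \<eta> / 2"
    using h2 by (rule order_tendstoD(2))
  show "\<forall>\<^sub>F n in sequentially. measure (prob_of E n) {\<omega>\<in>space (prob_of E n).
      ereal \<epsilon> < \<bar>rel_dev (Risk E n (zs_predictor E n \<omega>)) (Rdet_min E Rdet n)\<bar>} \<le> \<eta>"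
    using eventually_est_close[OF S pos O h2 d(1)] sup pos
  proof eventually_elim
    case (elim n)
    interpret zs_experiment_at E n using elim(1) by blast
    have r: "0 < Rdet_min E Rdet n" using elim(1) by blast
    obtain A where A: "A \<in> events" "prob A \<le> \<eta> / 2" and close: "\<And>\<omega>. \<omega> \<in> space (prob_of E n) - A \<Longrightarrow>
      \<forall>\<xi>\<in>grid E n. risk_estimated E n \<xi> \<omega> (\<delta> * (bagged_risk E n \<xi> \<omega> + Rdet_min E Rdet n))"
      using elim(1) by blast
    have "U n = (\<Union>\<xi>\<in>grid E n. {\<omega>\<in>space (prob_of E n).
        ereal \<delta> < rel_dev (Risk E n (base_predictor E n \<xi> 1 \<omega>)) (Rdet (sub_size E n \<xi>))})"
      by (auto simp: U_def less_SUP_iff)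
    also have "\<dots> \<in> events"
      using finite_grid one by (intro sets.finite_UN rel_dev_event(1)) auto
    finally have U: "U n \<in> events" .
    have "{\<omega>\<in>space (prob_of E n).
        ereal \<epsilon> < \<bar>rel_dev (Risk E n (zs_predictor E n \<omega>)) (Rdet_min E Rdet n)\<bar>} \<subseteq> A \<union> U n"
    proof
      fix \<omega> assume w: "\<omega> \<in> {\<omega>\<in>space (prob_of E n).
        ereal \<epsilon> < \<bar>rel_dev (Risk E n (zs_predictor E n \<omega>)) (Rdet_min E Rdet n)\<bar>}"
      show "\<omega> \<in> A \<union> U n"
      proof (rule ccontr)
        assume nm: "\<omega> \<notin> A \<union> U n"
        have sp: "\<omega> \<in> space (prob_of E n)" using w by simp
        have dev: "Risk E n (bagged_predictor E n \<xi> \<omega>) \<noteq> \<infinity>"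
          "\<bar>bagged_risk E n \<xi> \<omega> - Rdet (sub_size E n \<xi>)\<bar> \<le> \<delta> * Rdet (sub_size E n \<xi>)"
          if x: "\<xi> \<in> grid E n" for \<xi>
        proof -
          have "(SUP \<xi>\<in>grid E n. rel_dev (Risk E n (base_predictor E n \<xi> 1 \<omega>)) (Rdet (sub_size E n \<xi>))) \<le> ereal \<delta>"
            using nm sp by (simp add: U_def not_less)
          then have "rel_dev (Risk E n (base_predictor E n \<xi> 1 \<omega>)) (Rdet (sub_size E n \<xi>)) \<le> ereal \<delta>"
            using x by (simp add: SUP_le_iff)
          then have "rel_dev (Risk E n (bagged_predictor E n \<xi> \<omega>)) (Rdet (sub_size E n \<xi>)) \<le> ereal \<delta>"
            by (simp add: bagged_predictor_single[OF one])
          moreover have "0 < Rdet (sub_size E n \<xi>)" using elim(3) x by blast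
          ultimately show "Risk E n (bagged_predictor E n \<xi> \<omega>) \<noteq> \<infinity>"
            "\<bar>bagged_risk E n \<xi> \<omega> - Rdet (sub_size E n \<xi>)\<bar> \<le> \<delta> * Rdet (sub_size E n \<xi>)"
            using rel_dev_le_iff by blast+
        qed
        obtain \<xi> where \<xi>: "\<xi> \<in> grid E n" "Rdet (sub_size E n \<xi>) = Rdet_min E Rdet n"
          by (rule Rdet_min_attained)
        have "bagged_risk E n \<xi> \<omega> \<le> (1 + \<delta>) * Rdet_min E Rdet n"
          using dev(2)[OF \<xi>(1)] unfolding \<xi>(2) by (simp add: algebra_simps abs_le_iff)
        then have bb: "Risk E n (bagged_predictor E n \<xi> \<omega>) \<le> ennreal ((1 + \<delta>) * Rdet_min E Rdet n)"
          using dev(1)[OF \<xi>(1)] by (metis ennreal_enn2real ennreal_leI infinity_ennreal_def less_top)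
        have "\<omega> \<in> space (prob_of E n) - A" using nm sp by simp
        note zs = zs_risk_le[OF sp r e \<delta>_def close[OF this] \<xi>(1) bb]
        let ?x = "xihat E n \<omega>"
        have x: "?x \<in> grid E n" by (rule xihat_mem[OF sp])
        have "(1 - \<delta>) * Rdet_min E Rdet n \<le> (1 - \<delta>) * Rdet (sub_size E n ?x)"
          using d Rdet_min_le[OF x] by (intro mult_left_mono) auto
        also have "\<dots> \<le> enn2real (Risk E n (zs_predictor E n \<omega>))"
          using dev(2)[OF x] by (simp add: zs_predictor_def algebra_simps abs_le_iff)
        finally have low: "(1 - \<delta>) * Rdet_min E Rdet n \<le> enn2real (Risk E n (zs_predictor E n \<omega>))" .
        have "\<delta> * Rdet_min E Rdet n \<le> \<epsilon> * Rdet_min E Rdet n"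
          using d(3) r by (intro mult_right_mono) auto
        then have "\<bar>enn2real (Risk E n (zs_predictor E n \<omega>)) - Rdet_min E Rdet n\<bar> \<le> \<epsilon> * Rdet_min E Rdet n"
          using low zs(2) by (simp add: algebra_simps abs_le_iff)
        then have "rel_dev (Risk E n (zs_predictor E n \<omega>)) (Rdet_min E Rdet n) \<le> ereal \<epsilon>"
          using rel_dev_le_iff[OF r] zs(1) by blast
        then show False using w r by auto
      qed
    qed
    then have "prob {\<omega>\<in>space (prob_of E n).
        ereal \<epsilon> < \<bar>rel_dev (Risk E n (zs_predictor E n \<omega>)) (Rdet_min E Rdet n)\<bar>} \<le> prob (A \<union> U n)"
      by (rule finite_measure_mono) (use A U in auto)
    also have "\<dots> \<le> prob A + prob (U n)" using A U by (intro measure_Un_le)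
    finally show ?case using A(2) elim(2) by linarith
  qed
qed

theorem theorem3p4:
  fixes E :: "'w zero_step" and Rdet :: "nat \<Rightarrow> real"
  assumes "zero_step_setting E"
    and "\<forall>m. 0 \<le> Rdet m"
    and "\<forall>\<^sub>F n in sequentially. \<forall>\<xi>\<in>grid E n. 0 < Rdet (sub_size E n \<xi>)"
  shows
    "(bags E = 1 \<longrightarrow> DET_star E Rdet \<longrightarrow> O1 E Rdet \<or> O2 E \<longrightarrow>
        op1 (prob_of E) (\<lambda>n \<omega>. rel_dev (Risk E n (zs_predictor E n \<omega>)) (Rdet_min E Rdet n)))
     \<and>
     ((\<forall>y. convex_on UNIV (lossfun E y)) \<longrightarrow> DET E Rdet \<longrightarrow> O1 E Rdet \<or> O2 E \<longrightarrow>
        op1 (prob_of E) (\<lambda>n \<omega>. rel_excess (Risk E n (zs_predictor E n \<omega>)) (Rdet_min E Rdet n)))"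
  using zs_deviation_op1[OF assms(1,3)] zs_excess_op1[OF assms(1,3)] by blast

end
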